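(* Let $n\geq 3$ be an integer, and let $I=J_{n,1,(n-1)^{n-2}}$ be the ideal of the union of $(n-1)^{n-2}$ general lines in $\mathbb{P}^n$. Then $$\gamma(I)=g_{n,1,(n-1)^{n-2}}=n-1.$$
   Context: $k$ is an algebraically closed field, $\mathbb{P}^n=\mathbb{P}^n_k$ and $k[\mathbb{P}^n]=k[x_0,\ldots,x_n]$ with the standard grading. For a nonzero homogeneous ideal $J$, $\alpha(J)$ is the least degree of a nonzero form in $J$, and $\gamma(J)=\lim_{m\to\infty}\alpha(J^{(m)})/m=\inf_{m\ge1}\alpha(J^{(m)})/m$, where $J^{(m)}$ is the $m$th symbolic power. $J_{n,r,s}$ denotes the ideal of the union of $s$ general (generic) $r$-dimensional linear subspaces $L_1,\dots,L_s$ of $\mathbb{P}^n$, with $n\ge 2r+1$; then $J_{n,r,s}^{(m)}=I(L_1)^m\cap\cdots\cap I(L_s)^m$. Genericity is understood in the usual sense: for each $m$, $\alpha(J_{n,r,s}^{(m)})$ is the value attained for all $(L_1,\ldots,L_s)$ in a nonempty Zariski open subset (possibly depending on $m$) of the product of Grassmannians parametrizing $s$-tuples of $r$-planes. For a positive integer $m$ let $$c_{n,r,m,t}=\sum_{0\leq i<m}\binom{t-i+r}{r}\binom{i+n-r-1}{n-r-1},$$ regarded as a polynomial in $t$ (with $\binom{x+a}{a}=\frac{(x+a)\cdots(x+1)}{a!}$), and let $P_{n,r,s,m}(t)=\binom{t+n}{n}-s\,c_{n,r,m,t}$. Then $P_{n,r,s,m}(m\tau)$ is a polynomial in $m$ of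 degree $n$ with coefficients in $\mathbb{Q}[\tau]$; $\Lambda_{n,r,s}(\tau)$ denotes the coefficient of $m^n$ in it, and $g_{n,r,s}$ denotes the largest real root of $\Lambda_{n,r,s}$. *)

theory Defs
  imports
    Complex_Main
    "HOL-Library.FuncSet"
    "HOL-Library.Function_Algebras"
    "HOL-Library.Poly_Mapping"
    "HOL-Computational_Algebra.Polynomial"
    "HOL-Algebra.Ideal_Product"
begin

section \<open>Polynomials in several variables\<close>

text \<open>
  A polynomial is a finitely supported map from exponent vectors to coefficients;
  multiplication is the convolution product of \<^theory>\<open>HOL-Library.Poly_Mapping\<close>.
\<close>

type_synonym ('v, 'k) mpoly = "('v \<Rightarrow>\<^sub>0 nat) \<Rightarrow>\<^sub>0 'k"

definition mpolys :: "'v set \<Rightarrow> ('v, 'k::zero) mpoly set" where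
  "mpolys X = {p. \<forall>\<mu>\<in>Poly_Mapping.keys p. Poly_Mapping.keys \<mu> \<subseteq> X}"

definition mpoly_eval :: "('v \<Rightarrow> 'k) \<Rightarrow> ('v, 'k::comm_ring_1) mpoly \<Rightarrow> 'k" where
  "mpoly_eval a p =
     (\<Sum>\<mu>\<in>Poly_Mapping.keys p.
        Poly_Mapping.lookup p \<mu> * (\<Prod>x\<in>Poly_Mapping.keys \<mu>. a x ^ Poly_Mapping.lookup \<mu> x))"

definition is_form :: "nat \<Rightarrow> ('v, 'k::zero) mpoly \<Rightarrow> bool" where
  "is_form d p \<longleftrightarrow>
     (\<forall>\<mu>\<in>Poly_Mapping.keys p. (\<Sum>x\<in>Poly_Mapping.keys \<mu>. Poly_Mapping.lookup \<mu> x) = d)"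

definition coord_ring :: "nat \<Rightarrow> (nat, 'k::comm_ring_1) mpoly ring" where
  "coord_ring n = \<lparr>carrier = mpolys {..n}, mult = (*), one = 1, zero = 0, add = (+)\<rparr>"

lemma mpolys_mult:
  fixes p q :: "('v, 'k::comm_ring_1) mpoly"
  assumes "p \<in> mpolys X" "q \<in> mpolys X"
  shows "p * q \<in> mpolys X"
proof -
  have "Poly_Mapping.keys \<mu> \<subseteq> X" if \<mu>: "\<mu> \<in> Poly_Mapping.keys (p * q)" for \<mu>
  proof -
    obtain a b where "\<mu> = a + b" "a \<in> Poly_Mapping.keys p" "b \<in> Poly_Mapping.keys q"
      using \<mu> keys_mult[of p q] by blast
    then show ?thesis
      using assms Poly_Mapping.keys_add[of a b] unfolding mpolys_def by blast
  qed
  then show ?thesis by (simp add: mpolys_def)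
qed

lemma coord_ring_cring: "cring (coord_ring n :: (nat, 'k::comm_ring_1) mpoly ring)"
proof (rule cringI)
  let ?R = "coord_ring n :: (nat, 'k) mpoly ring"
  have add: "p + q \<in> mpolys {..n}" if "p \<in> mpolys {..n}" "q \<in> mpolys {..n}"
    for p q :: "(nat, 'k) mpoly"
    using that Poly_Mapping.keys_add[of p q] unfolding mpolys_def by blast
  have uminus: "- p \<in> mpolys {..n}" if "p \<in> mpolys {..n}" for p :: "(nat, 'k) mpoly"
    using that by (simp add: mpolys_def)
  have zero: "0 \<in> mpolys {..n}" and one: "1 \<in> mpolys {..n}"
    by (simp_all add: mpolys_def)
  show "abelian_group ?R"
  proof (rule abelian_groupI)
    fix x assume "x \<in> carrier ?R"
    then show "\<exists>y\<in>carrier ?R. y \<oplus>\<^bsub>?R\<^esub> x = \<zero>\<^bsub>?R\<^esub>"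
      using uminus by (intro bexI[of _ "- x"]) (auto simp: coord_ring_def)
  qed (auto simp: coord_ring_def add zero add_ac)
  show "Group.comm_monoid ?R"
    by (rule comm_monoidI) (auto simp: coord_ring_def mpolys_mult one mult_ac)
qed (auto simp: coord_ring_def distrib_right)


section \<open>Symbolic powers and the initial degree\<close>

primrec ideal_power :: "('a, 'b) ring_scheme \<Rightarrow> 'a set \<Rightarrow> nat \<Rightarrow> 'a set" where
  "ideal_power R I 0 = carrier R"
| "ideal_power R I (Suc m) = ideal_prod R (ideal_power R I m) I"

definition assoc_prime :: "('a, 'b) ring_scheme \<Rightarrow> 'a set \<Rightarrow> 'a set \<Rightarrow> bool" where
  "assoc_prime R J P \<longleftrightarrow>
     primeideal P R \<and> (\<exists>x\<in>carrier R. P = {a \<in> carrier R. a \<otimes>\<^bsub>R\<^esub> x \<in> J})"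

text \<open>
  \<open>J\<^sup>(\<^sup>m\<^sup>)\<close> is the intersection of the contractions to \<open>R\<close> of \<open>J\<^sup>m R\<^sub>P\<close>, for \<open>P\<close> ranging over
  the associated primes of \<open>J\<close>; an element \<open>f\<close> of \<open>R\<close> lies in the contraction of \<open>J\<^sup>m R\<^sub>P\<close>
  iff \<open>u f \<in> J\<^sup>m\<close> for some \<open>u\<close> outside \<open>P\<close>.
\<close>

definition symbolic_power :: "('a, 'b) ring_scheme \<Rightarrow> 'a set \<Rightarrow> nat \<Rightarrow> 'a set" where
  "symbolic_power R J m =
     {f \<in> carrier R. \<forall>P. assoc_prime R J P \<longrightarrow>
        (\<exists>u\<in>carrier R - P. u \<otimes>\<^bsub>R\<^esub> f \<in> ideal_power R J m)}"

definition alpha :: "(nat, 'k::zero) mpoly set \<Rightarrow> nat" where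
  "alpha J = (LEAST d. \<exists>f\<in>J. f \<noteq> 0 \<and> is_form d f)"


section \<open>Tuples of linear subspaces of projective space\<close>

text \<open>
  The space \<open>k\<^sup>n\<^sup>+\<^sup>1\<close> consists of the sequences that vanish beyond index \<open>n\<close>, and a linear
  subspace of projective \<open>n\<close>-space is represented by its affine cone.
\<close>

global_interpretation kvec: vector_space "\<lambda>(c::'k::field) (v::nat \<Rightarrow> 'k) i. c * v i"
  by unfold_locales (auto simp: fun_eq_iff algebra_simps)

definition planes :: "nat \<Rightarrow> nat \<Rightarrow> (nat \<Rightarrow> 'k::field) set set" where
  "planes n r = {V. kvec.subspace V \<and> (\<forall>v\<in>V. \<forall>i>n. v i = 0) \<and> kvec.dim V = r + 1}"

definition plane_tuples :: "nat \<Rightarrow> nat \<Rightarrow> nat \<Rightarrow> (nat \<Rightarrow> (nat \<Rightarrow> 'k::field) set) set" where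
  "plane_tuples n r s = (\<Pi>\<^sub>E l\<in>{..<s}. planes n r)"

definition spanned_tuple ::
  "nat \<Rightarrow> nat \<Rightarrow> nat \<Rightarrow> (nat \<times> nat \<times> nat \<Rightarrow> 'k::field) \<Rightarrow> nat \<Rightarrow> (nat \<Rightarrow> 'k) set" where
  "spanned_tuple n r s b =
     (\<lambda>l\<in>{..<s}. kvec.span ((\<lambda>j i. if i \<le> n then b (l, j, i) else 0) ` {..r}))"

text \<open>
  The Grassmannian of \<open>r\<close>-planes is the quotient of the space of \<open>(r + 1) \<times> (n + 1)\<close>
  matrices of full rank by the action of the general linear group on the rows, and it carries the
  quotient topology. Hence a set of \<open>s\<close>-tuples of \<open>r\<close>-planes is Zariski open in the
  product of Grassmannians iff its preimage in the space of \<open>s\<close>-tuples of full-rank matrices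
  is Zariski open. In \<open>b (l, j, i)\<close> the index \<open>l\<close> selects the plane, \<open>j\<close> the row and \<open>i\<close> the
  column; the condition \<open>spanned_tuple n r s b \<in> plane_tuples n r s\<close> says that all \<open>s\<close>
  matrices have full rank.
\<close>

definition zariski_open :: "nat \<Rightarrow> nat \<Rightarrow> nat \<Rightarrow> (nat \<Rightarrow> (nat \<Rightarrow> 'k::field) set) set \<Rightarrow> bool" where
  "zariski_open n r s U \<longleftrightarrow> U \<subseteq> plane_tuples n r s \<and>
     (\<exists>F \<subseteq> mpolys ({..<s} \<times> {..r} \<times> {..n}).
        \<forall>b. spanned_tuple n r s b \<in> plane_tuples n r s \<longrightarrow>
          (spanned_tuple n r s b \<in> U \<longleftrightarrow> (\<exists>f\<in>F. mpoly_eval b f \<noteq> 0)))"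

definition for_general ::
  "nat \<Rightarrow> nat \<Rightarrow> nat \<Rightarrow> ((nat \<Rightarrow> (nat \<Rightarrow> 'k::field) set) \<Rightarrow> bool) \<Rightarrow> bool" where
  "for_general n r s Q \<longleftrightarrow> (\<exists>U. zariski_open n r s U \<and> U \<noteq> {} \<and> (\<forall>L\<in>U. Q L))"

definition vanishing_ideal :: "nat \<Rightarrow> (nat \<Rightarrow> 'k::field) set \<Rightarrow> (nat, 'k) mpoly set" where
  "vanishing_ideal n V = {p \<in> mpolys {..n}. \<forall>v\<in>V. mpoly_eval v p = 0}"

definition union_ideal ::
  "nat \<Rightarrow> nat \<Rightarrow> (nat \<Rightarrow> (nat \<Rightarrow> 'k::field) set) \<Rightarrow> (nat, 'k) mpoly set" where
  "union_ideal n s L = vanishing_ideal n (\<Union>l<s. L l)"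

text \<open>
  The ideal \<open>J\<close> of \<open>s\<close> general \<open>r\<close>-planes enters only through the general value of
  \<open>alpha\<close> of its \<open>m\<close>-th symbolic power. The open set on which this value is attained may depend
  on \<open>m\<close>. The first argument only fixes the ground field.
\<close>

definition general_alpha :: "'k::field itself \<Rightarrow> nat \<Rightarrow> nat \<Rightarrow> nat \<Rightarrow> nat \<Rightarrow> nat" where
  "general_alpha _ n r s m =
     (THE a. for_general n r s (\<lambda>L :: nat \<Rightarrow> (nat \<Rightarrow> 'k) set.
        alpha (symbolic_power (coord_ring n) (union_ideal n s L) m) = a))"

definition general_gamma :: "'k::field itself \<Rightarrow> nat \<Rightarrow> nat \<Rightarrow> nat \<Rightarrow> real" where
  "general_gamma K n r s = lim (\<lambda>m. real (general_alpha K n r s m) / real m)"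


section \<open>The expected value\<close>

text \<open>The polynomial \<open>(x + a) \<cdots> (x + 1) / a!\<close> in \<open>x\<close>.\<close>

definition binom_poly :: "nat \<Rightarrow> real poly" where
  "binom_poly a = smult (1 / fact a) (\<Prod>j=1..a. [:real j, 1:])"

definition c_poly :: "nat \<Rightarrow> nat \<Rightarrow> nat \<Rightarrow> real poly" where
  "c_poly n r m =
     (\<Sum>i<m. smult (real ((i + (n - r - 1)) choose (n - r - 1)))
               (pcompose (binom_poly r) [:- real i, 1:]))"

definition P_poly :: "nat \<Rightarrow> nat \<Rightarrow> nat \<Rightarrow> nat \<Rightarrow> real poly" where
  "P_poly n r s m = binom_poly n - smult (real s) (c_poly n r m)"

text \<open>
  The bivariate polynomial \<open>Q\<close> below is \<open>P\<^sub>m(m \<tau>)\<close> as a polynomial in \<open>m\<close> (the outer variable)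
  with coefficients in the polynomial ring in \<open>\<tau>\<close> (the inner variable); it is determined by its
  values at the positive integers.
\<close>

definition Lambda_poly :: "nat \<Rightarrow> nat \<Rightarrow> nat \<Rightarrow> real poly" where
  "Lambda_poly n r s =
     coeff (THE Q :: real poly poly.
              \<forall>m\<ge>1. poly Q [:real m:] = pcompose (P_poly n r s m) [:0, real m:]) n"

definition g_root :: "nat \<Rightarrow> nat \<Rightarrow> nat \<Rightarrow> real" where
  "g_root n r s = (GREATEST x. poly (Lambda_poly n r s) x = 0)"

end

theory Submission
  imports Defs "HOL-Library.Infinite_Typeclass"
begin

text \<open>
  Let \<open>d = n - 1\<close> and \<open>s = d\<^sup>n\<^sup>-\<^sup>2\<close>. Up to the factor \<open>1 / n!\<close> the polynomial \<open>\<Lambda>\<close> is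
  \<open>\<tau>\<^sup>n - s (n \<tau> - d)\<close>; it vanishes at \<open>d\<close> and is positive to the right of \<open>d\<close>
  (\<open>Lambda_poly_lines\<close>, \<open>expected_polynomial_pos\<close>), so \<open>g = d\<close>. It remains to show that the general
  value of \<open>\<alpha>(J\<^sup>(\<^sup>m\<^sup>))\<close> is asymptotic to \<open>m d\<close>.

  For the upper bound, multiplicity \<open>m\<close> along a line imposes at most \<open>line_conditions n m t\<close> linear
  conditions on forms of degree \<open>t\<close>. If \<open>t\<close> is about \<open>(d + \<epsilon>) m\<close>, then for large \<open>m\<close> there are more coefficients than
  conditions, precisely because \<open>\<Lambda>(d + \<epsilon>) > 0\<close> (\<open>form_of_high_order_exists\<close>,
  \<open>eventually_form_count\<close>).

  For the lower bound, \<open>\<alpha>\<close> can only drop under specialization (\<open>general_alpha_bounds\<close>), so a single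
  tuple of lines without forms of degree less than \<open>m d\<close> suffices. Write \<open>x\<^sub>0, \<dots>, x\<^sub>n\<^sub>-\<^sub>2, y, z\<close> for
  the coordinates. The hypersurface \<open>W = \<Sum>j\<le>n-2. x\<^sub>j z\<^sup>j y\<^sup>n\<^sup>-\<^sup>2\<^sup>-\<^sup>j\<close> of degree \<open>d\<close> is swept out by a
  pencil of linear spaces of dimension \<open>n - 2\<close>, one for each value of \<open>(y : z)\<close>. There are lines on
  \<open>W\<close> that meet each of these spaces in the points of a grid, the product of \<open>n - 2\<close> copies of a set
  with \<open>d\<close> elements; their number is \<open>d\<^sup>n\<^sup>-\<^sup>2 = s\<close>. A polynomial of degree less than \<open>m d\<close> with
  multiplicity \<open>m\<close> on the grid is zero (\<open>grid_vanish\<close>). So a form of degree less than \<open>m d\<close> with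
  multiplicity \<open>m\<close> along the lines vanishes on \<open>W\<close>; dividing it by \<open>W\<close> lowers the degree by \<open>d\<close> and the
  multiplicities by one, and induction on \<open>m\<close> shows that it is zero (\<open>scroll_vanish\<close>,
  \<open>scroll_lines_vanish\<close>).

  Two translations connect this with the definitions. The symbolic power of the ideal of a union
  of lines consists of the polynomials with multiplicity \<open>m\<close> at each point of each line
  (\<open>symbolic_power_iff\<close>). Multiplicity and degree are read off from restrictions to affine lines,
  and identities are extended from generic points to all points because the ground field is
  infinite (\<open>polyfun_density\<close>).
\<close>

section \<open>Polynomial functions\<close>

text \<open>
  Over a finite field the product of all \<open>x - a\<close>, plus one, has no root.
\<close>
instance alg_closed_field \<subseteq> infinite
proof
  show "infinite (UNIV :: 'a set)"
  proof
    assume fin: "finite (UNIV :: 'a set)"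
    define p :: "'a poly" where "p = (\<Prod>a\<in>UNIV. [:- a, 1:]) + 1"
    have "degree (\<Prod>a\<in>(UNIV::'a set). [:- a, 1:]) = card (UNIV :: 'a set)"
      by (subst degree_prod_eq_sum_degree) auto
    moreover have "card (UNIV :: 'a set) > 0"
      using fin by (simp add: finite_UNIV_card_ge_0)
    ultimately have "degree p > 0"
      unfolding p_def by (subst degree_add_eq_left) auto
    then obtain x where "poly p x = 0"
      using alg_closed_imp_poly_has_root by blast
    moreover have "poly (\<Prod>a\<in>UNIV. [:- a, 1:]) x = 0"
      using fin by (auto simp: poly_prod prod_zero_iff)
    ultimately show False by (simp add: p_def)
  qed
qed

text \<open>
  Polynomial functions are needed both on the space of points and on the space of tuples of
  matrices that span the lines. Generating them from an arbitrary set \<open>C\<close> of functions makes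
  every substitution argument an induction over this set.
\<close>
inductive_set polyfun :: "('t \<Rightarrow> 'k::comm_ring_1) set \<Rightarrow> ('t \<Rightarrow> 'k) set"
  for C :: "('t \<Rightarrow> 'k) set" where
  const: "(\<lambda>_. c) \<in> polyfun C"
| gen: "g \<in> C \<Longrightarrow> g \<in> polyfun C"
| add: "f \<in> polyfun C \<Longrightarrow> g \<in> polyfun C \<Longrightarrow> (\<lambda>t. f t + g t) \<in> polyfun C"
| mult: "f \<in> polyfun C \<Longrightarrow> g \<in> polyfun C \<Longrightarrow> (\<lambda>t. f t * g t) \<in> polyfun C"

definition coords :: "'v set \<Rightarrow> (('v \<Rightarrow> 'k) \<Rightarrow> 'k) set" where
  "coords X = (\<lambda>x a. a x) ` X"

lemma polyfun_coord: "x \<in> X \<Longrightarrow> (\<lambda>a. a x) \<in> polyfun (coords X)"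
  by (rule polyfun.gen) (auto simp: coords_def)

lemma polyfun_uminus:
  assumes "f \<in> polyfun C" shows "(\<lambda>t. - f t) \<in> polyfun C"
  using polyfun.mult[OF polyfun.const[of "-1"] assms] by simp

lemma polyfun_diff:
  assumes "f \<in> polyfun C" "g \<in> polyfun C" shows "(\<lambda>t. f t - g t) \<in> polyfun C"
  using polyfun.add[OF assms(1) polyfun_uminus[OF assms(2)]] by simp

lemma polyfun_sum:
  assumes "\<And>i. i \<in> I \<Longrightarrow> f i \<in> polyfun C" shows "(\<lambda>t. \<Sum>i\<in>I. f i t) \<in> polyfun C"
  using assms by (induction I rule: infinite_finite_induct) (auto intro: polyfun.intros)

lemma polyfun_prod:
  assumes "\<And>i. i \<in> I \<Longrightarrow> f i \<in> polyfun C" shows "(\<lambda>t. \<Prod>i\<in>I. f i t) \<in> polyfun C"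
  using assms by (induction I rule: infinite_finite_induct) (auto intro: polyfun.intros)

lemma polyfun_power:
  assumes "f \<in> polyfun C" shows "(\<lambda>t. f t ^ e) \<in> polyfun C"
  using assms by (induction e) (auto intro: polyfun.intros)

lemmas polyfun_intros = polyfun.const polyfun.add polyfun.mult polyfun_coord polyfun_uminus
  polyfun_diff polyfun_sum polyfun_prod polyfun_power

lemma polyfun_compose:
  assumes "f \<in> polyfun (coords X)" "\<And>x. x \<in> X \<Longrightarrow> (\<lambda>t. \<sigma> t x) \<in> polyfun C"
  shows "(\<lambda>t. f (\<sigma> t)) \<in> polyfun C"
  using assms(1)
  by induction (auto simp: coords_def intro: polyfun.intros assms(2))

lemma polyfun_mono: "f \<in> polyfun C \<Longrightarrow> C \<subseteq> D \<Longrightarrow> f \<in> polyfun D"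
  by (induction rule: polyfun.induct) (auto intro: polyfun.intros)

lemma polyfun_coords_UNIV: "f \<in> polyfun (coords X) \<Longrightarrow> f \<in> polyfun (coords UNIV)"
  by (erule polyfun_mono) (auto simp: coords_def)

lemma polyfun_cong_on:
  assumes "f \<in> polyfun (coords X)" "\<And>x. x \<in> X \<Longrightarrow> a x = b x" shows "f a = f b"
  using assms by (induction rule: polyfun.induct) (auto simp: coords_def)


section \<open>Evaluation of polynomials\<close>

definition mono_eval :: "('v \<Rightarrow> 'k::comm_ring_1) \<Rightarrow> ('v \<Rightarrow>\<^sub>0 nat) \<Rightarrow> 'k" where
  "mono_eval a \<mu> = (\<Prod>x\<in>Poly_Mapping.keys \<mu>. a x ^ Poly_Mapping.lookup \<mu> x)"

lemma mono_eval_superset: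
  assumes "finite K" "Poly_Mapping.keys \<mu> \<subseteq> K"
  shows "mono_eval a \<mu> = (\<Prod>x\<in>K. a x ^ Poly_Mapping.lookup \<mu> x)"
  unfolding mono_eval_def by (rule prod.mono_neutral_left) (use assms in \<open>auto simp: in_keys_iff\<close>)

lemma mono_eval_add: "mono_eval a (\<mu> + \<nu>) = mono_eval a \<mu> * mono_eval a \<nu>"
proof -
  let ?K = "Poly_Mapping.keys \<mu> \<union> Poly_Mapping.keys \<nu>"
  have "Poly_Mapping.keys (\<mu> + \<nu>) \<subseteq> ?K" by (rule Poly_Mapping.keys_add)
  then show ?thesis
    by (simp add: mono_eval_superset[of ?K] lookup_add power_add prod.distrib)
qed

lemma mono_eval_0 [simp]: "mono_eval a 0 = 1"
  by (simp add: mono_eval_def)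

lemma mpoly_eval_superset:
  assumes "finite M" "Poly_Mapping.keys p \<subseteq> M"
  shows "mpoly_eval a p = (\<Sum>\<mu>\<in>M. Poly_Mapping.lookup p \<mu> * mono_eval a \<mu>)"
  unfolding mpoly_eval_def mono_eval_def[symmetric]
  by (rule sum.mono_neutral_left) (use assms in \<open>auto simp: in_keys_iff\<close>)

lemma mpoly_eval_altdef:
  "mpoly_eval a p = (\<Sum>\<mu>\<in>Poly_Mapping.keys p. Poly_Mapping.lookup p \<mu> * mono_eval a \<mu>)"
  by (rule mpoly_eval_superset) auto

lemma mpoly_eval_0 [simp]: "mpoly_eval a 0 = 0"
  by (simp add: mpoly_eval_def)

lemma mpoly_eval_add: "mpoly_eval a (p + q) = mpoly_eval a p + mpoly_eval a q"
proof -
  let ?M = "Poly_Mapping.keys p \<union> Poly_Mapping.keys q"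
  have "Poly_Mapping.keys (p + q) \<subseteq> ?M" by (rule Poly_Mapping.keys_add)
  then show ?thesis
    by (simp add: mpoly_eval_superset[of ?M] lookup_add ring_distribs sum.distrib)
qed

lemma mpoly_eval_sum: "mpoly_eval a (\<Sum>i\<in>I. p i) = (\<Sum>i\<in>I. mpoly_eval a (p i))"
  by (induction I rule: infinite_finite_induct) (auto simp: mpoly_eval_add)

lemma mpoly_eval_single: "mpoly_eval a (Poly_Mapping.single \<mu> c) = c * mono_eval a \<mu>"
  by (subst mpoly_eval_superset[of "{\<mu>}"]) (auto simp: lookup_single_eq)

lemma mpoly_eval_1 [simp]: "mpoly_eval a 1 = 1"
  by (metis mpoly_eval_single mono_eval_0 mult_1 single_one)

lemma mpoly_sum_monomials:
  fixes p :: "('v, 'k::comm_ring_1) mpoly"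
  assumes "finite M" "Poly_Mapping.keys p \<subseteq> M"
  shows "p = (\<Sum>\<mu>\<in>M. Poly_Mapping.single \<mu> (Poly_Mapping.lookup p \<mu>))"
proof (rule poly_mapping_eqI)
  fix \<nu>
  show "Poly_Mapping.lookup p \<nu> =
     Poly_Mapping.lookup (\<Sum>\<mu>\<in>M. Poly_Mapping.single \<mu> (Poly_Mapping.lookup p \<mu>)) \<nu>"
    using assms by (auto simp: lookup_sum lookup_single when_def sum.delta in_keys_iff)
qed

lemma mpoly_eval_mult: "mpoly_eval a (p * q) = mpoly_eval a p * mpoly_eval a q"
proof -
  have "p * q = (\<Sum>\<mu>\<in>Poly_Mapping.keys p. Poly_Mapping.single \<mu> (Poly_Mapping.lookup p \<mu>)) *
     (\<Sum>\<mu>\<in>Poly_Mapping.keys q. Poly_Mapping.single \<mu> (Poly_Mapping.lookup q \<mu>))"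
    by (simp flip: mpoly_sum_monomials)
  also have "mpoly_eval a \<dots> = mpoly_eval a p * mpoly_eval a q"
    by (simp add: sum_product mpoly_eval_sum mult_single mpoly_eval_single mono_eval_add
        mpoly_eval_altdef[of a p] mpoly_eval_altdef[of a q] mult_ac)
  finally show ?thesis .
qed

lemma mpoly_eval_uminus: "mpoly_eval a (- p) = - mpoly_eval a p"
  by (simp add: mpoly_eval_def sum_negf)

lemma mpoly_eval_prod: "mpoly_eval a (\<Prod>i\<in>I. p i) = (\<Prod>i\<in>I. mpoly_eval a (p i))"
  by (induction I rule: infinite_finite_induct) (auto simp: mpoly_eval_mult)

lemma mpoly_eval_power: "mpoly_eval a (p ^ e) = mpoly_eval a p ^ e"
  by (induction e) (auto simp: mpoly_eval_mult)

definition mpoly_var :: "'v \<Rightarrow> ('v, 'k::comm_ring_1) mpoly" where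
  "mpoly_var x = Poly_Mapping.single (Poly_Mapping.single x 1) 1"

definition mpoly_const :: "'k \<Rightarrow> ('v, 'k::comm_ring_1) mpoly" where
  "mpoly_const c = Poly_Mapping.single 0 c"

lemma mpoly_eval_var [simp]: "mpoly_eval a (mpoly_var x) = a x"
  by (simp add: mpoly_var_def mpoly_eval_single mono_eval_def)

lemma mpoly_eval_const [simp]: "mpoly_eval a (mpoly_const c) = c"
  by (simp add: mpoly_const_def mpoly_eval_single)

lemma mpolys_add: "p \<in> mpolys X \<Longrightarrow> q \<in> mpolys X \<Longrightarrow> p + q \<in> mpolys X"
  using Poly_Mapping.keys_add[of p q] unfolding mpolys_def by blast

lemma mpolys_uminus: "p \<in> mpolys X \<Longrightarrow> - p \<in> mpolys X" for p :: "('v, 'k::comm_ring_1) mpoly"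
  by (simp add: mpolys_def)

lemma mpolys_0 [simp]: "0 \<in> mpolys X" by (simp add: mpolys_def)

lemma mpolys_1 [simp]: "1 \<in> mpolys X" by (simp add: mpolys_def)

lemma mpolys_prod: "(\<And>i. i \<in> I \<Longrightarrow> p i \<in> mpolys X) \<Longrightarrow> (\<Prod>i\<in>I. p i) \<in> mpolys X"
  for p :: "'i \<Rightarrow> ('v, 'k::comm_ring_1) mpoly"
  by (induction I rule: infinite_finite_induct) (auto intro: mpolys_mult)

lemma mpolys_power: "p \<in> mpolys X \<Longrightarrow> p ^ e \<in> mpolys X" for p :: "('v, 'k::comm_ring_1) mpoly"
  by (induction e) (auto intro: mpolys_mult)

lemma mpolys_var: "x \<in> X \<Longrightarrow> mpoly_var x \<in> mpolys X"
  by (simp add: mpolys_def mpoly_var_def)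

lemma mpolys_const [simp]: "mpoly_const c \<in> mpolys X"
  by (simp add: mpolys_def mpoly_const_def)

lemma polyfun_mono_eval: "Poly_Mapping.keys \<mu> \<subseteq> X \<Longrightarrow> (\<lambda>a. mono_eval a \<mu>) \<in> polyfun (coords X)"
  unfolding mono_eval_def by (intro polyfun_intros) auto

lemma polyfun_mpoly_eval: "p \<in> mpolys X \<Longrightarrow> (\<lambda>a. mpoly_eval a p) \<in> polyfun (coords X)"
  unfolding mpoly_eval_altdef mpolys_def by (intro polyfun_intros polyfun_mono_eval) auto

lemma polyfun_imp_mpoly:
  assumes "f \<in> polyfun (coords X)"
  obtains p where "p \<in> mpolys X" "\<And>a. mpoly_eval a p = f a"
proof -
  have "\<exists>p\<in>mpolys X. \<forall>a. mpoly_eval a p = f a"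
    using assms
  proof induction
    case (const c)
    then show ?case by (intro bexI[of _ "mpoly_const c"]) auto
  next
    case (gen g)
    then show ?case by (auto simp: coords_def intro: bexI[OF _ mpolys_var])
  next
    case (add f g)
    then show ?case by (metis mpolys_add mpoly_eval_add)
  next
    case (mult f g)
    then show ?case by (metis mpolys_mult mpoly_eval_mult)
  qed
  then show ?thesis using that by blast
qed


section \<open>Restriction to lines\<close>

lemma polyfun_on_line_exists:
  assumes "f \<in> polyfun (coords X)"
  shows "\<exists>p. \<forall>z. poly p z = f (\<lambda>i. a i + z * y i)"
  using assms
proof induction
  case (const c)
  then show ?case by (intro exI[of _ "[:c:]"]) auto
next
  case (gen g)
  then obtain x where "g = (\<lambda>a. a x)" by (auto simp: coords_def)
  then show ?case by (intro exI[of _ "[:a x, y x:]"]) auto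
next
  case (add f g)
  then show ?case by (metis poly_add)
next
  case (mult f g)
  then show ?case by (metis poly_mult)
qed

definition line_poly :: "(('v \<Rightarrow> 'k::field) \<Rightarrow> 'k) \<Rightarrow> ('v \<Rightarrow> 'k) \<Rightarrow> ('v \<Rightarrow> 'k) \<Rightarrow> 'k poly" where
  "line_poly f a y = (THE p. \<forall>z. poly p z = f (\<lambda>i. a i + z * y i))"

lemma poly_all_eqI:
  fixes p q :: "'k::{field,infinite} poly"
  assumes "\<And>z. poly p z = poly q z" shows "p = q"
proof (rule ccontr)
  assume "p \<noteq> q"
  then have "finite {z. poly (p - q) z = 0}" by (intro poly_roots_finite) auto
  then show False using assms by (simp add: infinite_UNIV)
qed

lemma line_polyI:
  fixes p :: "'k::{field,infinite} poly"
  assumes "\<And>z. poly p z = f (\<lambda>i. a i + z * y i)" shows "line_poly f a y = p"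
  unfolding line_poly_def
  by (rule the_equality) (use assms in \<open>auto intro: poly_all_eqI\<close>)

lemma poly_line_poly:
  fixes f :: "('v \<Rightarrow> 'k::{field,infinite}) \<Rightarrow> 'k"
  assumes "f \<in> polyfun (coords X)"
  shows "poly (line_poly f a y) z = f (\<lambda>i. a i + z * y i)"
  using polyfun_on_line_exists[OF assms, of a y] line_polyI by metis

lemma line_poly_const: "line_poly (\<lambda>_. c) a y = [:c:]" for c :: "'k::{field,infinite}"
  by (rule line_polyI) auto

lemma line_poly_coord: "line_poly (\<lambda>a. a x) a y = [:a x, y x:]"
  for y :: "'v \<Rightarrow> 'k::{field,infinite}"
  by (rule line_polyI) auto

lemma line_poly_add:
  fixes f :: "('v \<Rightarrow> 'k::{field,infinite}) \<Rightarrow> 'k"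
  assumes "f \<in> polyfun (coords X)" "g \<in> polyfun (coords X)"
  shows "line_poly (\<lambda>t. f t + g t) a y = line_poly f a y + line_poly g a y"
  by (rule line_polyI) (simp add: poly_line_poly[OF assms(1)] poly_line_poly[OF assms(2)])

lemma line_poly_mult:
  fixes f :: "('v \<Rightarrow> 'k::{field,infinite}) \<Rightarrow> 'k"
  assumes "f \<in> polyfun (coords X)" "g \<in> polyfun (coords X)"
  shows "line_poly (\<lambda>t. f t * g t) a y = line_poly f a y * line_poly g a y"
  by (rule line_polyI) (simp add: poly_line_poly[OF assms(1)] poly_line_poly[OF assms(2)])

lemma line_poly_affine:
  fixes f :: "('v \<Rightarrow> 'k::{field,infinite}) \<Rightarrow> 'k"
  assumes "f \<in> polyfun (coords X)"
    and "\<And>z x. x \<in> X \<Longrightarrow> \<sigma> (\<lambda>i. a i + z * y i) x = a' x + z * y' x"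
  shows "line_poly (\<lambda>t. f (\<sigma> t)) a y = line_poly f a' y'"
  by (rule line_polyI)
    (simp add: poly_line_poly[OF assms(1)], rule polyfun_cong_on[OF assms(1)], simp add: assms(2))

text \<open>
  A condition on the restriction of \<open>f\<close> to a line is a polynomial condition on the line. This
  serves twice: to extend such conditions by density from generic directions to all, and to see
  that they are algebraic in the matrices that define a tuple of lines.
\<close>
lemma polyfun_coeff_line_poly:
  fixes f :: "('v \<Rightarrow> 'k::{field,infinite}) \<Rightarrow> 'k"
  assumes "f \<in> polyfun (coords X)"
    and A: "\<And>x. x \<in> X \<Longrightarrow> (\<lambda>t. A t x) \<in> polyfun C"
    and Y: "\<And>x. x \<in> X \<Longrightarrow> (\<lambda>t. Y t x) \<in> polyfun C"
  shows "(\<lambda>t. coeff (line_poly f (A t) (Y t)) j) \<in> polyfun C"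
  using assms(1)
proof (induction arbitrary: j)
  case (const c)
  then show ?case by (simp add: line_poly_const coeff_pCons polyfun.const split: nat.split)
next
  case (gen g)
  then obtain x where x: "g = (\<lambda>a. a x)" "x \<in> X" by (auto simp: coords_def)
  consider "j = 0" | "j = Suc 0" | i where "j = Suc (Suc i)"
    by (metis not0_implies_Suc)
  then show ?case
    by cases (auto simp: x line_poly_coord A[OF x(2)] Y[OF x(2)] polyfun.const)
next
  case (add f g)
  then show ?case by (simp add: line_poly_add[of f X] polyfun.add)
next
  case (mult f g)
  then show ?case by (simp add: line_poly_mult[of f X] coeff_mult polyfun.mult polyfun_sum)
qed

text \<open>
  Zariski density of the non-vanishing locus of \<open>u\<close>: on the line joining \<open>b\<close> to a point
  where \<open>u\<close> does not vanish, \<open>u\<close> has finitely many zeros, hence \<open>h\<close> has infinitely many.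
\<close>
lemma polyfun_density:
  fixes h u :: "('v \<Rightarrow> 'k::{field,infinite}) \<Rightarrow> 'k"
  assumes h: "h \<in> polyfun (coords X)" and u: "u \<in> polyfun (coords X)" and u0: "u b0 \<noteq> 0"
    and vanish: "\<And>b. u b \<noteq> 0 \<Longrightarrow> h b = 0"
  shows "h b = 0"
proof -
  define y where "y i = b i - b0 i" for i
  have "line_poly h b0 y * line_poly u b0 y = 0"
    by (rule poly_all_eqI) (use vanish in \<open>auto simp: poly_line_poly[OF h] poly_line_poly[OF u]\<close>)
  moreover have "poly (line_poly u b0 y) 0 \<noteq> 0"
    using u0 by (simp add: poly_line_poly[OF u])
  ultimately have "line_poly h b0 y = 0" by auto
  then have "poly (line_poly h b0 y) 1 = 0" by simp
  then show ?thesis by (simp add: poly_line_poly[OF h] y_def)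
qed

lemma mono_eval_mult: "mono_eval (\<lambda>x. a x * b x) \<mu> = mono_eval a \<mu> * mono_eval b \<mu>"
  by (simp add: mono_eval_def power_mult_distrib prod.distrib)

lemma mono_eval_distinct:
  assumes "\<mu> \<noteq> \<nu>"
  obtains a :: "'v \<Rightarrow> 'k::{field,infinite}" where "mono_eval a \<mu> \<noteq> mono_eval a \<nu>"
proof -
  obtain x where x: "Poly_Mapping.lookup \<mu> x \<noteq> Poly_Mapping.lookup \<nu> x"
    using assms by (meson poly_mapping_eqI)
  define i j where "i = Poly_Mapping.lookup \<mu> x" and "j = Poly_Mapping.lookup \<nu> x"
  have "monom (1::'k) i \<noteq> monom 1 j"
    using x by (simp add: monom_eq_iff' i_def j_def)
  then obtain z :: 'k where z: "z ^ i \<noteq> z ^ j"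
    using poly_all_eqI[of "monom (1::'k) i" "monom 1 j"] by (auto simp: poly_monom)
  have *: "mono_eval (\<lambda>y. if y = x then z else 1) \<kappa> = z ^ Poly_Mapping.lookup \<kappa> x"
    for \<kappa> :: "'v \<Rightarrow>\<^sub>0 nat"
    unfolding mono_eval_superset[of "insert x (Poly_Mapping.keys \<kappa>)", OF finite.insertI[OF finite_keys] subset_insertI]
    by (subst prod.insert_remove) (auto intro!: prod.neutral)
  show ?thesis using z that[of "\<lambda>y. if y = x then z else 1"] unfolding * i_def j_def by blast
qed

text \<open>
  Monomials are characters of the multiplicative monoid \<open>'v \<Rightarrow> 'k\<close>, distinct ones because the
  field is infinite, and distinct characters are linearly independent (Dedekind).
\<close>
lemma mono_eval_independent:
  fixes c :: "('v \<Rightarrow>\<^sub>0 nat) \<Rightarrow> 'k::{field,infinite}"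
  assumes "finite M" "\<And>a. (\<Sum>\<mu>\<in>M. c \<mu> * mono_eval a \<mu>) = 0" "\<mu> \<in> M"
  shows "c \<mu> = 0"
  using assms
proof (induction M arbitrary: c \<mu> rule: finite_induct)
  case (insert \<nu> M)
  have zero: "c \<kappa> = 0" if "\<kappa> \<in> M" for \<kappa>
  proof -
    have "\<kappa> \<noteq> \<nu>" using insert.hyps that by auto
    then obtain g :: "'v \<Rightarrow> 'k" where g: "mono_eval g \<kappa> \<noteq> mono_eval g \<nu>"
      by (rule mono_eval_distinct)
    have "(\<Sum>\<mu>\<in>M. (c \<mu> * (mono_eval g \<mu> - mono_eval g \<nu>)) * mono_eval a \<mu>) = 0" for a
    proof -
      have "(\<Sum>\<mu>\<in>insert \<nu> M. c \<mu> * mono_eval (\<lambda>x. g x * a x) \<mu>) -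
          mono_eval g \<nu> * (\<Sum>\<mu>\<in>insert \<nu> M. c \<mu> * mono_eval a \<mu>) = 0"
        by (simp only: insert.prems(1)) simp
      then show ?thesis
        using insert.hyps
        by (simp add: mono_eval_mult algebra_simps sum_subtractf sum_distrib_left)
    qed
    from insert.IH[OF this that] g show ?thesis by simp
  qed
  moreover have "c \<nu> = 0"
    using insert.prems(1)[of "\<lambda>_. 1"] insert.hyps zero by (simp add: mono_eval_def)
  ultimately show ?case using insert.prems(2) by auto
qed simp

lemma mpoly_eval_eq_0_imp:
  fixes p :: "('v, 'k::{field,infinite}) mpoly"
  assumes "\<And>a. mpoly_eval a p = 0" shows "p = 0"
proof (rule poly_mapping_eqI)
  fix \<mu>
  show "Poly_Mapping.lookup p \<mu> = Poly_Mapping.lookup 0 \<mu>"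
    using mono_eval_independent[of "Poly_Mapping.keys p" "Poly_Mapping.lookup p" \<mu>] assms
    by (cases "\<mu> \<in> Poly_Mapping.keys p") (auto simp: mpoly_eval_altdef in_keys_iff)
qed

lemma mpoly_eqI:
  fixes p q :: "('v, 'k::{field,infinite}) mpoly"
  assumes "\<And>a. mpoly_eval a p = mpoly_eval a q" shows "p = q"
proof -
  have "p + - q = 0"
    by (rule mpoly_eval_eq_0_imp) (simp only: mpoly_eval_add mpoly_eval_uminus assms, simp)
  then show ?thesis by simp
qed

section \<open>Order of vanishing, degree and division\<close>

text \<open>
  Multiplicity and degree are tested on lines, so that products and quotients of polynomials in
  several variables are controlled by univariate polynomials. Over an infinite field these are
  the usual notions: if the homogeneous component of some degree in the expansion at \<open>a\<close> is
  nonzero, then it is nonzero in some direction \<open>y\<close>.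
\<close>
definition ord_ge :: "nat \<Rightarrow> (('v \<Rightarrow> 'k::field) \<Rightarrow> 'k) \<Rightarrow> ('v \<Rightarrow> 'k) \<Rightarrow> bool" where
  "ord_ge m f a \<longleftrightarrow> (\<forall>y. \<forall>i<m. coeff (line_poly f a y) i = 0)"

definition deg_less :: "nat \<Rightarrow> (('v \<Rightarrow> 'k::field) \<Rightarrow> 'k) \<Rightarrow> bool" where
  "deg_less D f \<longleftrightarrow> (\<forall>a y. \<forall>i\<ge>D. coeff (line_poly f a y) i = 0)"

lemma ord_ge_imp_zero:
  fixes f :: "('v \<Rightarrow> 'k::{field,infinite}) \<Rightarrow> 'k"
  assumes "f \<in> polyfun (coords X)" "ord_ge m f a" "m > 0"
  shows "f a = 0"
proof -
  have "coeff (line_poly f a (\<lambda>_. 0)) 0 = 0" using assms(2,3) by (auto simp: ord_ge_def)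
  then show ?thesis
    using poly_line_poly[OF assms(1), of a "\<lambda>_. 0" 0] by (simp add: poly_0_coeff_0)
qed

lemma deg_less_0_imp_zero:
  fixes f :: "('v \<Rightarrow> 'k::{field,infinite}) \<Rightarrow> 'k"
  assumes "f \<in> polyfun (coords X)" "deg_less 0 f"
  shows "f a = 0"
proof -
  have "coeff (line_poly f a (\<lambda>_. 0)) 0 = 0" using assms(2) by (auto simp: deg_less_def)
  then show ?thesis
    using poly_line_poly[OF assms(1), of a "\<lambda>_. 0" 0] by (simp add: poly_0_coeff_0)
qed

lemma polyfun_coeff_direction:
  fixes f :: "('v \<Rightarrow> 'k::{field,infinite}) \<Rightarrow> 'k"
  assumes "f \<in> polyfun (coords X)"
  shows "(\<lambda>y. coeff (line_poly f a y) j) \<in> polyfun (coords UNIV)"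
  by (rule polyfun_coeff_line_poly[OF assms polyfun.const polyfun_coord]) auto

lemma low_coeffs_divide:
  fixes w g :: "'k::field poly"
  assumes "\<And>i. i < m \<Longrightarrow> coeff (w * g) i = 0" "coeff w c \<noteq> 0" "i < m - c"
  shows "coeff g i = 0"
proof (cases "g = 0")
  case False
  have w: "w \<noteq> 0" using assms(2) by auto
  have "monom 1 m dvd w * g" using assms(1) by (simp add: monom_1_dvd_iff')
  then have "m \<le> Polynomial.order 0 w + Polynomial.order 0 g"
    using w False by (simp add: monom_1_dvd_iff order_mult)
  moreover have "Polynomial.order 0 w \<le> c"
  proof (rule ccontr)
    assume "\<not> Polynomial.order 0 w \<le> c"
    then have "monom 1 (Suc c) dvd w" using w by (simp add: monom_1_dvd_iff)
    then show False using assms(2) unfolding monom_1_dvd_iff' by blast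
  qed
  ultimately have "m - c \<le> Polynomial.order 0 g" by linarith
  then have "monom 1 (m - c) dvd g" using False by (simp add: monom_1_dvd_iff)
  then show ?thesis using assms(3) by (simp add: monom_1_dvd_iff')
qed auto

lemma high_coeffs_divide:
  fixes w g :: "'k::field poly"
  assumes "\<And>i. i \<ge> D \<Longrightarrow> coeff (w * g) i = 0" "coeff w e \<noteq> 0" "i \<ge> D - e"
  shows "coeff g i = 0"
proof (rule ccontr)
  assume g: "coeff g i \<noteq> 0"
  then have nz: "w \<noteq> 0" "g \<noteq> 0" using assms(2) by auto
  have "e \<le> degree w" "i \<le> degree g" using g assms(2) by (auto intro: le_degree)
  then have "degree (w * g) \<ge> D" using nz assms(3) by (simp add: degree_mult_eq)
  then have "coeff (w * g) (degree (w * g)) = 0" by (rule assms(1))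
  then show False using nz by simp
qed

text \<open>
  In the generic direction \<open>y\<close> the restriction of \<open>W\<close> to the line through \<open>a\<close> has a nonzero
  coefficient in degree \<open>c\<close>, so there a factor of order at most \<open>c\<close> is cancelled; the remaining
  directions follow by density.
\<close>
lemma ord_ge_divide:
  fixes W G :: "('v \<Rightarrow> 'k::{field,infinite}) \<Rightarrow> 'k"
  assumes W: "W \<in> polyfun (coords UNIV)" and G: "G \<in> polyfun (coords UNIV)"
    and ord: "ord_ge m (\<lambda>t. W t * G t) a" and c: "coeff (line_poly W a y0) c \<noteq> 0"
  shows "ord_ge (m - c) G a"
  unfolding ord_ge_def
proof (intro allI impI)
  fix y i assume i: "i < m - c"
  show "coeff (line_poly G a y) i = 0"
  proof (rule polyfun_density[where h = "\<lambda>y. coeff (line_poly G a y) i" and b = y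
        and u = "\<lambda>y. coeff (line_poly W a y) c" and X = UNIV])
    fix y assume "coeff (line_poly W a y) c \<noteq> 0"
    then show "coeff (line_poly G a y) i = 0"
      using low_coeffs_divide[OF _ _ i, of "line_poly W a y"] ord
      by (simp add: ord_ge_def line_poly_mult[OF W G])
  qed (rule polyfun_coeff_direction[OF G] polyfun_coeff_direction[OF W] c)+
qed

text \<open>
  As for multiplicities: in the generic direction \<open>W\<close> has degree at least \<open>e\<close> on the line, and
  degrees add up.
\<close>
lemma deg_less_divide:
  fixes W G :: "('v \<Rightarrow> 'k::{field,infinite}) \<Rightarrow> 'k"
  assumes W: "W \<in> polyfun (coords UNIV)" and G: "G \<in> polyfun (coords UNIV)"
    and deg: "deg_less D (\<lambda>t. W t * G t)" and c: "\<And>a. coeff (line_poly W a y0) e \<noteq> 0"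
  shows "deg_less (D - e) G"
  unfolding deg_less_def
proof (intro allI impI)
  fix a y i assume i: "i \<ge> D - e"
  show "coeff (line_poly G a y) i = 0"
  proof (rule polyfun_density[where h = "\<lambda>y. coeff (line_poly G a y) i" and b = y
        and u = "\<lambda>y. coeff (line_poly W a y) e" and X = UNIV])
    fix y assume "coeff (line_poly W a y) e \<noteq> 0"
    then show "coeff (line_poly G a y) i = 0"
      using high_coeffs_divide[OF _ _ i, of "line_poly W a y"] deg
      by (simp add: deg_less_def line_poly_mult[OF W G])
  qed (rule polyfun_coeff_direction[OF G] polyfun_coeff_direction[OF W] c)+
qed

lemma polyfun_fun_upd:
  assumes "q \<in> polyfun (coords UNIV)"
  shows "(\<lambda>t. (t(i := q t)) x) \<in> polyfun (coords UNIV)"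
  using assms by (cases "x = i") (simp_all add: polyfun_coord)

text \<open>
  The hypersurface \<open>x\<^sub>i = - Q\<close> is a graph over the other coordinates. Modulo \<open>x\<^sub>i + Q\<close> every
  polynomial agrees with its restriction to the graph; in particular one that vanishes there is
  a multiple of \<open>x\<^sub>i + Q\<close>.
\<close>
lemma polyfun_division:
  fixes f :: "('v \<Rightarrow> 'k::comm_ring_1) \<Rightarrow> 'k"
  assumes f: "f \<in> polyfun (coords UNIV)" and Q: "Q \<in> polyfun (coords UNIV)"
  shows "\<exists>h\<in>polyfun (coords UNIV). \<forall>t. f t = f (t(i := - Q t)) + (t i + Q t) * h t"
  using f
proof induction
  case (const c)
  then show ?case by (intro bexI[of _ "\<lambda>_. 0"]) (auto intro: polyfun_intros)
next
  case (gen g)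
  then obtain x where x: "g = (\<lambda>a. a x)" by (auto simp: coords_def)
  then show ?case
    by (intro bexI[of _ "\<lambda>_. if x = i then 1 else 0"]) (auto intro: polyfun_intros)
next
  case (add f g)
  then obtain h k where hk: "h \<in> polyfun (coords UNIV)" "k \<in> polyfun (coords UNIV)"
    "\<And>t. f t = f (t(i := - Q t)) + (t i + Q t) * h t"
    "\<And>t. g t = g (t(i := - Q t)) + (t i + Q t) * k t" by blast
  show ?case
  proof (rule bexI[of _ "\<lambda>t. h t + k t"], intro allI)
    fix t
    show "f t + g t = f (t(i := - Q t)) + g (t(i := - Q t)) + (t i + Q t) * (h t + k t)"
      unfolding hk(3)[of t] hk(4)[of t] by (simp add: algebra_simps)
  qed (auto intro: polyfun_intros hk)
next
  case (mult f g)
  then obtain h k where hk: "h \<in> polyfun (coords UNIV)" "k \<in> polyfun (coords UNIV)"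
    "\<And>t. f t = f (t(i := - Q t)) + (t i + Q t) * h t"
    "\<And>t. g t = g (t(i := - Q t)) + (t i + Q t) * k t" by blast
  have sub: "(\<lambda>t. f (t(i := - Q t))) \<in> polyfun (coords UNIV)"
    by (rule polyfun_compose[OF mult.hyps(1) polyfun_fun_upd]) (rule polyfun_uminus[OF Q])
  show ?case
  proof (rule bexI[of _ "\<lambda>t. f (t(i := - Q t)) * k t + h t * g t"], intro allI)
    fix t
    have "f t * g t = f (t(i := - Q t)) * g t + (t i + Q t) * h t * g t"
      by (subst hk(3)[of t]) (simp add: algebra_simps)
    also have "f (t(i := - Q t)) * g t =
        f (t(i := - Q t)) * g (t(i := - Q t)) + (t i + Q t) * (f (t(i := - Q t)) * k t)"
      by (subst hk(4)[of t]) (simp add: algebra_simps)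
    finally show "f t * g t = f (t(i := - Q t)) * g (t(i := - Q t)) +
        (t i + Q t) * (f (t(i := - Q t)) * k t + h t * g t)"
      by (simp add: algebra_simps)
  qed (auto intro!: polyfun_intros hk sub mult.hyps)
qed

lemma polyfun_prod_division:
  fixes f :: "('v \<Rightarrow> 'k::field) \<Rightarrow> 'k"
  assumes "finite B" "f \<in> polyfun (coords UNIV)" "\<And>\<beta> t. \<beta> \<in> B \<Longrightarrow> f (t(i := \<beta>)) = 0"
  shows "\<exists>G\<in>polyfun (coords UNIV). \<forall>t. f t = (\<Prod>\<beta>\<in>B. t i - \<beta>) * G t"
  using assms
proof (induction B rule: finite_induct)
  case empty
  then show ?case by auto
next
  case (insert \<gamma> B)
  then obtain G where G: "G \<in> polyfun (coords UNIV)" "\<And>t. f t = (\<Prod>\<beta>\<in>B. t i - \<beta>) * G t"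
    by blast
  obtain H where H: "H \<in> polyfun (coords UNIV)" "\<And>t. G t = G (t(i := \<gamma>)) + (t i - \<gamma>) * H t"
    using polyfun_division[OF G(1) polyfun.const[of "- \<gamma>"], of i] by auto
  have "G (t(i := \<gamma>)) = 0" for t
  proof -
    have "(\<Prod>\<beta>\<in>B. \<gamma> - \<beta>) * G (t(i := \<gamma>)) = 0"
      using insert.prems(2)[of \<gamma> t] unfolding G(2)[of "t(i := \<gamma>)"] by simp
    moreover have "(\<Prod>\<beta>\<in>B. \<gamma> - \<beta>) \<noteq> 0" using insert.hyps by auto
    ultimately show ?thesis by simp
  qed
  then have "f t = (\<Prod>\<beta>\<in>insert \<gamma> B. t i - \<beta>) * H t" for t
    using G(2)[of t] H(2)[of t] insert.hyps by (simp add: algebra_simps)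
  then show ?case using H(1) by blast
qed


section \<open>Polynomials vanishing to high order on a grid\<close>

lemma line_poly_linear_product:
  fixes A :: "'k::{field,infinite} set"
  shows "line_poly (\<lambda>t. \<Prod>\<alpha>\<in>A. t i - \<alpha>) a y = (\<Prod>\<alpha>\<in>A. [:a i - \<alpha>, y i:])"
  by (rule line_polyI) (auto simp: poly_prod algebra_simps intro!: prod.cong)

text \<open>
  On each hyperplane \<open>x\<^sub>N = \<alpha>\<close> with \<open>\<alpha> \<in> A\<close> the same hypotheses hold with one coordinate fewer, so
  \<open>f\<close> vanishes there and is divisible by \<open>\<Prod>\<alpha>\<in>A. x\<^sub>N - \<alpha>\<close>. This product has degree \<open>card A\<close> and is
  smooth at the grid points, so the quotient satisfies the hypotheses for \<open>m - 1\<close>. The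
  coordinates from \<open>N\<close> on are unrestricted, hence the case \<open>N = 0\<close> says that \<open>f\<close> vanishes
  everywhere to order \<open>m\<close>.
\<close>
lemma grid_vanish:
  fixes f :: "(nat \<Rightarrow> 'k::{field,infinite}) \<Rightarrow> 'k"
  assumes "finite A" "f \<in> polyfun (coords UNIV)" "deg_less (m * card A) f"
    and "\<And>a. (\<And>j. j < N \<Longrightarrow> a j \<in> A) \<Longrightarrow> ord_ge m f a"
  shows "f x = 0"
  using assms(2-4)
proof (induction N arbitrary: f m x)
  case 0
  show ?case
  proof (cases m)
    case 0
    then show ?thesis using deg_less_0_imp_zero[OF "0.prems"(1)] "0.prems"(2) by simp
  next
    case (Suc m')
    then show ?thesis using ord_ge_imp_zero[OF "0.prems"(1) "0.prems"(3)] by simp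
  qed
next
  case (Suc N)
  note IHN = Suc.IH
  show ?case
    using Suc.prems
  proof (induction m arbitrary: f x)
    case 0
    then show ?case using deg_less_0_imp_zero[OF "0.prems"(1)] by simp
  next
    case (Suc m)
    note IHm = Suc.IH and prems = Suc.prems
    have slice: "f (t(N := \<alpha>)) = 0" if "\<alpha> \<in> A" for \<alpha> t
    proof -
      have line: "line_poly (\<lambda>t. f (t(N := \<alpha>))) a y = line_poly f (a(N := \<alpha>)) (y(N := 0))" for a y
        by (rule line_poly_affine[OF prems(1)]) auto
      have 1: "(\<lambda>t. f (t(N := \<alpha>))) \<in> polyfun (coords UNIV)"
        by (rule polyfun_compose[OF prems(1) polyfun_fun_upd]) (rule polyfun.const)
      have 2: "deg_less (Suc m * card A) (\<lambda>t. f (t(N := \<alpha>)))"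
        using prems(2) by (simp add: deg_less_def line)
      have 3: "ord_ge (Suc m) (\<lambda>t. f (t(N := \<alpha>))) a" if "\<And>j. j < N \<Longrightarrow> a j \<in> A" for a
      proof -
        have "ord_ge (Suc m) f (a(N := \<alpha>))"
          by (rule prems(3)) (use that \<open>\<alpha> \<in> A\<close> in auto)
        then show ?thesis by (simp add: ord_ge_def line)
      qed
      show ?thesis by (rule IHN[OF 1 2 3])
    qed
    define W where "W = (\<lambda>t :: nat \<Rightarrow> 'k. \<Prod>\<alpha>\<in>A. t N - \<alpha>)"
    obtain G where G: "G \<in> polyfun (coords UNIV)" "\<And>t. f t = W t * G t"
      using polyfun_prod_division[OF assms(1) prems(1) slice] unfolding W_def by blast
    have f_eq: "f = (\<lambda>t. W t * G t)" using G(2) by auto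
    have W: "W \<in> polyfun (coords UNIV)" unfolding W_def by (intro polyfun_intros) auto
    have "deg_less (Suc m * card A - card A) G"
    proof (rule deg_less_divide[OF W G(1), of _ "\<lambda>_. 1"])
      fix a :: "nat \<Rightarrow> 'k"
      have "degree (\<Prod>\<alpha>\<in>A. [:a N - \<alpha>, 1:]) = card A"
        by (subst degree_prod_eq_sum_degree) auto
      moreover have "lead_coeff (\<Prod>\<alpha>\<in>A. [:a N - \<alpha>, 1:]) = 1"
        by (simp add: lead_coeff_prod)
      ultimately show "coeff (line_poly W a (\<lambda>_. 1)) (card A) \<noteq> 0"
        by (simp add: W_def line_poly_linear_product)
    qed (use prems(2) f_eq in simp)
    moreover have "ord_ge m G a" if a: "\<And>j. j < Suc N \<Longrightarrow> a j \<in> A" for a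
    proof -
      have "(\<Prod>\<alpha>\<in>A. [:a N - \<alpha>, 1:]) = [:0, 1:] * (\<Prod>\<alpha>\<in>A - {a N}. [:a N - \<alpha>, 1:])"
        by (subst prod.remove[OF assms(1) a[of N]]) auto
      then have "coeff (\<Prod>\<alpha>\<in>A. [:a N - \<alpha>, 1:]) 1 = (\<Prod>\<alpha>\<in>A - {a N}. a N - \<alpha>)"
        by (simp add: poly_prod flip: poly_0_coeff_0)
      also have "\<dots> \<noteq> 0" using assms(1) by auto
      finally have "coeff (line_poly W a (\<lambda>_. 1)) 1 \<noteq> 0"
        by (simp add: W_def line_poly_linear_product)
      moreover have "ord_ge (Suc m) (\<lambda>t. W t * G t) a" using prems(3)[OF a] f_eq by simp
      ultimately show ?thesis using ord_ge_divide[OF W G(1), of "Suc m" a _ 1] by simp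
    qed
    ultimately have "G x = 0" by (intro IHm[OF G(1)]) auto
    then show ?case by (simp add: G(2))
  qed
qed


section \<open>Special lines on a rational scroll\<close>

text \<open>
  For fixed \<open>v\<close> the vectors \<open>v e\<^sub>j - e\<^sub>j\<^sub>+\<^sub>1\<close>, where \<open>j < N\<close>, form a basis of the hyperplane
  \<open>\<Sum>j\<le>N. x\<^sub>j v\<^sup>j = 0\<close> in the coordinates \<open>x\<^sub>0, \<dots>, x\<^sub>N\<close>, and \<open>scroll N v p\<close> is the vector with
  coordinates \<open>p\<close> in this basis. It is linear in \<open>p\<close> and affine in \<open>v\<close>.
\<close>
definition scroll :: "nat \<Rightarrow> 'k::field \<Rightarrow> (nat \<Rightarrow> 'k) \<Rightarrow> nat \<Rightarrow> 'k" where
  "scroll N v p j = v * (if j < N then p j else 0) - (if j = 0 then 0 else p (j - 1))"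

text \<open>
  The coefficients of \<open>x\<close> in the basis \<open>v e\<^sub>j - e\<^sub>j\<^sub>+\<^sub>1\<close> are found by back substitution from \<open>x\<^sub>N\<close>; the
  equation of the hyperplane takes care of \<open>x\<^sub>0\<close>.
\<close>
lemma scroll_surj:
  fixes x :: "nat \<Rightarrow> 'k::field"
  assumes "x 0 + (\<Sum>j=1..N. x j * v ^ j) = 0"
  shows "\<exists>p. \<forall>j\<le>N. x j = scroll N v p j"
proof (rule exI, intro allI impI)
  fix j assume j: "j \<le> N"
  \<comment> \<open>The sum is empty for \<open>j = N\<close>, which gives the boundary value \<open>p N = 0\<close>.\<close>
  define p where "p = (\<lambda>j. - (\<Sum>k=Suc j..N. x k * v ^ (k - Suc j)))"
  have pv: "v * p i = - (\<Sum>k=Suc i..N. x k * v ^ (k - i))" for i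
  proof -
    have "v * (x k * v ^ (k - Suc i)) = x k * v ^ (k - i)" if "k \<in> {Suc i..N}" for k
    proof -
      have "k - i = Suc (k - Suc i)" using that by auto
      then show ?thesis by (simp add: mult_ac)
    qed
    then have "(\<Sum>k=Suc i..N. v * (x k * v ^ (k - Suc i))) = (\<Sum>k=Suc i..N. x k * v ^ (k - i))"
      by (rule sum.cong[OF refl])
    then show ?thesis by (simp only: p_def mult_minus_right sum_distrib_left)
  qed
  have vp: "v * (if j < N then p j else 0) = v * p j"
    using j by (cases "j = N") (auto simp: p_def)
  show "x j = scroll N v p j"
  proof (cases j)
    case 0
    have "x 0 = - (\<Sum>j=1..N. x j * v ^ j)" using assms by (simp add: add_eq_0_iff2)
    then show ?thesis unfolding scroll_def vp using 0 pv[of 0] by simp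
  next
    case (Suc i)
    have "(\<Sum>k=j..N. x k * v ^ (k - j)) = x j + (\<Sum>k=Suc j..N. x k * v ^ (k - j))"
      using j by (subst sum.atLeast_Suc_atMost) auto
    then show ?thesis unfolding scroll_def vp pv using Suc by (simp add: p_def)
  qed
qed

text \<open>
  Let \<open>W = x\<^sub>0 + x\<^sub>1 z + \<dots> + x\<^sub>N z\<^sup>N\<close>, where \<open>z\<close> is the coordinate with index \<open>N + 2\<close>. The slice of the
  hypersurface \<open>W = 0\<close> at \<open>z = v\<close> is an affine space with coordinates \<open>p\<close>, in which the lines
  leave the points of the grid \<open>A\<^sup>N\<close>; as \<open>card A = N + 1\<close>, the grid lemma shows that \<open>g\<close> vanishes on
  it. Hence \<open>g\<close> vanishes on \<open>W = 0\<close>. This hypersurface is a graph, so \<open>W\<close> divides \<open>g\<close>; it has degree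
  \<open>N + 1\<close> and is smooth, so the quotient satisfies the hypotheses for \<open>m - 1\<close>.
\<close>
lemma scroll_vanish:
  fixes g :: "(nat \<Rightarrow> 'k::{field,infinite}) \<Rightarrow> 'k"
  assumes A: "finite A" "card A = N + 1" and N: "N \<ge> 1"
    and "g \<in> polyfun (coords UNIV)" "deg_less (m * (N + 1)) g"
    and "\<And>a \<alpha>. (\<And>j. j < N \<Longrightarrow> \<alpha> j \<in> A) \<Longrightarrow> (\<And>j. j \<le> N \<Longrightarrow> a j = scroll N (a (N + 2)) \<alpha> j) \<Longrightarrow>
           ord_ge m g a"
  shows "g x = 0"
  using assms(4-6)
proof (induction m arbitrary: g x)
  case 0
  then show ?case using deg_less_0_imp_zero[OF "0.prems"(1)] by simp
next
  case (Suc m)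
  note prems = Suc.prems
  define Q where "Q = (\<lambda>x :: nat \<Rightarrow> 'k. \<Sum>j=1..N. x j * x (N + 2) ^ j)"
  define W where "W = (\<lambda>x :: nat \<Rightarrow> 'k. x 0 + Q x)"
  have Q: "Q \<in> polyfun (coords UNIV)" unfolding Q_def by (intro polyfun_intros) auto
  have W: "W \<in> polyfun (coords UNIV)" unfolding W_def by (intro polyfun_intros Q) auto
  have onW: "g x = 0" if Wx: "W x = 0" for x
  proof -
    define v where "v = x (N + 2)"
    obtain p where p: "\<And>j. j \<le> N \<Longrightarrow> x j = scroll N v p j"
      using scroll_surj[of x v N] Wx unfolding W_def Q_def v_def by blast
    define \<sigma> where "\<sigma> = (\<lambda>p i. if i \<le> N then scroll N v p i else x i)"
    have line: "line_poly (\<lambda>p. g (\<sigma> p)) a y =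
        line_poly g (\<sigma> a) (\<lambda>i. if i \<le> N then scroll N v y i else 0)" for a y
      by (rule line_poly_affine[OF prems(1)]) (auto simp: \<sigma>_def scroll_def algebra_simps)
    have "g (\<sigma> p) = 0"
    proof (rule grid_vanish[OF A(1), where f = "\<lambda>p. g (\<sigma> p)" and m = "Suc m" and N = N])
      show "(\<lambda>p. g (\<sigma> p)) \<in> polyfun (coords UNIV)"
      proof (rule polyfun_compose[OF prems(1)])
        fix i
        show "(\<lambda>p. \<sigma> p i) \<in> polyfun (coords UNIV)"
          unfolding \<sigma>_def scroll_def
          by (cases "i \<le> N"; cases "i < N"; cases "i = 0") (auto intro!: polyfun_intros)
      qed
      show "deg_less (Suc m * card A) (\<lambda>p. g (\<sigma> p))"
        using prems(2) A(2) by (simp add: deg_less_def line)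
      fix a assume a: "\<And>j. j < N \<Longrightarrow> a j \<in> A"
      have "ord_ge (Suc m) g (\<sigma> a)"
        by (rule prems(3)[of a]) (use a in \<open>auto simp: \<sigma>_def v_def\<close>)
      then show "ord_ge (Suc m) (\<lambda>p. g (\<sigma> p)) a" by (simp add: ord_ge_def line)
    qed
    moreover have "\<sigma> p = x" using p by (auto simp: \<sigma>_def fun_eq_iff)
    ultimately show ?thesis by simp
  qed
  obtain G where G: "G \<in> polyfun (coords UNIV)" "\<And>t. g t = g (t(0 := - Q t)) + W t * G t"
    using polyfun_division[OF prems(1) Q, of 0] unfolding W_def by blast
  have "W (t(0 := - Q t)) = 0" for t by (simp add: W_def Q_def)
  then have gt: "g t = W t * G t" for t using G(2)[of t] onW by simp
  then have g_eq: "g = (\<lambda>t. W t * G t)" by auto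
  have "deg_less (Suc m * (N + 1) - (N + 1)) G"
  proof (rule deg_less_divide[OF W G(1)])
    fix a :: "nat \<Rightarrow> 'k"
    \<comment> \<open>The top form of \<open>W\<close> is \<open>x\<^sub>N z\<^sup>N\<close>, so it is nonzero in this direction.\<close>
    let ?y = "\<lambda>i. if i = N \<or> i = N + 2 then 1 else 0 :: 'k"
    let ?P = "\<lambda>j. [:a j, ?y j:] * [:a (N + 2), 1:] ^ j"
    have line: "line_poly W a ?y = [:a 0:] + (\<Sum>j=1..N. ?P j)"
      by (rule line_polyI) (use N in \<open>auto simp: W_def Q_def poly_sum algebra_simps intro!: sum.cong\<close>)
    have 1: "coeff (?P j) (N + 1) = 0" if "j \<in> {1..N} - {N}" for j
    proof (rule coeff_eq_0)
      have "degree (?P j) \<le> 0 + degree ([:a (N + 2), 1:] ^ j)"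
        using that by (intro order.trans[OF degree_mult_le] add_mono) auto
      then show "degree (?P j) < N + 1" using that by (auto simp: degree_linear_power)
    qed
    have 2: "coeff (?P N) (N + 1) = 1"
    proof -
      have P: "?P N = [:a N, 1:] * [:a (N + 2), 1:] ^ N" by simp
      have "degree ([:a N, 1:] * [:a (N + 2), 1:] ^ N) = N + 1"
        by (subst degree_mult_eq) (auto simp: degree_linear_power)
      moreover have "lead_coeff ([:a N, 1:] * [:a (N + 2), 1:] ^ N) = 1"
        by (simp only: lead_coeff_mult lead_coeff_power) simp
      ultimately show ?thesis unfolding P by metis
    qed
    have "coeff (\<Sum>j=1..N. ?P j) (N + 1) = coeff (?P N) (N + 1) + (\<Sum>j\<in>{1..N} - {N}. coeff (?P j) (N + 1))"
      unfolding coeff_sum by (rule sum.remove) (use N in auto)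
    also have "(\<Sum>j\<in>{1..N} - {N}. coeff (?P j) (N + 1)) = 0"
      by (rule sum.neutral) (use 1 in blast)
    also have "coeff (?P N) (N + 1) + 0 = 1" using 2 by (simp only: add_0_right)
    finally show "coeff (line_poly W a ?y) (N + 1) \<noteq> 0" unfolding line by simp
  qed (use prems(2) g_eq in simp)
  moreover have "ord_ge m G a"
    if "\<And>j. j < N \<Longrightarrow> \<alpha> j \<in> A" "\<And>j. j \<le> N \<Longrightarrow> a j = scroll N (a (N + 2)) \<alpha> j" for a \<alpha>
  proof -
    \<comment> \<open>\<open>W\<close> is linear in \<open>x\<^sub>0\<close> with coefficient 1, so it has order at most 1 everywhere.\<close>
    have "line_poly W a (\<lambda>i. if i = 0 then 1 else 0) = [:W a, 1:]"
      by (rule line_polyI) (auto simp: W_def Q_def intro!: sum.cong)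
    then have "coeff (line_poly W a (\<lambda>i. if i = 0 then 1 else 0)) 1 \<noteq> 0" by simp
    moreover have "ord_ge (Suc m) (\<lambda>t. W t * G t) a" using prems(3)[OF that] g_eq by simp
    ultimately show ?thesis using ord_ge_divide[OF W G(1), of "Suc m" a _ 1] by simp
  qed
  ultimately have "G x = 0" by (intro Suc.IH[OF G(1)]) auto
  then show ?case by (simp add: gt)
qed

lemma mono_eval_scale:
  "mono_eval (\<lambda>i. c * a i) \<mu> =
     c ^ (\<Sum>x\<in>Poly_Mapping.keys \<mu>. Poly_Mapping.lookup \<mu> x) * mono_eval a \<mu>"
  by (simp add: mono_eval_def power_mult_distrib prod.distrib power_sum)

lemma mpoly_eval_form_scale:
  assumes "is_form e f"
  shows "mpoly_eval (\<lambda>i. c * a i) f = c ^ e * mpoly_eval a f"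
  using assms unfolding mpoly_eval_altdef is_form_def
  by (simp add: mono_eval_scale sum_distrib_left mult_ac)

lemma deg_less_form:
  fixes f :: "('v, 'k::{field,infinite}) mpoly"
  assumes "is_form e f"
  shows "deg_less (Suc e) (\<lambda>a. mpoly_eval a f)"
  unfolding deg_less_def
proof (intro allI impI)
  fix a y :: "'v \<Rightarrow> 'k" and i assume i: "i \<ge> Suc e"
  let ?M = "\<lambda>\<mu>. \<Prod>x\<in>Poly_Mapping.keys \<mu>. [:a x, y x:] ^ Poly_Mapping.lookup \<mu> x"
  have line: "line_poly (\<lambda>a. mpoly_eval a f) a y =
      (\<Sum>\<mu>\<in>Poly_Mapping.keys f. smult (Poly_Mapping.lookup f \<mu>) (?M \<mu>))"
    by (rule line_polyI) (simp add: poly_sum poly_prod mpoly_eval_altdef mono_eval_def)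
  have "coeff (?M \<mu>) i = 0" if "\<mu> \<in> Poly_Mapping.keys f" for \<mu>
  proof (rule coeff_eq_0)
    have "degree (?M \<mu>) \<le> (\<Sum>x\<in>Poly_Mapping.keys \<mu>. degree ([:a x, y x:] ^ Poly_Mapping.lookup \<mu> x))"
      by (rule degree_prod_sum_le[unfolded o_def]) simp
    also have "\<dots> \<le> (\<Sum>x\<in>Poly_Mapping.keys \<mu>. Poly_Mapping.lookup \<mu> x)"
      by (intro sum_mono order.trans[OF degree_power_le]) auto
    also have "\<dots> = e" using assms that by (auto simp: is_form_def)
    finally show "degree (?M \<mu>) < i" using i by simp
  qed
  then show "coeff (line_poly (\<lambda>a. mpoly_eval a f) a y) i = 0"
    by (simp add: line coeff_sum)
qed

text \<open>
  The line of the grid point \<open>\<alpha>\<close> consists of the points with coordinates \<open>v \<alpha>\<^sub>j - u \<alpha>\<^sub>j\<^sub>-\<^sub>1\<close> for \<open>j \<le> N\<close>,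
  followed by \<open>u\<close> and \<open>v\<close> at the indices \<open>N + 1\<close> and \<open>N + 2\<close>; the two definitions are its points
  with \<open>(u, v) = (1, 0)\<close> and \<open>(u, v) = (0, 1)\<close>. At \<open>u = 1\<close> the first coordinates are those of
  \<open>scroll N v \<alpha>\<close>.
\<close>
definition scroll_line0 :: "nat \<Rightarrow> (nat \<Rightarrow> 'k::field) \<Rightarrow> nat \<Rightarrow> 'k" where
  "scroll_line0 N \<alpha> i =
     (if i = 0 then 0 else if i \<le> N then - \<alpha> (i - 1) else if i = N + 1 then 1 else 0)"

definition scroll_line1 :: "nat \<Rightarrow> (nat \<Rightarrow> 'k::field) \<Rightarrow> nat \<Rightarrow> 'k" where
  "scroll_line1 N \<alpha> i = (if i < N then \<alpha> i else if i = N + 2 then 1 else 0)"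

text \<open>
  In the affine chart where the coordinate \<open>N + 1\<close> equals 1 the lines become those of
  \<open>scroll_vanish\<close>. A form that vanishes on the chart vanishes wherever that
  coordinate is nonzero, hence everywhere.
\<close>
lemma scroll_lines_vanish:
  fixes f :: "(nat, 'k::{field,infinite}) mpoly"
  assumes A: "finite A" "card A = N + 1" and N: "N \<ge> 1"
    and f: "f \<in> mpolys {..N + 2}" "is_form e f" and e: "e < m * (N + 1)"
    and ord: "\<And>\<alpha> u v. (\<And>j. j < N \<Longrightarrow> \<alpha> j \<in> A) \<Longrightarrow>
      ord_ge m (\<lambda>a. mpoly_eval a f) (\<lambda>i. u * scroll_line0 N \<alpha> i + v * scroll_line1 N \<alpha> i)"
  shows "f = 0"
proof -
  define F where "F = (\<lambda>a. mpoly_eval a f)"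
  have F: "F \<in> polyfun (coords {..N + 2})" unfolding F_def by (rule polyfun_mpoly_eval[OF f(1)])
  have F': "F \<in> polyfun (coords UNIV)" using F by (rule polyfun_coords_UNIV)
  define g where "g = (\<lambda>x. F (x(N + 1 := 1)))"
  have line: "line_poly g a y = line_poly F a' (y(N + 1 := 0))"
    if "\<And>i. i \<le> N + 2 \<Longrightarrow> a' i = (a(N + 1 := 1)) i" for a a' y
    unfolding g_def by (rule line_poly_affine[OF F]) (use that in auto)
  have g0: "g x = 0" for x
  proof (rule scroll_vanish[OF A N, where m = m and g = g])
    show "g \<in> polyfun (coords UNIV)"
      unfolding g_def by (rule polyfun_compose[OF F' polyfun_fun_upd]) (rule polyfun.const)
    show "deg_less (m * (N + 1)) g"
      using deg_less_form[OF f(2)] e by (simp add: deg_less_def line[OF refl] F_def)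
    fix a \<alpha> assume \<alpha>: "\<And>j. j < N \<Longrightarrow> \<alpha> j \<in> A"
      and a: "\<And>j. j \<le> N \<Longrightarrow> a j = scroll N (a (N + 2)) \<alpha> j"
    let ?a = "\<lambda>i. 1 * scroll_line0 N \<alpha> i + a (N + 2) * scroll_line1 N \<alpha> i"
    have "?a i = (a(N + 1 := 1)) i" if i: "i \<le> N + 2" for i
    proof -
      consider "i \<le> N" | "i = N + 1" | "i = N + 2" using i by linarith
      then show ?thesis
        by cases (auto simp: a scroll_def scroll_line0_def scroll_line1_def)
    qed
    note line = line[OF this]
    have "ord_ge m F ?a"
      unfolding F_def by (rule ord) (rule \<alpha>)
    then have ordF: "coeff (line_poly F ?a y) i = 0" if "i < m" for y i
      using that by (simp only: ord_ge_def)
    show "ord_ge m g a"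
      unfolding ord_ge_def
    proof (intro allI impI)
      fix y i assume "i < m"
      then show "coeff (line_poly g a y) i = 0" by (simp only: line ordF)
    qed
  qed
  have "F a = 0" if a: "a (N + 1) \<noteq> 0" for a
  proof -
    have "F a = a (N + 1) ^ e * F (\<lambda>i. a i / a (N + 1))"
      unfolding F_def by (subst mpoly_eval_form_scale[OF f(2), symmetric]) (use a in simp)
    also have "(\<lambda>i. a i / a (N + 1)) = (\<lambda>i. a i / a (N + 1))(N + 1 := 1)"
      using a by auto
    also have "F \<dots> = 0" using g0 by (simp only: g_def)
    finally show ?thesis by simp
  qed
  then have "F a = 0" for a
    using polyfun_density[OF F' polyfun_coord[OF UNIV_I, of "N + 1"], of "\<lambda>_. 1"] by simp
  then show ?thesis by (intro mpoly_eval_eq_0_imp) (simp add: F_def)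
qed

section \<open>Lines in projective space\<close>

definition lin2 :: "(nat \<Rightarrow> 'k::field) \<Rightarrow> (nat \<Rightarrow> 'k) \<Rightarrow> (nat \<Rightarrow> 'k) set" where
  "lin2 b c = range (\<lambda>(s, t) k. s * b k + t * c k)"

lemma lin2_iff: "v \<in> lin2 b c \<longleftrightarrow> (\<exists>s t. v = (\<lambda>k. s * b k + t * c k))"
  by (auto simp: lin2_def image_iff)

lemma lin2_left: "b \<in> lin2 b c"
  unfolding lin2_iff by (rule exI[of _ 1], rule exI[of _ 0]) simp

lemma span_pair: "kvec.span {b, c} = lin2 b c"
proof (rule Set.set_eqI)
  fix x
  have "x \<in> kvec.span {b, c} \<longleftrightarrow> (\<exists>s t. x - (\<lambda>i. s * b i) = (\<lambda>i. t * c i))"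
    by (auto simp: kvec.span_insert kvec.span_singleton)
  also have "\<dots> \<longleftrightarrow> x \<in> lin2 b c"
    by (auto simp: lin2_iff fun_eq_iff algebra_simps)
  finally show "x \<in> kvec.span {b, c} \<longleftrightarrow> x \<in> lin2 b c" .
qed

definition pivots :: "nat \<Rightarrow> (nat \<Rightarrow> 'k::field) \<Rightarrow> (nat \<Rightarrow> 'k) \<Rightarrow> nat \<Rightarrow> nat \<Rightarrow> bool" where
  "pivots n b c i j \<longleftrightarrow> i \<le> n \<and> j \<le> n \<and> b i * c j - b j * c i \<noteq> 0 \<and>
     (\<forall>k>n. b k = 0 \<and> c k = 0)"

lemma pivots_dim:
  assumes "pivots n b c i j" shows "kvec.dim (kvec.span {b, c}) = 2"
proof -
  have D: "b i * c j - b j * c i \<noteq> 0" using assms by (simp add: pivots_def)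
  have c: "c \<noteq> 0" using D by auto
  have b: "b \<notin> kvec.span {c}"
    using D by (auto simp: kvec.span_singleton)
  have "kvec.independent {b, c}"
    using b c by (auto simp: kvec.independent_insert)
  moreover have "b \<noteq> c" using b kvec.span_base[of c "{c}"] by auto
  ultimately show ?thesis by (simp add: kvec.dim_eq_card_independent)
qed

lemma dim_imp_pivots:
  assumes dim: "kvec.dim (kvec.span {b, c}) = 2" and supp: "\<And>k. k > n \<Longrightarrow> b k = 0 \<and> c k = 0"
  shows "\<exists>i j. pivots n b c i j"
proof (rule ccontr)
  assume "\<not> ?thesis"
  then have zero: "b i * c j = b j * c i" for i j
    using supp unfolding pivots_def by (metis eq_iff_diff_eq_0 linorder_not_le mult_zero_left mult_zero_right)
  have "\<exists>d. kvec.span {b, c} \<subseteq> kvec.span {d}"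
  proof (cases "b = 0")
    case True
    then have "kvec.span {b, c} = kvec.span {c}" by (simp add: kvec.span_insert_0)
    then show ?thesis by blast
  next
    case False
    then obtain i where i: "b i \<noteq> 0" by (auto simp: fun_eq_iff)
    have "c = (\<lambda>k. (c i / b i) * b k)"
      using zero[of i] i by (auto simp: fun_eq_iff field_simps)
    then have "c \<in> kvec.span {b}" unfolding kvec.span_singleton by blast
    then have "kvec.span {b, c} \<subseteq> kvec.span {b}"
      by (intro kvec.span_minimal) (auto intro: kvec.span_base)
    then show ?thesis by blast
  qed
  then obtain d where "kvec.span {b, c} \<subseteq> kvec.span {d}" by blast
  then have "kvec.dim (kvec.span {b, c}) \<le> card {d}" by (rule kvec.dim_le_card) simp
  then show False using dim by simp
qed

lemma lin2_in_planes:
  assumes "pivots n b c i j" shows "lin2 b c \<in> planes n 1"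
proof -
  have "kvec.subspace (lin2 b c)" "kvec.dim (lin2 b c) = 2"
    using pivots_dim[OF assms] kvec.subspace_span[of "{b, c}"] by (simp_all only: span_pair)
  moreover have "\<forall>v\<in>lin2 b c. \<forall>i>n. v i = 0"
    using assms by (auto simp: lin2_def pivots_def)
  ultimately show ?thesis by (simp add: planes_def)
qed

lemma planes_cases:
  assumes "V \<in> planes n 1"
  obtains b c i j where "pivots n b c i j" "V = lin2 b c"
proof -
  have V: "kvec.subspace V" "\<And>v i. v \<in> V \<Longrightarrow> i > n \<Longrightarrow> v i = 0" "kvec.dim V = 2"
    using assms by (auto simp: planes_def)
  obtain B where B: "B \<subseteq> V" "kvec.independent B" "V \<subseteq> kvec.span B" "card B = kvec.dim V"
    using kvec.basis_exists by blast
  obtain b c where bc: "B = {b, c}" "b \<noteq> c"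
    using B(4) V(3) by (auto simp: card_2_iff)
  have span: "V = kvec.span {b, c}"
    using B bc kvec.span_minimal[OF B(1) V(1)] by auto
  obtain i j where "pivots n b c i j"
    using dim_imp_pivots[of b c n] V B(1) bc span by auto
  then show ?thesis using that span by (simp add: span_pair)
qed

lemma planes_subset_eq:
  assumes "V \<in> planes n 1" "V' \<in> planes n 1" "V \<subseteq> V'" shows "V = V'"
proof -
  have V: "kvec.subspace V" "kvec.dim V = 2" and V': "kvec.subspace V'" "kvec.dim V' = 2"
    using assms by (auto simp: planes_def)
  obtain B where B: "B \<subseteq> V" "kvec.independent B" "V \<subseteq> kvec.span B" "card B = kvec.dim V"
    using kvec.basis_exists by blast
  obtain B' where B': "B' \<subseteq> V'" "kvec.independent B'" "V' \<subseteq> kvec.span B'" "card B' = kvec.dim V'"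
    using kvec.basis_exists by blast
  have fin: "finite B'" using B'(4) V'(2) by (intro card_ge_0_finite) simp
  have BB': "B \<subseteq> kvec.span B'" using B(1) assms(3) B'(3) by blast
  have finB: "finite B" using B(4) V(2) by (intro card_ge_0_finite) simp
  have "V' \<subseteq> kvec.span B"
  proof
    fix x assume x: "x \<in> V'"
    show "x \<in> kvec.span B"
    proof (rule ccontr)
      assume nx: "x \<notin> kvec.span B"
      then have "kvec.independent (insert x B)" by (rule kvec.independent_insertI) (rule B(2))
      moreover have "insert x B \<subseteq> kvec.span B'" using BB' x B'(3) by blast
      ultimately have "card (insert x B) \<le> card B'"
        using kvec.independent_span_bound[OF fin] by blast
      moreover have "x \<notin> B" using nx kvec.span_base by blast
      ultimately show False using finB B(4) B'(4) V(2) V'(2) by simp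
    qed
  qed
  also have "\<dots> \<subseteq> V" using B(1) V(1) by (rule kvec.span_minimal)
  finally show ?thesis using assms(3) by blast
qed

text \<open>
  If \<open>V\<close> is spanned by \<open>b\<close> and \<open>c\<close>, the minor of the columns \<open>i\<close> and \<open>j\<close> being nonzero,
  then \<open>dual_coord\<close> gives, at \<open>i\<close> and \<open>j\<close>, the coordinates on \<open>V\<close> with respect to \<open>b\<close> and
  \<open>c\<close>, and at the other indices linear forms that cut out \<open>V\<close>; \<open>frame\<close> is the inverse linear
  change of coordinates.
\<close>
definition dual_coord :: "(nat \<Rightarrow> 'k::field) \<Rightarrow> (nat \<Rightarrow> 'k) \<Rightarrow> nat \<Rightarrow> nat \<Rightarrow> (nat \<Rightarrow> 'k) \<Rightarrow> nat \<Rightarrow> 'k" where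
  "dual_coord b c i j x k =
     (let D = b i * c j - b j * c i;
          s = inverse D * (c j * x i - c i * x j);
          t = inverse D * (b i * x j - b j * x i)
      in if k = i then s else if k = j then t else x k - (s * b k + t * c k))"

definition frame :: "nat \<Rightarrow> (nat \<Rightarrow> 'k::field) \<Rightarrow> (nat \<Rightarrow> 'k) \<Rightarrow> nat \<Rightarrow> nat \<Rightarrow> (nat \<Rightarrow> 'k) \<Rightarrow> nat \<Rightarrow> 'k" where
  "frame n b c i j x k = x i * b k + x j * c k + (if k \<le> n \<and> k \<noteq> i \<and> k \<noteq> j then x k else 0)"

lemma pivots_neq: "pivots n b c i j \<Longrightarrow> i \<noteq> j"
  by (auto simp: pivots_def)

lemma cramer:
  fixes bi bj ci cj :: "'k::field"
  assumes "bi * cj - bj * ci \<noteq> 0" (is "?D \<noteq> 0")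
  shows "inverse ?D * (cj * xi - ci * xj) * bi + inverse ?D * (bi * xj - bj * xi) * ci = xi"
    and "inverse ?D * (cj * xi - ci * xj) * bj + inverse ?D * (bi * xj - bj * xi) * cj = xj"
proof -
  have "inverse ?D * (cj * xi - ci * xj) * bi + inverse ?D * (bi * xj - bj * xi) * ci =
     inverse ?D * (?D * xi)" by (simp add: algebra_simps)
  then show "inverse ?D * (cj * xi - ci * xj) * bi + inverse ?D * (bi * xj - bj * xi) * ci = xi"
    using assms by (simp flip: mult.assoc)
  have "inverse ?D * (cj * xi - ci * xj) * bj + inverse ?D * (bi * xj - bj * xi) * cj =
     inverse ?D * (?D * xj)" by (simp add: algebra_simps)
  then show "inverse ?D * (cj * xi - ci * xj) * bj + inverse ?D * (bi * xj - bj * xi) * cj = xj"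
    using assms by (simp flip: mult.assoc)
qed

lemma frame_dual_coord:
  assumes "pivots n b c i j" "k \<le> n"
  shows "frame n b c i j (dual_coord b c i j x) k = x k"
  using assms cramer[of "b i" "c j" "b j" "c i"] pivots_neq[OF assms(1)]
  by (auto simp: frame_def dual_coord_def Let_def pivots_def)

lemma dual_coord_on_line:
  assumes "pivots n b c i j" "v \<in> lin2 b c" "k \<noteq> i" "k \<noteq> j"
  shows "dual_coord b c i j v k = 0"
proof -
  obtain s t where v: "v = (\<lambda>k. s * b k + t * c k)" using assms(2) by (auto simp: lin2_def)
  define D where "D = b i * c j - b j * c i"
  have D: "D \<noteq> 0" using assms(1) by (simp add: pivots_def D_def)
  have "c j * v i - c i * v j = D * s" "b i * v j - b j * v i = D * t"
    by (simp_all add: v D_def algebra_simps)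
  then have "inverse D * (c j * v i - c i * v j) = s" "inverse D * (b i * v j - b j * v i) = t"
    using D by (simp_all flip: mult.assoc)
  then show ?thesis using assms(3,4) by (simp add: dual_coord_def Let_def D_def[symmetric] v)
qed

lemma in_lin2_if_dual_coord:
  assumes "pivots n b c i j" "\<And>k. k > n \<Longrightarrow> v k = 0"
    "\<And>k. k \<le> n \<Longrightarrow> k \<noteq> i \<Longrightarrow> k \<noteq> j \<Longrightarrow> dual_coord b c i j v k = 0"
  shows "v \<in> lin2 b c"
proof -
  let ?w = "dual_coord b c i j v"
  have "v k = ?w i * b k + ?w j * c k" for k
  proof (cases "k \<le> n")
    case True
    have "v k = frame n b c i j ?w k" using frame_dual_coord[OF assms(1) True] by simp
    also have "\<dots> = ?w i * b k + ?w j * c k" using assms(3)[OF True] by (auto simp: frame_def)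
    finally show ?thesis .
  next
    case False
    then show ?thesis using assms(1,2) by (auto simp: pivots_def)
  qed
  then have "v = (\<lambda>k. ?w i * b k + ?w j * c k)" by auto
  then show ?thesis unfolding lin2_iff by blast
qed

lemma polyfun_dual_coord:
  assumes "pivots n b c i j" "k \<le> n"
  shows "(\<lambda>x. dual_coord b c i j x k) \<in> polyfun (coords {..n})"
  using assms unfolding dual_coord_def Let_def pivots_def
  by (cases "k = i"; cases "k = j") (auto intro!: polyfun_intros)

lemma polyfun_frame:
  assumes "pivots n b c i j"
  shows "(\<lambda>x. frame n b c i j x k) \<in> polyfun (coords {..n})"
  using assms unfolding frame_def pivots_def
  by (cases "k \<le> n \<and> k \<noteq> i \<and> k \<noteq> j") (auto intro!: polyfun_intros)


section \<open>The ideal of a line\<close>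

lemma coord_ring_simps [simp]:
  "carrier (coord_ring n) = mpolys {..n}" "x \<otimes>\<^bsub>coord_ring n\<^esub> y = x * y"
  "x \<oplus>\<^bsub>coord_ring n\<^esub> y = x + y" "\<one>\<^bsub>coord_ring n\<^esub> = 1" "\<zero>\<^bsub>coord_ring n\<^esub> = 0"
  by (simp_all add: coord_ring_def)

lemma coord_ring_ideal:
  fixes I :: "(nat, 'k::comm_ring_1) mpoly set"
  assumes "ideal I (coord_ring n)"
  shows "I \<subseteq> mpolys {..n}" "0 \<in> I" "\<And>p q. p \<in> I \<Longrightarrow> q \<in> I \<Longrightarrow> p + q \<in> I"
    "\<And>p q. p \<in> I \<Longrightarrow> q \<in> mpolys {..n} \<Longrightarrow> q * p \<in> I"
proof -
  interpret ideal I "coord_ring n" by fact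
  show "I \<subseteq> mpolys {..n}" using a_subset by simp
  show "0 \<in> I" using additive_subgroup.zero_closed[OF additive_subgroup_axioms] by simp
  show "p + q \<in> I" if "p \<in> I" "q \<in> I" for p q using additive_subgroup.a_closed[OF additive_subgroup_axioms that] by simp
  show "q * p \<in> I" if "p \<in> I" "q \<in> mpolys {..n}" for p q using I_l_closed[of p q] that by simp
qed

lemma coord_ring_ideal_sum:
  fixes I :: "(nat, 'k::comm_ring_1) mpoly set"
  assumes "ideal I (coord_ring n)" "\<And>x. x \<in> X \<Longrightarrow> f x \<in> I"
  shows "(\<Sum>x\<in>X. f x) \<in> I"
  using assms(2) coord_ring_ideal[OF assms(1)]
  by (induction X rule: infinite_finite_induct) auto

lemma coord_ring_idealI:
  fixes I :: "(nat, 'k::comm_ring_1) mpoly set"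
  assumes "I \<subseteq> mpolys {..n}" "0 \<in> I" "\<And>p q. p \<in> I \<Longrightarrow> q \<in> I \<Longrightarrow> p + q \<in> I"
    "\<And>p q. p \<in> I \<Longrightarrow> q \<in> mpolys {..n} \<Longrightarrow> q * p \<in> I"
  shows "ideal I (coord_ring n)"
proof (rule idealI)
  let ?R = "coord_ring n :: (nat, 'k) mpoly ring"
  interpret cring ?R by (rule coord_ring_cring)
  show "ring ?R" by (rule ring_axioms)
  show "subgroup I (add_monoid ?R)"
  proof (rule subgroup.intro)
    fix x assume x: "x \<in> I"
    have "- x \<in> I" using assms(4)[OF x, of "- 1"] by (simp add: mpolys_uminus)
    moreover have "\<ominus>\<^bsub>?R\<^esub> x = - x"
      by (rule minus_equality) (use x assms(1) in \<open>auto intro: mpolys_uminus\<close>)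
    ultimately show "inv\<^bsub>add_monoid ?R\<^esub> x \<in> I" by (simp add: a_inv_def)
  qed (use assms in auto)
qed (use assms in \<open>auto simp: mult.commute\<close>)

lemma vanishing_ideal_ideal:
  "ideal (vanishing_ideal n V) (coord_ring n)" for V :: "(nat \<Rightarrow> 'k::field) set"
  by (rule coord_ring_idealI)
    (auto simp: vanishing_ideal_def mpolys_add mpolys_mult mpoly_eval_add mpoly_eval_mult)

lemma ideal_power_ideal:
  fixes I :: "(nat, 'k::comm_ring_1) mpoly set"
  assumes "ideal I (coord_ring n)" shows "ideal (ideal_power (coord_ring n) I m) (coord_ring n)"
proof -
  interpret cring "coord_ring n :: (nat, 'k) mpoly ring" by (rule coord_ring_cring)
  show ?thesis
    by (induction m) (use oneideal ideal_prod_is_ideal assms in auto)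
qed

lemma ideal_power_SucI:
  fixes I :: "(nat, 'k::comm_ring_1) mpoly set"
  assumes "p \<in> ideal_power (coord_ring n) I m" "q \<in> I"
  shows "p * q \<in> ideal_power (coord_ring n) I (Suc m)"
  using ideal_prod.prod[OF assms, of "coord_ring n"] by simp

text \<open>
  A line is irreducible: \<open>p\<close> and \<open>q\<close> are pulled back to polynomial functions of the two parameters
  of the line, to which the density argument applies.
\<close>
lemma vanishing_ideal_prime_aux:
  fixes V :: "(nat \<Rightarrow> 'k::{field,infinite}) set"
  assumes V: "V \<in> planes n 1" and p: "p \<in> mpolys {..n}" and q: "q \<in> polyfun (coords UNIV)"
    and v: "v \<in> V" "mpoly_eval v p \<noteq> 0" and zero: "\<And>w. w \<in> V \<Longrightarrow> mpoly_eval w p \<noteq> 0 \<Longrightarrow> q w = 0"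
    and w: "w \<in> V"
  shows "q w = 0"
proof -
  obtain b c where V: "V = lin2 b c" using V planes_cases by metis
  define \<sigma> where "\<sigma> = (\<lambda>(x :: nat \<Rightarrow> 'k) k. x 0 * b k + x 1 * c k)"
  have \<sigma>: "(\<lambda>x. \<sigma> x k) \<in> polyfun (coords UNIV)" for k
    unfolding \<sigma>_def by (intro polyfun_intros) auto
  have \<sigma>V: "\<sigma> x \<in> V" for x by (auto simp: V lin2_def \<sigma>_def)
  have surj: "\<exists>x. w = \<sigma> x" if w: "w \<in> V" for w
  proof -
    obtain s t where "w = (\<lambda>k. s * b k + t * c k)" using w unfolding V lin2_iff by blast
    then show ?thesis by (intro exI[of _ "\<lambda>k. if k = 0 then s else t"]) (auto simp: \<sigma>_def)
  qed
  obtain x0 x where x: "v = \<sigma> x0" "w = \<sigma> x" using surj v(1) w by blast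
  have 1: "(\<lambda>x. q (\<sigma> x)) \<in> polyfun (coords UNIV)"
    by (rule polyfun_compose[OF q \<sigma>])
  have 2: "(\<lambda>x. mpoly_eval (\<sigma> x) p) \<in> polyfun (coords UNIV)"
    by (rule polyfun_compose[OF polyfun_mpoly_eval[OF p] \<sigma>])
  show ?thesis
    using polyfun_density[OF 1 2, of x0 x] x v(2) zero \<sigma>V by auto
qed

lemma vanishing_ideal_prime:
  fixes V :: "(nat \<Rightarrow> 'k::{field,infinite}) set"
  assumes "V \<in> planes n 1"
  shows "primeideal (vanishing_ideal n V) (coord_ring n)"
proof (rule primeidealI)
  show "ideal (vanishing_ideal n V) (coord_ring n)" by (rule vanishing_ideal_ideal)
  show "cring (coord_ring n :: (nat, 'k) mpoly ring)" by (rule coord_ring_cring)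
  obtain b c where "V = lin2 b c" using assms planes_cases by metis
  then have "b \<in> V" using lin2_left by simp
  then have "1 \<notin> vanishing_ideal n V" by (auto simp: vanishing_ideal_def)
  then show "carrier (coord_ring n) \<noteq> vanishing_ideal n V"
    by (metis coord_ring_simps(1) mpolys_1)
  fix p q :: "(nat, 'k) mpoly"
  assume "p \<in> carrier (coord_ring n)" "q \<in> carrier (coord_ring n)"
    "p \<otimes>\<^bsub>coord_ring n\<^esub> q \<in> vanishing_ideal n V"
  then have p: "p \<in> mpolys {..n}" and q: "q \<in> mpolys {..n}"
    and pq: "\<And>v. v \<in> V \<Longrightarrow> mpoly_eval v p = 0 \<or> mpoly_eval v q = 0"
    by (auto simp: vanishing_ideal_def mpoly_eval_mult)
  show "p \<in> vanishing_ideal n V \<or> q \<in> vanishing_ideal n V"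
  proof (cases "p \<in> vanishing_ideal n V")
    case False
    then obtain v where v: "v \<in> V" "mpoly_eval v p \<noteq> 0" using p by (auto simp: vanishing_ideal_def)
    have "mpoly_eval w q = 0" if "w \<in> V" for w
      using vanishing_ideal_prime_aux[OF assms p polyfun_coords_UNIV[OF polyfun_mpoly_eval[OF q]] v _ that] pq
      by blast
    then show ?thesis using q by (simp add: vanishing_ideal_def)
  qed auto
qed

text \<open>
  Distinct lines are not contained in one another, and one of the linear forms that cut out \<open>V'\<close>
  detects a point of \<open>V\<close> outside \<open>V'\<close>.
\<close>
lemma vanishing_ideal_incomparable:
  fixes V V' :: "(nat \<Rightarrow> 'k::{field,infinite}) set"
  assumes V: "V \<in> planes n 1" and V': "V' \<in> planes n 1" and "V \<noteq> V'"
  shows "\<exists>u\<in>vanishing_ideal n V'. u \<notin> vanishing_ideal n V"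
proof -
  obtain b c i j where bc: "pivots n b c i j" "V' = lin2 b c" using V' planes_cases by metis
  obtain v where v: "v \<in> V" "v \<notin> V'" using planes_subset_eq[OF V V'] assms(3) by blast
  have "\<And>k. k > n \<Longrightarrow> v k = 0" using V v(1) by (auto simp: planes_def)
  then obtain k where k: "k \<le> n" "k \<noteq> i" "k \<noteq> j" "dual_coord b c i j v k \<noteq> 0"
    using in_lin2_if_dual_coord[OF bc(1), of v] v(2) bc(2) by blast
  obtain u where u: "u \<in> mpolys {..n}" "\<And>x. mpoly_eval x u = dual_coord b c i j x k"
    using polyfun_imp_mpoly[OF polyfun_dual_coord[OF bc(1) k(1)]] by metis
  have "u \<in> vanishing_ideal n V'"
    using u dual_coord_on_line[OF bc(1) _ k(2,3)] bc(2) by (auto simp: vanishing_ideal_def)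
  moreover have "u \<notin> vanishing_ideal n V" using u(2) k(4) v(1) by (auto simp: vanishing_ideal_def)
  ultimately show ?thesis by blast
qed


section \<open>Associated primes and symbolic powers of the ideal of a union of lines\<close>

lemma primeideal_prod_notin:
  fixes P :: "(nat, 'k::comm_ring_1) mpoly set"
  assumes P: "primeideal P (coord_ring n)" and T: "\<And>l. l \<in> T \<Longrightarrow> a l \<in> mpolys {..n} - P"
  shows "(\<Prod>l\<in>T. a l) \<notin> P"
proof -
  interpret primeideal P "coord_ring n" by fact
  have 1: "1 \<notin> P" using one_imp_carrier I_notcarr by auto
  show ?thesis
    using T
  proof (induction T rule: infinite_finite_induct)
    case (insert l T)
    have "a l \<in> mpolys {..n}" "(\<Prod>l\<in>T. a l) \<in> mpolys {..n}" using insert.prems by (auto intro!: mpolys_prod)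
    then show ?case using insert I_prime[of "a l" "\<Prod>l\<in>T. a l"] by auto
  qed (use 1 in auto)
qed

lemma union_ideal_eq:
  "p \<in> union_ideal n s L \<longleftrightarrow> p \<in> mpolys {..n} \<and> (\<forall>l<s. p \<in> vanishing_ideal n (L l))"
  by (auto simp: union_ideal_def vanishing_ideal_def)

lemma union_ideal_ideal: "ideal (union_ideal n s L) (coord_ring n)"
  unfolding union_ideal_def by (rule vanishing_ideal_ideal)

text \<open>
  The product over the lines other than \<open>L l0\<close> of elements that vanish on that line but not on \<open>L l0\<close>
  does not vanish on \<open>L l0\<close>, by primality. Lines of the tuple that coincide with \<open>L l0\<close> are left
  out of the product, so the tuple may have repetitions.
\<close>
lemma line_separator:
  fixes L :: "nat \<Rightarrow> (nat \<Rightarrow> 'k::{field,infinite}) set"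
  assumes L: "\<forall>l<s. L l \<in> planes n 1" and l0: "l0 < s"
  obtains w where "w \<in> mpolys {..n}" "w \<notin> vanishing_ideal n (L l0)"
    "\<And>q. q \<in> vanishing_ideal n (L l0) \<Longrightarrow> w * q \<in> union_ideal n s L"
proof -
  let ?T = "{l\<in>{..<s}. L l \<noteq> L l0}"
  have "\<exists>u. u \<in> vanishing_ideal n (L l) \<and> u \<notin> vanishing_ideal n (L l0)" if "l \<in> ?T" for l
    using vanishing_ideal_incomparable[OF L[rule_format, OF l0] L[rule_format, of l]] that by auto
  then obtain u where u: "\<And>l. l \<in> ?T \<Longrightarrow> u l \<in> vanishing_ideal n (L l) \<and> u l \<notin> vanishing_ideal n (L l0)"
    by metis
  define w where "w = (\<Prod>l\<in>?T. u l)"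
  have up: "u l \<in> mpolys {..n}" if "l \<in> ?T" for l using u[OF that] by (auto simp: vanishing_ideal_def)
  have w: "w \<in> mpolys {..n}" unfolding w_def using up by (intro mpolys_prod) auto
  have "w \<notin> vanishing_ideal n (L l0)"
    unfolding w_def by (rule primeideal_prod_notin[OF vanishing_ideal_prime[OF L[rule_format, OF l0]]]) (use u up in auto)
  moreover have "w * q \<in> union_ideal n s L" if q: "q \<in> vanishing_ideal n (L l0)" for q
  proof -
    have "mpoly_eval v (w * q) = 0" if l: "l < s" "v \<in> L l" for l v
    proof (cases "L l = L l0")
      case True
      then show ?thesis using q l(2) by (auto simp: vanishing_ideal_def mpoly_eval_mult)
    next
      case False
      then have "l \<in> ?T" using l(1) by auto
      then have "mpoly_eval v w = 0"
        unfolding w_def mpoly_eval_prod using u l(2) by (intro prod_zero) (auto simp: vanishing_ideal_def)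
      then show ?thesis by (simp add: mpoly_eval_mult)
    qed
    moreover have "w * q \<in> mpolys {..n}"
      using w q by (intro mpolys_mult) (auto simp: vanishing_ideal_def)
    ultimately show ?thesis by (auto simp: union_ideal_def vanishing_ideal_def)
  qed
  ultimately show ?thesis using that w by blast
qed

text \<open>
  The colon ideal of \<open>x\<close> is the intersection of the ideals of those lines on which \<open>x\<close> does not
  vanish. A prime ideal that is such an intersection equals one of its members; conversely the
  separator of a line realizes the ideal of that line.
\<close>
lemma assoc_prime_union_ideal:
  fixes L :: "nat \<Rightarrow> (nat \<Rightarrow> 'k::{field,infinite}) set"
  assumes L: "\<forall>l<s. L l \<in> planes n 1"
  shows "assoc_prime (coord_ring n) (union_ideal n s L) P \<longleftrightarrow> (\<exists>l<s. P = vanishing_ideal n (L l))"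
proof
  assume "assoc_prime (coord_ring n) (union_ideal n s L) P"
  then obtain x where P: "primeideal P (coord_ring n)" and x: "x \<in> mpolys {..n}"
    and Px: "P = {a \<in> mpolys {..n}. a * x \<in> union_ideal n s L}"
    by (auto simp: assoc_prime_def)
  let ?T = "{l\<in>{..<s}. x \<notin> vanishing_ideal n (L l)}"
  show "\<exists>l<s. P = vanishing_ideal n (L l)"
  proof (rule ccontr)
    assume contr: "\<not> ?thesis"
    have "\<exists>a. a \<in> vanishing_ideal n (L l) \<and> a \<notin> P" if l: "l \<in> ?T" for l
    proof -
      interpret pI: primeideal "vanishing_ideal n (L l)" "coord_ring n"
        by (rule vanishing_ideal_prime) (use L l in auto)
      have "P \<subseteq> vanishing_ideal n (L l)"
      proof
        fix a assume "a \<in> P"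
        then have "a \<in> mpolys {..n}" "a * x \<in> vanishing_ideal n (L l)"
          using l by (auto simp: Px union_ideal_eq)
        then show "a \<in> vanishing_ideal n (L l)" using pI.I_prime[of a x] x l by auto
      qed
      then show ?thesis using contr l by auto
    qed
    then obtain a where a: "\<And>l. l \<in> ?T \<Longrightarrow> a l \<in> vanishing_ideal n (L l) \<and> a l \<notin> P" by metis
    have ap: "a l \<in> mpolys {..n}" if "l \<in> ?T" for l using a[OF that] by (auto simp: vanishing_ideal_def)
    have prod: "(\<Prod>l\<in>?T. a l) \<in> mpolys {..n}" using ap by (intro mpolys_prod) auto
    have "mpoly_eval v ((\<Prod>l\<in>?T. a l) * x) = 0" if l: "l < s" "v \<in> L l" for l v
    proof (cases "l \<in> ?T")
      case True
      then have "mpoly_eval v (\<Prod>l\<in>?T. a l) = 0"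
        unfolding mpoly_eval_prod using a l(2) by (intro prod_zero) (auto simp: vanishing_ideal_def)
      then show ?thesis by (simp add: mpoly_eval_mult)
    next
      case False
      then show ?thesis using l by (auto simp: vanishing_ideal_def mpoly_eval_mult)
    qed
    then have "(\<Prod>l\<in>?T. a l) \<in> P"
      using prod x by (auto simp: Px union_ideal_def vanishing_ideal_def intro: mpolys_mult)
    moreover have "(\<Prod>l\<in>?T. a l) \<notin> P" by (rule primeideal_prod_notin[OF P]) (use a ap in auto)
    ultimately show False by blast
  qed
next
  assume "\<exists>l<s. P = vanishing_ideal n (L l)"
  then obtain l where l: "l < s" and P: "P = vanishing_ideal n (L l)" by blast
  obtain w where w: "w \<in> mpolys {..n}" "w \<notin> P" "\<And>q. q \<in> P \<Longrightarrow> w * q \<in> union_ideal n s L"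
    unfolding P by (rule line_separator[OF L l]) blast
  interpret primeideal P "coord_ring n"
    unfolding P by (rule vanishing_ideal_prime) (use L l in auto)
  have "P = {a \<in> mpolys {..n}. a * w \<in> union_ideal n s L}"
  proof (intro Set.set_eqI iffI)
    fix a assume "a \<in> P"
    then show "a \<in> {a \<in> mpolys {..n}. a * w \<in> union_ideal n s L}"
      using w(3)[of a] by (auto simp: P vanishing_ideal_def mult.commute)
  next
    fix a assume a: "a \<in> {a \<in> mpolys {..n}. a * w \<in> union_ideal n s L}"
    then have "a * w \<in> P" using l by (auto simp: union_ideal_eq P)
    then show "a \<in> P" using I_prime[of a w] w a by auto
  qed
  then show "assoc_prime (coord_ring n) (union_ideal n s L) P"
    using w(1) primeideal by (auto simp: assoc_prime_def)
qed

lemma ord_ge_add: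
  fixes f g :: "('v \<Rightarrow> 'k::{field,infinite}) \<Rightarrow> 'k"
  assumes "f \<in> polyfun (coords X)" "g \<in> polyfun (coords X)" "ord_ge m f a" "ord_ge m g a"
  shows "ord_ge m (\<lambda>t. f t + g t) a"
  using assms by (simp add: ord_ge_def line_poly_add[of f X])

lemma ord_ge_mult:
  fixes f g :: "('v \<Rightarrow> 'k::{field,infinite}) \<Rightarrow> 'k"
  assumes "f \<in> polyfun (coords X)" "g \<in> polyfun (coords X)" "ord_ge m f a" "ord_ge m' g a"
  shows "ord_ge (m + m') (\<lambda>t. f t * g t) a"
  unfolding ord_ge_def line_poly_mult[OF assms(1,2)]
proof (intro allI impI)
  fix y i assume "i < m + m'"
  then have "coeff (line_poly f a y) j * coeff (line_poly g a y) (i - j) = 0" if "j \<le> i" for j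
    using assms(3,4) that by (cases "j < m") (auto simp: ord_ge_def)
  then show "coeff (line_poly f a y * line_poly g a y) i = 0"
    by (auto simp: coeff_mult intro!: sum.neutral)
qed

lemma ord_ge_1I:
  fixes f :: "('v \<Rightarrow> 'k::{field,infinite}) \<Rightarrow> 'k"
  assumes "f \<in> polyfun (coords X)" "f a = 0" shows "ord_ge 1 f a"
  using assms(2) poly_line_poly[OF assms(1), of a _ 0]
  by (auto simp: ord_ge_def simp flip: poly_0_coeff_0)

lemma ideal_power_ord_ge:
  fixes J :: "(nat, 'k::{field,infinite}) mpoly set"
  assumes J: "ideal J (coord_ring n)" and a: "\<And>q. q \<in> J \<Longrightarrow> mpoly_eval a q = 0"
    and "p \<in> ideal_power (coord_ring n) J m"
  shows "ord_ge m (\<lambda>x. mpoly_eval x p) a"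
  using assms(3)
proof (induction m arbitrary: p)
  case 0
  then show ?case by (simp add: ord_ge_def)
next
  case (Suc m)
  have sub: "ideal_power (coord_ring n) J k \<subseteq> mpolys {..n}" for k
    by (rule coord_ring_ideal(1)[OF ideal_power_ideal[OF J]])
  from Suc.prems have "p \<in> ideal_prod (coord_ring n) (ideal_power (coord_ring n) J m) J" by simp
  then have "p \<in> mpolys {..n} \<and> ord_ge (Suc m) (\<lambda>x. mpoly_eval x p) a"
  proof induction
    case (prod i j)
    have i: "i \<in> mpolys {..n}" and j: "j \<in> mpolys {..n}"
      using prod sub[of m] coord_ring_ideal(1)[OF J] by auto
    have "ord_ge (m + 1) (\<lambda>x. mpoly_eval x i * mpoly_eval x j) a"
      by (rule ord_ge_mult[OF polyfun_mpoly_eval[OF i] polyfun_mpoly_eval[OF j] Suc.IH[OF prod.hyps(1)]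
            ord_ge_1I[OF polyfun_mpoly_eval[OF j] a[OF prod.hyps(2)]]])
    then show ?case using i j by (simp add: mpolys_mult mpoly_eval_mult)
  next
    case (sum p q)
    then show ?case
      using ord_ge_add[OF polyfun_mpoly_eval[of p "{..n}"] polyfun_mpoly_eval[of q "{..n}"]]
      by (simp add: mpolys_add mpoly_eval_add)
  qed
  then show ?case by simp
qed

text \<open>
  By definition \<open>u * f\<close> lies in the power of the ideal for some \<open>u\<close> that does not vanish identically
  on the line, so \<open>f\<close> has multiplicity \<open>m\<close> where \<open>u\<close> is nonzero. The conditions on the multiplicity are
  polynomial in the point, so density extends them to the whole line.
\<close>
lemma symbolic_power_ord_ge:
  fixes L :: "nat \<Rightarrow> (nat \<Rightarrow> 'k::{field,infinite}) set"
  assumes L: "\<forall>l<s. L l \<in> planes n 1" and l: "l < s" "a \<in> L l"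
    and f: "f \<in> symbolic_power (coord_ring n) (union_ideal n s L) m"
  shows "ord_ge m (\<lambda>x. mpoly_eval x f) a"
proof -
  let ?F = "\<lambda>x. mpoly_eval x f"
  have f': "f \<in> mpolys {..n}" using f by (simp add: symbolic_power_def)
  have F: "?F \<in> polyfun (coords UNIV)" by (rule polyfun_coords_UNIV[OF polyfun_mpoly_eval[OF f']])
  have "assoc_prime (coord_ring n) (union_ideal n s L) (vanishing_ideal n (L l))"
    using assoc_prime_union_ideal[OF L] l(1) by blast
  then obtain u where u: "u \<in> mpolys {..n}" "u \<notin> vanishing_ideal n (L l)"
    and uf: "u * f \<in> ideal_power (coord_ring n) (union_ideal n s L) m"
    using f by (auto simp: symbolic_power_def)
  have U: "(\<lambda>x. mpoly_eval x u) \<in> polyfun (coords UNIV)"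
    by (rule polyfun_coords_UNIV[OF polyfun_mpoly_eval[OF u(1)]])
  obtain v where v: "v \<in> L l" "mpoly_eval v u \<noteq> 0" using u by (auto simp: vanishing_ideal_def)
  have ord: "ord_ge m ?F w" if w: "w \<in> L l" "mpoly_eval w u \<noteq> 0" for w
  proof -
    have "ord_ge m (\<lambda>x. mpoly_eval x (u * f)) w"
      by (rule ideal_power_ord_ge[OF union_ideal_ideal _ uf])
        (use l(1) w(1) in \<open>auto simp: union_ideal_def vanishing_ideal_def\<close>)
    moreover have "coeff (line_poly (\<lambda>x. mpoly_eval x u) w (\<lambda>_. 0)) 0 \<noteq> 0"
      using w(2) by (simp add: poly_line_poly[OF U] flip: poly_0_coeff_0)
    ultimately show ?thesis using ord_ge_divide[OF U F, of m w _ 0] by (simp add: mpoly_eval_mult)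
  qed
  show ?thesis
    unfolding ord_ge_def
  proof (intro allI impI)
    fix y i assume i: "i < m"
    have "(\<lambda>x. coeff (line_poly ?F x y) i) \<in> polyfun (coords UNIV)"
      by (rule polyfun_coeff_line_poly[OF F]) (auto intro: polyfun_intros)
    then show "coeff (line_poly ?F a y) i = 0"
      by (rule vanishing_ideal_prime_aux[OF L[rule_format, OF l(1)] u(1) _ v _ l(2)])
        (use ord i in \<open>auto simp: ord_ge_def\<close>)
  qed
qed

text \<open>
  The degree in the coordinates normal to a line, in coordinates of projective space in which
  the coordinates with indices \<open>i\<close> and \<open>j\<close> restrict to coordinates of the line and the others
  vanish on it.
\<close>
definition off_degree :: "nat \<Rightarrow> nat \<Rightarrow> (nat \<Rightarrow>\<^sub>0 nat) \<Rightarrow> nat" where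
  "off_degree i j \<mu> = (\<Sum>k\<in>Poly_Mapping.keys \<mu> - {i, j}. Poly_Mapping.lookup \<mu> k)"

text \<open>
  Of the factors of the product only \<open>m\<close> are moved into \<open>J\<close> by a factor \<open>w\<close>; the others only
  multiply. The induction therefore tracks \<open>min m a\<close>, where \<open>a\<close> is the number of factors so far.
\<close>
lemma prod_in_ideal_power:
  fixes J :: "(nat, 'k::comm_ring_1) mpoly set"
  assumes J: "ideal J (coord_ring n)" and w: "w \<in> mpolys {..n}"
    and q: "\<And>k. k \<in> K \<Longrightarrow> q k \<in> mpolys {..n} \<and> w * q k \<in> J"
    and m: "m \<le> (\<Sum>k\<in>K. e k)"
  shows "w ^ m * (\<Prod>k\<in>K. q k ^ e k) \<in> ideal_power (coord_ring n) J m"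
proof -
  let ?R = "coord_ring n"
  define good where "good = (\<lambda>a x. w ^ min m a * x \<in> ideal_power ?R J (min m a))"
  note JI = coord_ring_ideal[OF ideal_power_ideal[OF J]]
  have step: "good (Suc a) (x * r)" if "good a x" "r \<in> mpolys {..n}" "w * r \<in> J" for a x r
  proof (cases "a < m")
    case True
    then have "(w ^ a * x) * (w * r) \<in> ideal_power ?R J (Suc a)"
      using that by (intro ideal_power_SucI) (auto simp: good_def min_def)
    moreover have "min m (Suc a) = Suc a" using True by simp
    moreover have "w ^ Suc a * (x * r) = (w ^ a * x) * (w * r)" by (simp add: mult_ac)
    ultimately show ?thesis unfolding good_def by (simp only:)
  next
    case False
    then have "w ^ m * x \<in> ideal_power ?R J m" using that(1) by (simp add: good_def min_def)
    then show ?thesis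
      using False JI(4)[of "w ^ m * x" m r] that(2) by (simp add: good_def min_def mult_ac)
  qed
  have pow: "good (a + c) (x * r ^ c)" if "good a x" "r \<in> mpolys {..n}" "w * r \<in> J" for a x r c
  proof (induction c)
    case (Suc c)
    then show ?case using step[OF Suc that(2,3)] by (simp add: mult_ac)
  qed (use that in simp)
  have "good (\<Sum>k\<in>K. e k) (\<Prod>k\<in>K. q k ^ e k)"
    using q
  proof (induction K rule: infinite_finite_induct)
    case (insert k K)
    then have "good ((\<Sum>k\<in>K. e k) + e k) ((\<Prod>k\<in>K. q k ^ e k) * q k ^ e k)"
      by (intro pow) auto
    then show ?case using insert.hyps by (simp add: add.commute mult.commute)
  qed (simp_all add: good_def)
  then show ?thesis using m by (simp add: good_def min_def)
qed

text \<open>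
  The polynomial \<open>h\<close> is \<open>f\<close> in coordinates adapted to the line. Substituting the linear forms
  \<open>dual_coord\<close> back turns each monomial of \<open>h\<close> into a product that contains at least \<open>m\<close> forms
  vanishing on the line, so \<open>w ^ m * f\<close> lies in the \<open>m\<close>-th power of the ideal of the union, where
  \<open>w\<close> separates the line from the others.
\<close>
lemma symbolic_powerI:
  fixes L :: "nat \<Rightarrow> (nat \<Rightarrow> 'k::{field,infinite}) set"
  assumes L: "\<forall>l<s. L l \<in> planes n 1" and f: "f \<in> mpolys {..n}"
    and h: "\<And>l. l < s \<Longrightarrow> \<exists>b c i j h. pivots n b c i j \<and> L l = lin2 b c \<and> h \<in> mpolys {..n} \<and>
      (\<forall>x. mpoly_eval x h = mpoly_eval (frame n b c i j x) f) \<and>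
      (\<forall>\<mu>\<in>Poly_Mapping.keys h. m \<le> off_degree i j \<mu>)"
  shows "f \<in> symbolic_power (coord_ring n) (union_ideal n s L) m"
proof -
  let ?R = "coord_ring n" and ?J = "union_ideal n s L"
  have "\<exists>u\<in>mpolys {..n} - vanishing_ideal n (L l). u * f \<in> ideal_power ?R ?J m" if l: "l < s" for l
  proof -
    obtain b c i j h where bc: "pivots n b c i j" "L l = lin2 b c" and hp: "h \<in> mpolys {..n}"
      and he: "\<And>x. mpoly_eval x h = mpoly_eval (frame n b c i j x) f"
      and deg: "\<And>\<mu>. \<mu> \<in> Poly_Mapping.keys h \<Longrightarrow> m \<le> off_degree i j \<mu>"
      using h[OF l] by blast
    obtain w where w: "w \<in> mpolys {..n}" "w \<notin> vanishing_ideal n (L l)"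
      "\<And>q. q \<in> vanishing_ideal n (L l) \<Longrightarrow> w * q \<in> ?J"
      by (rule line_separator[OF L l]) blast
    have "\<exists>q. q \<in> mpolys {..n} \<and> (\<forall>x. mpoly_eval x q = dual_coord b c i j x k)" if "k \<le> n" for k
      by (rule polyfun_imp_mpoly[OF polyfun_dual_coord[OF bc(1) that]]) blast
    then have "\<exists>\<rho>. \<forall>k\<le>n. \<rho> k \<in> mpolys {..n} \<and> (\<forall>x. mpoly_eval x (\<rho> k) = dual_coord b c i j x k)"
      by metis
    then obtain \<rho> where \<rho>: "\<And>k. k \<le> n \<Longrightarrow> \<rho> k \<in> mpolys {..n}"
      "\<And>k x. k \<le> n \<Longrightarrow> mpoly_eval x (\<rho> k) = dual_coord b c i j x k" by blast
    let ?M = "\<lambda>\<mu>. \<Prod>k\<in>Poly_Mapping.keys \<mu>. \<rho> k ^ Poly_Mapping.lookup \<mu> k"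
    have keys: "Poly_Mapping.keys \<mu> \<subseteq> {..n}" if "\<mu> \<in> Poly_Mapping.keys h" for \<mu>
      using hp that by (auto simp: mpolys_def)
    have f_eq: "f = (\<Sum>\<mu>\<in>Poly_Mapping.keys h. mpoly_const (Poly_Mapping.lookup h \<mu>) * ?M \<mu>)"
    proof (rule mpoly_eqI)
      fix x :: "nat \<Rightarrow> 'k"
      have "mpoly_eval x (\<Sum>\<mu>\<in>Poly_Mapping.keys h. mpoly_const (Poly_Mapping.lookup h \<mu>) * ?M \<mu>) =
          (\<Sum>\<mu>\<in>Poly_Mapping.keys h. Poly_Mapping.lookup h \<mu> * mono_eval (dual_coord b c i j x) \<mu>)"
        unfolding mpoly_eval_sum mpoly_eval_mult mpoly_eval_prod mpoly_eval_power mpoly_eval_const mono_eval_def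
        by (intro sum.cong prod.cong arg_cong2[of _ _ _ _ "(*)"] refl)
          (metis \<rho>(2) keys subsetD atMost_iff)
      also have "\<dots> = mpoly_eval (frame n b c i j (dual_coord b c i j x)) f"
        by (simp add: mpoly_eval_altdef[of _ h] flip: he)
      also have "\<dots> = mpoly_eval x f"
        by (rule polyfun_cong_on[OF polyfun_mpoly_eval[OF f]]) (simp add: frame_dual_coord[OF bc(1)])
      finally show "mpoly_eval x f = mpoly_eval x
        (\<Sum>\<mu>\<in>Poly_Mapping.keys h. mpoly_const (Poly_Mapping.lookup h \<mu>) * ?M \<mu>)" by simp
    qed
    note JI = coord_ring_ideal[OF ideal_power_ideal[OF union_ideal_ideal[of n s L]]]
    have summand: "w ^ m * (mpoly_const (Poly_Mapping.lookup h \<mu>) * ?M \<mu>) \<in> ideal_power ?R ?J m"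
      if \<mu>: "\<mu> \<in> Poly_Mapping.keys h" for \<mu>
    proof -
      let ?K = "Poly_Mapping.keys \<mu>"
      have "w ^ m * (\<Prod>k\<in>?K - {i, j}. \<rho> k ^ Poly_Mapping.lookup \<mu> k) \<in> ideal_power ?R ?J m"
      proof (rule prod_in_ideal_power[OF union_ideal_ideal w(1)])
        fix k assume k: "k \<in> ?K - {i, j}"
        then have "k \<le> n" using keys[OF \<mu>] by auto
        moreover have "\<rho> k \<in> vanishing_ideal n (L l)"
          using \<rho>[OF \<open>k \<le> n\<close>] dual_coord_on_line[OF bc(1)] k bc(2) by (auto simp: vanishing_ideal_def)
        ultimately show "\<rho> k \<in> mpolys {..n} \<and> w * \<rho> k \<in> ?J" using w(3) \<rho>(1) by auto
      qed (use deg[OF \<mu>] in \<open>simp add: off_degree_def\<close>)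
      moreover have "mpoly_const (Poly_Mapping.lookup h \<mu>) *
          (\<Prod>k\<in>?K \<inter> {i, j}. \<rho> k ^ Poly_Mapping.lookup \<mu> k) \<in> mpolys {..n}"
        using keys[OF \<mu>] \<rho>(1) by (intro mpolys_mult mpolys_const mpolys_prod mpolys_power) auto
      ultimately have "(mpoly_const (Poly_Mapping.lookup h \<mu>) *
          (\<Prod>k\<in>?K \<inter> {i, j}. \<rho> k ^ Poly_Mapping.lookup \<mu> k)) *
          (w ^ m * (\<Prod>k\<in>?K - {i, j}. \<rho> k ^ Poly_Mapping.lookup \<mu> k)) \<in> ideal_power ?R ?J m"
        by (rule JI(4))
      also have "(mpoly_const (Poly_Mapping.lookup h \<mu>) *
          (\<Prod>k\<in>?K \<inter> {i, j}. \<rho> k ^ Poly_Mapping.lookup \<mu> k)) *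
          (w ^ m * (\<Prod>k\<in>?K - {i, j}. \<rho> k ^ Poly_Mapping.lookup \<mu> k)) =
          w ^ m * (mpoly_const (Poly_Mapping.lookup h \<mu>) * ?M \<mu>)"
        by (subst prod.Int_Diff[of ?K _ "{i, j}"]) (auto simp: mult_ac)
      finally show ?thesis .
    qed
    have "w ^ m * f \<in> ideal_power ?R ?J m"
      by (subst f_eq, subst sum_distrib_left)
        (rule coord_ring_ideal_sum[OF ideal_power_ideal[OF union_ideal_ideal]], rule summand)
    moreover have "w ^ m \<in> mpolys {..n} - vanishing_ideal n (L l)"
      using w(1,2) by (auto simp: vanishing_ideal_def mpoly_eval_power intro: mpolys_power)
    ultimately show ?thesis by blast
  qed
  then show ?thesis using f by (auto simp: symbolic_power_def assoc_prime_union_ideal[OF L])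
qed

lemma mono_eval_off_scale:
  "mono_eval (\<lambda>k. if k = i \<or> k = j then x k else z * x k) \<mu> = z ^ off_degree i j \<mu> * mono_eval x \<mu>"
proof -
  let ?K = "Poly_Mapping.keys \<mu>" and ?e = "Poly_Mapping.lookup \<mu>"
  have "mono_eval (\<lambda>k. if k = i \<or> k = j then x k else z * x k) \<mu> =
      (\<Prod>k\<in>?K. (if k \<in> {i, j} then 1 else z ^ ?e k) * x k ^ ?e k)"
    unfolding mono_eval_def by (intro prod.cong) (auto simp: power_mult_distrib)
  also have "\<dots> = (\<Prod>k\<in>?K. if k \<in> {i, j} then 1 else z ^ ?e k) * mono_eval x \<mu>"
    by (simp add: prod.distrib mono_eval_def)
  also have "(\<Prod>k\<in>?K. if k \<in> {i, j} then 1 else z ^ ?e k) = (\<Prod>k\<in>?K - {i, j}. z ^ ?e k)"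
    by (rule prod.mono_neutral_cong_right) auto
  also have "\<dots> = z ^ off_degree i j \<mu>" by (simp add: off_degree_def power_sum)
  finally show ?thesis .
qed

text \<open>
  Along the line through a point of \<open>lin2 b c\<close> in a normal direction, the coefficient of degree \<open>e\<close> of the
  restriction of \<open>f\<close> is the part of \<open>h\<close> of normal degree \<open>e\<close>. It vanishes for \<open>e < m\<close> at all points and
  directions, so this part of \<open>h\<close> has no monomials.
\<close>
lemma ord_ge_imp_off_degree:
  fixes f h :: "(nat, 'k::{field,infinite}) mpoly"
  assumes bc: "pivots n b c i j" and f: "f \<in> mpolys {..n}" and h: "h \<in> mpolys {..n}"
    and he: "\<And>x. mpoly_eval x h = mpoly_eval (frame n b c i j x) f"
    and ord: "\<And>a. a \<in> lin2 b c \<Longrightarrow> ord_ge m (\<lambda>x. mpoly_eval x f) a"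
    and \<mu>: "\<mu> \<in> Poly_Mapping.keys h"
  shows "m \<le> off_degree i j \<mu>"
proof (rule ccontr)
  assume "\<not> m \<le> off_degree i j \<mu>"
  then have less: "off_degree i j \<mu> < m" by simp
  let ?e = "off_degree i j \<mu>"
  let ?M = "{\<nu>\<in>Poly_Mapping.keys h. off_degree i j \<nu> = ?e}"
  have "(\<Sum>\<nu>\<in>?M. Poly_Mapping.lookup h \<nu> * mono_eval x \<nu>) = 0" for x
  proof -
    define a where "a = (\<lambda>k. x i * b k + x j * c k)"
    define y where "y = (\<lambda>k. if k \<le> n \<and> k \<noteq> i \<and> k \<noteq> j then x k else 0)"
    have line: "line_poly (\<lambda>x. mpoly_eval x f) a y =
        (\<Sum>\<nu>\<in>Poly_Mapping.keys h. monom (Poly_Mapping.lookup h \<nu> * mono_eval x \<nu>) (off_degree i j \<nu>))"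
    proof (rule line_polyI)
      fix z
      have "mpoly_eval (\<lambda>k. a k + z * y k) f =
          mpoly_eval (frame n b c i j (\<lambda>k. if k = i \<or> k = j then x k else z * x k)) f"
        by (rule arg_cong[where f = "\<lambda>x. mpoly_eval x f"])
          (use pivots_neq[OF bc] in \<open>auto simp: fun_eq_iff frame_def a_def y_def\<close>)
      also have "\<dots> = (\<Sum>\<nu>\<in>Poly_Mapping.keys h. Poly_Mapping.lookup h \<nu> * (z ^ off_degree i j \<nu> * mono_eval x \<nu>))"
        by (simp add: mpoly_eval_altdef[of _ h] mono_eval_off_scale flip: he)
      finally show "poly (\<Sum>\<nu>\<in>Poly_Mapping.keys h. monom (Poly_Mapping.lookup h \<nu> * mono_eval x \<nu>) (off_degree i j \<nu>)) z =
          mpoly_eval (\<lambda>k. a k + z * y k) f"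
        by (simp add: poly_sum poly_monom mult_ac)
    qed
    have "a \<in> lin2 b c" by (auto simp: a_def lin2_def)
    then have "coeff (line_poly (\<lambda>x. mpoly_eval x f) a y) ?e = 0"
      using ord less by (auto simp: ord_ge_def)
    then have "(\<Sum>\<nu>\<in>Poly_Mapping.keys h. if off_degree i j \<nu> = ?e then Poly_Mapping.lookup h \<nu> * mono_eval x \<nu> else 0) = 0"
      unfolding line coeff_sum by simp
    then show ?thesis by (subst sum.inter_filter) auto
  qed
  then have "Poly_Mapping.lookup h \<mu> = 0"
    by (rule mono_eval_independent[of ?M "Poly_Mapping.lookup h", rotated]) (use \<mu> in auto)
  then show False using \<mu> by (simp add: in_keys_iff)
qed

text \<open>
  The geometric description \<open>J\<^sup>(\<^sup>m\<^sup>) = I(L\<^sub>1)\<^sup>m \<inter> \<dots> \<inter> I(L\<^sub>s)\<^sup>m\<close>, with multiplicities in place of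
  the powers of the ideals.
\<close>
lemma symbolic_power_iff:
  fixes L :: "nat \<Rightarrow> (nat \<Rightarrow> 'k::{field,infinite}) set"
  assumes L: "\<forall>l<s. L l \<in> planes n 1"
  shows "f \<in> symbolic_power (coord_ring n) (union_ideal n s L) m \<longleftrightarrow>
    f \<in> mpolys {..n} \<and> (\<forall>l<s. \<forall>a\<in>L l. ord_ge m (\<lambda>x. mpoly_eval x f) a)"
proof
  assume f: "f \<in> symbolic_power (coord_ring n) (union_ideal n s L) m"
  then show "f \<in> mpolys {..n} \<and> (\<forall>l<s. \<forall>a\<in>L l. ord_ge m (\<lambda>x. mpoly_eval x f) a)"
    using symbolic_power_ord_ge[OF L _ _ f] by (auto simp: symbolic_power_def)
next
  assume asm: "f \<in> mpolys {..n} \<and> (\<forall>l<s. \<forall>a\<in>L l. ord_ge m (\<lambda>x. mpoly_eval x f) a)"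
  then have f: "f \<in> mpolys {..n}" by blast
  show "f \<in> symbolic_power (coord_ring n) (union_ideal n s L) m"
  proof (rule symbolic_powerI[OF L f])
    fix l assume l: "l < s"
    obtain b c i j where bc: "pivots n b c i j" "L l = lin2 b c" using L[rule_format, OF l] planes_cases by metis
    have "(\<lambda>x. mpoly_eval (frame n b c i j x) f) \<in> polyfun (coords {..n})"
      by (rule polyfun_compose[OF polyfun_mpoly_eval[OF f] polyfun_frame[OF bc(1)]])
    then obtain h where h: "h \<in> mpolys {..n}" "\<And>x. mpoly_eval x h = mpoly_eval (frame n b c i j x) f"
      by (rule polyfun_imp_mpoly) blast
    have "\<forall>\<mu>\<in>Poly_Mapping.keys h. m \<le> off_degree i j \<mu>"
      using ord_ge_imp_off_degree[OF bc(1) f h] asm l bc(2) by auto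
    then show "\<exists>b c i j h. pivots n b c i j \<and> L l = lin2 b c \<and> h \<in> mpolys {..n} \<and>
      (\<forall>x. mpoly_eval x h = mpoly_eval (frame n b c i j x) f) \<and>
      (\<forall>\<mu>\<in>Poly_Mapping.keys h. m \<le> off_degree i j \<mu>)"
      using bc h by blast
  qed
qed

section \<open>Monomials of given degree\<close>

definition mono_degree :: "('v \<Rightarrow>\<^sub>0 nat) \<Rightarrow> nat" where
  "mono_degree \<mu> = (\<Sum>x\<in>Poly_Mapping.keys \<mu>. Poly_Mapping.lookup \<mu> x)"

definition monomials :: "'v set \<Rightarrow> nat \<Rightarrow> ('v \<Rightarrow>\<^sub>0 nat) set" where
  "monomials X d = {\<mu>. Poly_Mapping.keys \<mu> \<subseteq> X \<and> mono_degree \<mu> = d}"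

lemma mono_degree_superset:
  assumes "finite K" "Poly_Mapping.keys \<mu> \<subseteq> K"
  shows "mono_degree \<mu> = (\<Sum>x\<in>K. Poly_Mapping.lookup \<mu> x)"
  unfolding mono_degree_def by (rule sum.mono_neutral_left) (use assms in \<open>auto simp: in_keys_iff\<close>)

lemma mono_degree_add: "mono_degree (\<mu> + \<nu>) = mono_degree \<mu> + mono_degree \<nu>"
proof -
  let ?K = "Poly_Mapping.keys \<mu> \<union> Poly_Mapping.keys \<nu>"
  have "Poly_Mapping.keys (\<mu> + \<nu>) \<subseteq> ?K" by (rule Poly_Mapping.keys_add)
  then show ?thesis by (simp add: mono_degree_superset[of ?K] lookup_add sum.distrib)
qed

lemma mono_degree_single [simp]: "mono_degree (Poly_Mapping.single x e) = e"
  by (simp add: mono_degree_def)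

lemma monomials_empty: "monomials {} d = (if d = 0 then {0} else {})"
  by (auto simp: monomials_def mono_degree_def)

lemma monomials_insert:
  assumes "x \<notin> X"
  shows "monomials (insert x X) d = (\<Union>e\<le>d. (\<lambda>\<mu>. Poly_Mapping.single x e + \<mu>) ` monomials X (d - e))"
proof (intro Set.set_eqI iffI)
  fix \<mu> assume \<mu>: "\<mu> \<in> monomials (insert x X) d"
  define e where "e = Poly_Mapping.lookup \<mu> x"
  define \<nu> where "\<nu> = \<mu> - Poly_Mapping.single x e"
  have lk: "Poly_Mapping.lookup \<nu> y = (if y = x then 0 else Poly_Mapping.lookup \<mu> y)" for y
    by (simp add: \<nu>_def lookup_minus lookup_single e_def)
  have eq: "\<mu> = Poly_Mapping.single x e + \<nu>"
    by (rule poly_mapping_eqI) (auto simp: lookup_add lk lookup_single e_def)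
  have "Poly_Mapping.keys \<nu> \<subseteq> X"
  proof
    fix y assume "y \<in> Poly_Mapping.keys \<nu>"
    then have "y \<noteq> x" "y \<in> Poly_Mapping.keys \<mu>" by (auto simp: in_keys_iff lk split: if_splits)
    then show "y \<in> X" using \<mu> by (auto simp: monomials_def)
  qed
  moreover have "e + mono_degree \<nu> = d"
    using \<mu> mono_degree_add[of "Poly_Mapping.single x e" \<nu>] by (simp add: monomials_def flip: eq)
  ultimately have "e \<le> d" "\<nu> \<in> monomials X (d - e)" by (auto simp: monomials_def)
  then show "\<mu> \<in> (\<Union>e\<le>d. (\<lambda>\<mu>. Poly_Mapping.single x e + \<mu>) ` monomials X (d - e))"
    using eq by blast
next
  fix \<mu> assume "\<mu> \<in> (\<Union>e\<le>d. (\<lambda>\<mu>. Poly_Mapping.single x e + \<mu>) ` monomials X (d - e))"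
  then obtain e \<nu> where e: "e \<le> d" "\<nu> \<in> monomials X (d - e)" "\<mu> = Poly_Mapping.single x e + \<nu>" by auto
  have "Poly_Mapping.keys \<mu> \<subseteq> Poly_Mapping.keys (Poly_Mapping.single x e) \<union> Poly_Mapping.keys \<nu>"
    unfolding e(3) by (rule Poly_Mapping.keys_add)
  also have "\<dots> \<subseteq> insert x X" using e(2) by (auto simp: monomials_def)
  finally show "\<mu> \<in> monomials (insert x X) d" using e by (simp add: monomials_def mono_degree_add)
qed

lemma finite_monomials: "finite X \<Longrightarrow> finite (monomials X d)"
  by (induction X arbitrary: d rule: finite_induct) (auto simp: monomials_empty monomials_insert)

lemma card_monomials_insert:
  assumes "finite X" "x \<notin> X"
  shows "card (monomials (insert x X) d) = (\<Sum>e\<le>d. card (monomials X e))"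
proof -
  have lk: "Poly_Mapping.lookup \<mu> x = 0" if "\<mu> \<in> monomials X e" for \<mu> e
    using that assms(2) by (auto simp: monomials_def in_keys_iff)
  have "card (monomials (insert x X) d) = (\<Sum>e\<le>d. card ((\<lambda>\<mu>. Poly_Mapping.single x e + \<mu>) ` monomials X (d - e)))"
    unfolding monomials_insert[OF assms(2)]
  proof (rule card_UN_disjoint)
    show "\<forall>i\<in>{..d}. \<forall>j\<in>{..d}. i \<noteq> j \<longrightarrow>
      (\<lambda>\<mu>. Poly_Mapping.single x i + \<mu>) ` monomials X (d - i) \<inter>
      (\<lambda>\<mu>. Poly_Mapping.single x j + \<mu>) ` monomials X (d - j) = {}"
    proof (intro ballI impI equals0I)
      fix i j \<mu> assume "i \<noteq> j" and \<mu>: "\<mu> \<in> (\<lambda>\<mu>. Poly_Mapping.single x i + \<mu>) ` monomials X (d - i) \<inter>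
        (\<lambda>\<mu>. Poly_Mapping.single x j + \<mu>) ` monomials X (d - j)"
      have "Poly_Mapping.lookup \<mu> x = e" if "\<mu> \<in> (\<lambda>\<mu>. Poly_Mapping.single x e + \<mu>) ` monomials X (d - e)" for e
        using that lk by (auto simp: lookup_add)
      from this[of i] this[of j] show False using \<open>i \<noteq> j\<close> \<mu> by simp
    qed
  qed (use assms finite_monomials in auto)
  also have "\<dots> = (\<Sum>e\<le>d. card (monomials X (d - e)))"
    by (intro sum.cong card_image refl) (auto simp: inj_on_def)
  also have "\<dots> = (\<Sum>e\<le>d. card (monomials X e))"
    by (rule sum.reindex_bij_witness[of _ "\<lambda>e. d - e" "\<lambda>e. d - e"]) auto
  finally show ?thesis .
qed

lemma card_monomials:
  assumes "finite X" "card X = Suc k"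
  shows "card (monomials X d) = (d + k) choose k"
  using assms
proof (induction k arbitrary: X d)
  case 0
  then obtain x where X: "X = insert x {}" by (auto simp: card_1_singleton_iff)
  show ?case unfolding X by (subst card_monomials_insert) (auto simp: monomials_empty sum.delta if_distrib cong: if_cong)
next
  case (Suc k)
  then obtain x Y where X: "X = insert x Y" "x \<notin> Y" "card Y = Suc k" by (metis card_Suc_eq)
  have "finite Y" using Suc.prems X by simp
  then have "card (monomials X d) = (\<Sum>e\<le>d. (e + k) choose k)"
    using card_monomials_insert[OF _ X(2)] Suc.IH[OF _ X(3)] X(1) by simp
  also have "\<dots> = (\<Sum>e\<le>d. (k + e) choose k)" by (simp add: add.commute)
  also have "\<dots> = (k + d + 1) choose (k + 1)" by (rule choose_rising_sum(1))
  also have "k + d + 1 = d + Suc k" by simp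
  also have "k + 1 = Suc k" by simp
  finally show ?case .
qed

lemma is_form_mono_degree: "is_form d p \<longleftrightarrow> (\<forall>\<mu>\<in>Poly_Mapping.keys p. mono_degree \<mu> = d)"
  by (simp add: is_form_def mono_degree_def)

lemma form_keys: "p \<in> mpolys X \<Longrightarrow> is_form d p \<Longrightarrow> Poly_Mapping.keys p \<subseteq> monomials X d"
  by (auto simp: mpolys_def is_form_mono_degree monomials_def)

definition mpoly_of_coeffs :: "('v \<Rightarrow>\<^sub>0 nat) set \<Rightarrow> (('v \<Rightarrow>\<^sub>0 nat) \<Rightarrow> 'k) \<Rightarrow> ('v, 'k::comm_ring_1) mpoly" where
  "mpoly_of_coeffs M c = (\<Sum>\<mu>\<in>M. Poly_Mapping.single \<mu> (c \<mu>))"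

lemma lookup_mpoly_of_coeffs:
  assumes "finite M"
  shows "Poly_Mapping.lookup (mpoly_of_coeffs M c) \<mu> = (if \<mu> \<in> M then c \<mu> else 0)"
  using assms by (simp add: mpoly_of_coeffs_def lookup_sum lookup_single when_def sum.delta')

lemma mpoly_eval_mpoly_of_coeffs: "mpoly_eval a (mpoly_of_coeffs M c) = (\<Sum>\<mu>\<in>M. c \<mu> * mono_eval a \<mu>)"
  by (simp add: mpoly_of_coeffs_def mpoly_eval_sum mpoly_eval_single)

lemma keys_mpoly_of_coeffs: "finite M \<Longrightarrow> Poly_Mapping.keys (mpoly_of_coeffs M c) \<subseteq> M"
  by (auto simp: in_keys_iff lookup_mpoly_of_coeffs split: if_splits)

lemma mpoly_of_coeffs_form:
  assumes "finite X"
  shows "mpoly_of_coeffs (monomials X d) c \<in> mpolys X" "is_form d (mpoly_of_coeffs (monomials X d) c)"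
  using keys_mpoly_of_coeffs[OF finite_monomials[OF assms], of d c]
  by (auto simp: mpolys_def is_form_mono_degree monomials_def)

lemma form_eq_mpoly_of_coeffs:
  assumes "finite X" "p \<in> mpolys X" "is_form d p"
  shows "p = mpoly_of_coeffs (monomials X d) (Poly_Mapping.lookup p)"
  unfolding mpoly_of_coeffs_def
  by (rule mpoly_sum_monomials[OF finite_monomials[OF assms(1)] form_keys[OF assms(2,3)]])


section \<open>The general value of the initial degree\<close>

text \<open>
  Elimination without division replaces minors, so the number of rows may be infinite: the
  pivot \<open>g\<close> is an entry that is nonzero at \<open>b0\<close>, and the column \<open>\<nu>\<close> is cleared after multiplication
  by \<open>g\<close>.
\<close>
lemma independent_columns_open:
  fixes G :: "'e \<Rightarrow> 'm \<Rightarrow> 't \<Rightarrow> 'k::field"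
  assumes "finite M" "\<And>\<kappa> \<mu>. \<mu> \<in> M \<Longrightarrow> G \<kappa> \<mu> \<in> polyfun C"
    and "\<And>c. (\<And>\<kappa>. (\<Sum>\<mu>\<in>M. c \<mu> * G \<kappa> \<mu> b0) = 0) \<Longrightarrow> \<forall>\<mu>\<in>M. c \<mu> = 0"
  shows "\<exists>h\<in>polyfun C. h b0 \<noteq> 0 \<and>
    (\<forall>b. h b \<noteq> 0 \<longrightarrow> (\<forall>c. (\<forall>\<kappa>. (\<Sum>\<mu>\<in>M. c \<mu> * G \<kappa> \<mu> b) = 0) \<longrightarrow> (\<forall>\<mu>\<in>M. c \<mu> = 0)))"
  using assms
proof (induction M arbitrary: G rule: finite_induct)
  case empty
  then show ?case by (intro bexI[of _ "\<lambda>_. 1"]) (auto intro: polyfun_intros)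
next
  case (insert \<nu> M)
  obtain \<kappa>0 where \<kappa>0: "G \<kappa>0 \<nu> b0 \<noteq> 0"
  proof (rule ccontr)
    assume "\<not> thesis"
    then have "\<And>\<kappa>. G \<kappa> \<nu> b0 = 0" using that by blast
    then have "(\<Sum>\<mu>\<in>insert \<nu> M. (if \<mu> = \<nu> then 1 else 0) * G \<kappa> \<mu> b0) = 0" for \<kappa>
      by (intro sum.neutral) auto
    from insert.prems(2)[OF this] show False by auto
  qed
  define g where "g = G \<kappa>0 \<nu>"
  define G' where "G' = (\<lambda>\<kappa> \<mu> b. g b * G \<kappa> \<mu> b - G \<kappa>0 \<mu> b * G \<kappa> \<nu> b)"
  have G: "G \<kappa> \<mu> \<in> polyfun C" if "\<mu> \<in> insert \<nu> M" for \<kappa> \<mu> using insert.prems(1)[OF that] .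
  have g: "g \<in> polyfun C" using G by (simp add: g_def)
  have G': "G' \<kappa> \<mu> \<in> polyfun C" if "\<mu> \<in> M" for \<kappa> \<mu>
    unfolding G'_def by (intro polyfun_intros g G) (use that in auto)
  have sumG': "(\<Sum>\<mu>\<in>M. c \<mu> * G' \<kappa> \<mu> b) =
      g b * (\<Sum>\<mu>\<in>M. c \<mu> * G \<kappa> \<mu> b) - (\<Sum>\<mu>\<in>M. c \<mu> * G \<kappa>0 \<mu> b) * G \<kappa> \<nu> b" for c \<kappa> b
    by (simp add: G'_def algebra_simps sum_subtractf sum_distrib_left sum_distrib_right)
  have indep': "\<forall>\<mu>\<in>M. c \<mu> = 0" if c: "\<And>\<kappa>. (\<Sum>\<mu>\<in>M. c \<mu> * G' \<kappa> \<mu> b0) = 0" for c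
  proof -
    define c' where "c' = (\<lambda>\<mu>. if \<mu> = \<nu> then - (\<Sum>\<mu>\<in>M. c \<mu> * G \<kappa>0 \<mu> b0) else g b0 * c \<mu>)"
    have "(\<Sum>\<mu>\<in>M. c' \<mu> * G \<kappa> \<mu> b0) = (\<Sum>\<mu>\<in>M. g b0 * c \<mu> * G \<kappa> \<mu> b0)" for \<kappa>
      by (rule sum.cong) (use insert.hyps in \<open>auto simp: c'_def\<close>)
    then have "(\<Sum>\<mu>\<in>insert \<nu> M. c' \<mu> * G \<kappa> \<mu> b0) = 0" for \<kappa>
      using c[of \<kappa>] insert.hyps by (simp add: sumG' c'_def sum_distrib_left mult.assoc)
    from insert.prems(2)[OF this] have "\<forall>\<mu>\<in>M. c' \<mu> = 0" by auto
    then show ?thesis using \<kappa>0 insert.hyps by (auto simp: c'_def g_def split: if_splits)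
  qed
  have "\<exists>h\<in>polyfun C. h b0 \<noteq> 0 \<and>
    (\<forall>b. h b \<noteq> 0 \<longrightarrow> (\<forall>c. (\<forall>\<kappa>. (\<Sum>\<mu>\<in>M. c \<mu> * G' \<kappa> \<mu> b) = 0) \<longrightarrow> (\<forall>\<mu>\<in>M. c \<mu> = 0)))"
  proof (rule insert.IH)
    show "G' \<kappa> \<mu> \<in> polyfun C" if "\<mu> \<in> M" for \<kappa> \<mu> by (rule G'[OF that])
    show "\<forall>\<mu>\<in>M. c \<mu> = 0" if "\<And>\<kappa>. (\<Sum>\<mu>\<in>M. c \<mu> * G' \<kappa> \<mu> b0) = 0" for c
      by (rule indep') (rule that)
  qed
  then obtain h where h: "h \<in> polyfun C" "h b0 \<noteq> 0"
    and h': "\<And>b c. h b \<noteq> 0 \<Longrightarrow> (\<forall>\<kappa>. (\<Sum>\<mu>\<in>M. c \<mu> * G' \<kappa> \<mu> b) = 0) \<Longrightarrow> \<forall>\<mu>\<in>M. c \<mu> = 0" by blast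
  have "\<forall>\<mu>\<in>insert \<nu> M. c \<mu> = 0"
    if b: "g b * h b \<noteq> 0" and c: "\<forall>\<kappa>. (\<Sum>\<mu>\<in>insert \<nu> M. c \<mu> * G \<kappa> \<mu> b) = 0" for b c
  proof -
    have split: "(\<Sum>\<mu>\<in>M. c \<mu> * G \<kappa> \<mu> b) = - (c \<nu> * G \<kappa> \<nu> b)" for \<kappa>
      using spec[OF c, of \<kappa>] insert.hyps by (simp add: add_eq_0_iff)
    have "(\<Sum>\<mu>\<in>M. c \<mu> * G' \<kappa> \<mu> b) = 0" for \<kappa>
      unfolding sumG' split by (simp add: g_def)
    then have M: "\<forall>\<mu>\<in>M. c \<mu> = 0" using h'[of b c] b by auto
    then have "(\<Sum>\<mu>\<in>M. c \<mu> * G \<kappa>0 \<mu> b) = 0" by (intro sum.neutral) auto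
    then have "c \<nu> = 0" using split[of \<kappa>0] b by (simp add: g_def)
    then show ?thesis using M by simp
  qed
  then show ?case using h g \<kappa>0
    by (intro bexI[of _ "\<lambda>b. g b * h b"]) (auto intro: polyfun.mult simp: g_def)
qed

definition tuple_row :: "nat \<Rightarrow> (nat \<times> nat \<times> nat \<Rightarrow> 'k::zero) \<Rightarrow> nat \<Rightarrow> nat \<Rightarrow> nat \<Rightarrow> 'k" where
  "tuple_row n b l j = (\<lambda>i. if i \<le> n then b (l, j, i) else 0)"

lemma spanned_tuple_line:
  "l < s \<Longrightarrow> spanned_tuple n 1 s b l = lin2 (tuple_row n b l 0) (tuple_row n b l 1)"
proof -
  assume "l < s"
  moreover have "{..1::nat} = {0, 1}" by auto
  ultimately show ?thesis by (simp add: spanned_tuple_def tuple_row_def flip: span_pair)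
qed

lemma plane_tuples_iff:
  "L \<in> plane_tuples n r s \<longleftrightarrow> L \<in> extensional {..<s} \<and> (\<forall>l<s. L l \<in> planes n r)"
  by (auto simp: plane_tuples_def PiE_iff)

lemma spanned_tuple_extensional: "spanned_tuple n r s b \<in> extensional {..<s}"
  by (simp add: spanned_tuple_def)

lemma spanned_tuple_in_plane_tuples:
  "spanned_tuple n 1 s b \<in> plane_tuples n 1 s \<longleftrightarrow>
     (\<forall>l<s. \<exists>i j. pivots n (tuple_row n b l 0) (tuple_row n b l 1) i j)"
proof -
  have "lin2 (tuple_row n b l 0) (tuple_row n b l 1) \<in> planes n 1 \<longleftrightarrow>
      (\<exists>i j. pivots n (tuple_row n b l 0) (tuple_row n b l 1) i j)" for l
    using lin2_in_planes dim_imp_pivots[of "tuple_row n b l 0" "tuple_row n b l 1" n]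
    by (fastforce simp: planes_def span_pair tuple_row_def)
  then show ?thesis
    by (simp add: plane_tuples_iff spanned_tuple_extensional spanned_tuple_line del: One_nat_def)
qed

lemma plane_tuple_spanned:
  fixes L :: "nat \<Rightarrow> (nat \<Rightarrow> 'k::field) set"
  assumes "L \<in> plane_tuples n 1 s"
  obtains b where "L = spanned_tuple n 1 s b"
proof -
  have "\<exists>p q. L l = lin2 p q \<and> (\<forall>k>n. p k = 0 \<and> q k = 0)" if l: "l < s" for l
  proof -
    have "L l \<in> planes n 1" using assms l by (simp add: plane_tuples_iff)
    then obtain p q i j where "pivots n p q i j" "L l = lin2 p q" by (rule planes_cases)
    then show ?thesis by (auto simp: pivots_def)
  qed
  then obtain p q where pq: "\<And>l. l < s \<Longrightarrow> L l = lin2 (p l) (q l)"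
    "\<And>l k. l < s \<Longrightarrow> k > n \<Longrightarrow> p l k = 0 \<and> q l k = 0" by metis
  define b where "b = (\<lambda>(l, j, i). if j = (0::nat) then p l i else q l i)"
  have "L = spanned_tuple n 1 s b"
  proof (rule extensionalityI[of _ "{..<s}"])
    show "L \<in> extensional {..<s}" using assms by (simp add: plane_tuples_iff)
    show "spanned_tuple n 1 s b \<in> extensional {..<s}" by (rule spanned_tuple_extensional)
    fix l assume "l \<in> {..<s}"
    then have l: "l < s" by simp
    have "tuple_row n b l 0 = p l" "tuple_row n b l 1 = q l"
      using pq(2)[OF l] by (auto simp: tuple_row_def b_def fun_eq_iff)
    then show "L l = spanned_tuple n 1 s b l" using pq(1)[OF l] by (simp add: spanned_tuple_line[OF l] del: One_nat_def)
  qed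
  then show ?thesis by (rule that)
qed

abbreviation tuple_coords :: "nat \<Rightarrow> nat \<Rightarrow> (((nat \<times> nat \<times> nat) \<Rightarrow> 'k) \<Rightarrow> 'k) set" where
  "tuple_coords n s \<equiv> coords ({..<s} \<times> {..1} \<times> {..n})"

lemma polyfun_tuple_row:
  "l < s \<Longrightarrow> j \<le> 1 \<Longrightarrow> (\<lambda>b. tuple_row n b l j i) \<in> polyfun (tuple_coords n s)"
  by (cases "i \<le> n") (auto simp: tuple_row_def intro: polyfun_intros)

lemma full_rank_open:
  fixes b0 :: "nat \<times> nat \<times> nat \<Rightarrow> 'k::field"
  assumes "spanned_tuple n 1 s b0 \<in> plane_tuples n 1 s"
  shows "\<exists>h\<in>polyfun (tuple_coords n s). h b0 \<noteq> 0 \<and>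
    (\<forall>b. h b \<noteq> 0 \<longrightarrow> spanned_tuple n 1 s b \<in> plane_tuples n 1 s)"
proof -
  obtain i j where ij: "\<And>l. l < s \<Longrightarrow> pivots n (tuple_row n b0 l 0) (tuple_row n b0 l 1) (i l) (j l)"
    using assms unfolding spanned_tuple_in_plane_tuples by metis
  define h where "h = (\<lambda>b :: nat \<times> nat \<times> nat \<Rightarrow> 'k. \<Prod>l<s.
    tuple_row n b l 0 (i l) * tuple_row n b l 1 (j l) - tuple_row n b l 0 (j l) * tuple_row n b l 1 (i l))"
  have "h \<in> polyfun (tuple_coords n s)"
    unfolding h_def by (intro polyfun_prod polyfun_diff polyfun.mult polyfun_tuple_row) auto
  moreover have "h b0 \<noteq> 0" using ij by (auto simp: h_def pivots_def)
  moreover have "spanned_tuple n 1 s b \<in> plane_tuples n 1 s" if "h b \<noteq> 0" for b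
    unfolding spanned_tuple_in_plane_tuples
  proof (intro allI impI exI)
    fix l assume l: "l < s"
    have "tuple_row n b l 0 (i l) * tuple_row n b l 1 (j l) -
        tuple_row n b l 0 (j l) * tuple_row n b l 1 (i l) \<noteq> 0"
      using that l unfolding h_def by (simp add: prod_zero_iff del: One_nat_def)
    then show "pivots n (tuple_row n b l 0) (tuple_row n b l 1) (i l) (j l)"
      using ij[OF l] by (simp add: pivots_def tuple_row_def)
  qed
  ultimately show ?thesis by blast
qed

definition no_forms_below :: "nat \<Rightarrow> nat \<Rightarrow> nat \<Rightarrow> nat \<Rightarrow> (nat \<Rightarrow> (nat \<Rightarrow> 'k::field) set) \<Rightarrow> bool" where
  "no_forms_below n s m a L \<longleftrightarrow> (\<forall>d<a. \<forall>f\<in>symbolic_power (coord_ring n) (union_ideal n s L) m.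
     is_form d f \<longrightarrow> f = 0)"

text \<open>
  The linear functional on the coefficients of a form that extracts, at the point of the \<open>l\<close>-th
  line with parameters \<open>u\<close> and \<open>v\<close>, the coefficient of degree \<open>i\<close> in the direction \<open>y\<close>. Outside
  the relevant range it is zero, so that all tuples can serve as row indices.
\<close>
definition vanishing_cond ::
  "nat \<Rightarrow> nat \<Rightarrow> nat \<Rightarrow> nat \<times> nat \<times> 'k \<times> 'k \<times> (nat \<Rightarrow> 'k) \<Rightarrow> (nat \<Rightarrow>\<^sub>0 nat) \<Rightarrow>
    (nat \<times> nat \<times> nat \<Rightarrow> 'k::field) \<Rightarrow> 'k" where
  "vanishing_cond n s m = (\<lambda>(l, i, u, v, y) \<mu> b. if l < s \<and> i < m then
     coeff (line_poly (\<lambda>x. mono_eval x \<mu>) (\<lambda>k. u * tuple_row n b l 0 k + v * tuple_row n b l 1 k) y) i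
     else 0)"

lemma no_form_iff_independent:
  fixes b :: "nat \<times> nat \<times> nat \<Rightarrow> 'k::{field,infinite}"
  assumes b: "spanned_tuple n 1 s b \<in> plane_tuples n 1 s"
  shows "(\<forall>f\<in>symbolic_power (coord_ring n) (union_ideal n s (spanned_tuple n 1 s b)) m.
      is_form d f \<longrightarrow> f = 0) \<longleftrightarrow>
    (\<forall>c. (\<forall>\<kappa>. (\<Sum>\<mu>\<in>monomials {..n} d. c \<mu> * vanishing_cond n s m \<kappa> \<mu> b) = 0) \<longrightarrow> (\<forall>\<mu>\<in>monomials {..n} d. c \<mu> = 0))"
proof -
  let ?M = "monomials {..n} d" and ?L = "spanned_tuple n 1 s b"
  have fin: "finite ?M" by (rule finite_monomials) simp
  have L: "\<forall>l<s. ?L l \<in> planes n 1" using b by (simp add: plane_tuples_iff)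
  have eq: "mpoly_of_coeffs ?M c \<in> symbolic_power (coord_ring n) (union_ideal n s ?L) m \<longleftrightarrow>
      (\<forall>\<kappa>. (\<Sum>\<mu>\<in>?M. c \<mu> * vanishing_cond n s m \<kappa> \<mu> b) = 0)" for c
  proof -
    let ?f = "mpoly_of_coeffs ?M c"
    have line: "line_poly (\<lambda>x. mpoly_eval x ?f) a y =
        (\<Sum>\<mu>\<in>?M. smult (c \<mu>) (line_poly (\<lambda>x. mono_eval x \<mu>) a y))" for a y
      by (rule line_polyI)
        (simp add: mpoly_eval_mpoly_of_coeffs poly_sum poly_line_poly[OF polyfun_mono_eval[OF order.refl]])
    have "?f \<in> symbolic_power (coord_ring n) (union_ideal n s ?L) m \<longleftrightarrow>
        (\<forall>l<s. \<forall>a\<in>?L l. ord_ge m (\<lambda>x. mpoly_eval x ?f) a)"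
      using symbolic_power_iff[OF L] mpoly_of_coeffs_form(1)[of "{..n}" d c] by simp
    also have "\<dots> \<longleftrightarrow> (\<forall>l u v y i. l < s \<longrightarrow> i < m \<longrightarrow> coeff (line_poly (\<lambda>x. mpoly_eval x ?f)
        (\<lambda>k. u * tuple_row n b l 0 k + v * tuple_row n b l 1 k) y) i = 0)"
      by (auto simp: spanned_tuple_line lin2_def ord_ge_def simp del: One_nat_def)
    also have "\<dots> \<longleftrightarrow> (\<forall>\<kappa>. (\<Sum>\<mu>\<in>?M. c \<mu> * vanishing_cond n s m \<kappa> \<mu> b) = 0)"
    proof -
      have "(\<Sum>\<mu>\<in>?M. c \<mu> * vanishing_cond n s m (l, i, u, v, y) \<mu> b) =
          (if l < s \<and> i < m then coeff (line_poly (\<lambda>x. mpoly_eval x ?f)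
            (\<lambda>k. u * tuple_row n b l 0 k + v * tuple_row n b l 1 k) y) i else 0)" for l i u v y
        by (cases "l < s \<and> i < m")
          (simp_all add: vanishing_cond_def line coeff_sum, auto intro!: sum.neutral)
      then show ?thesis by (simp add: split_paired_All del: One_nat_def) blast
    qed
    finally show ?thesis .
  qed
  show ?thesis
  proof (intro iffI allI impI ballI)
    fix c \<mu>
    assume "\<forall>f\<in>symbolic_power (coord_ring n) (union_ideal n s ?L) m. is_form d f \<longrightarrow> f = 0"
      "\<forall>\<kappa>. (\<Sum>\<mu>\<in>?M. c \<mu> * vanishing_cond n s m \<kappa> \<mu> b) = 0" and \<mu>: "\<mu> \<in> ?M"
    then have "mpoly_of_coeffs ?M c = 0" using eq[of c] mpoly_of_coeffs_form(2)[of "{..n}" d c] by blast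
    then show "c \<mu> = 0" using lookup_mpoly_of_coeffs[OF fin, of c \<mu>] \<mu> by simp
  next
    fix f
    assume indep: "\<forall>c. (\<forall>\<kappa>. (\<Sum>\<mu>\<in>?M. c \<mu> * vanishing_cond n s m \<kappa> \<mu> b) = 0) \<longrightarrow> (\<forall>\<mu>\<in>?M. c \<mu> = 0)"
      and f: "f \<in> symbolic_power (coord_ring n) (union_ideal n s ?L) m" "is_form d f"
    have "f \<in> mpolys {..n}" using f(1) by (simp add: symbolic_power_def)
    then have f_eq: "f = mpoly_of_coeffs ?M (Poly_Mapping.lookup f)"
      by (intro form_eq_mpoly_of_coeffs f(2)) auto
    then have "\<forall>\<mu>\<in>?M. Poly_Mapping.lookup f \<mu> = 0" using indep eq f(1) by metis
    then show "f = 0" by (subst f_eq) (simp add: mpoly_of_coeffs_def)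
  qed
qed

text \<open>
  Semicontinuity of \<open>alpha\<close>. There is no form of degree \<open>d\<close> exactly if the columns of the matrix
  \<open>vanishing_cond\<close> at the monomials of degree \<open>d\<close> are linearly independent.
\<close>
lemma no_forms_below_open:
  fixes b0 :: "nat \<times> nat \<times> nat \<Rightarrow> 'k::{field,infinite}"
  assumes b0: "spanned_tuple n 1 s b0 \<in> plane_tuples n 1 s"
    and nf: "no_forms_below n s m a (spanned_tuple n 1 s b0)"
  shows "\<exists>h\<in>polyfun (tuple_coords n s). h b0 \<noteq> 0 \<and>
    (\<forall>b. h b \<noteq> 0 \<longrightarrow> spanned_tuple n 1 s b \<in> plane_tuples n 1 s \<and>
      no_forms_below n s m a (spanned_tuple n 1 s b))"
proof -
  let ?G = "vanishing_cond n s m :: _ \<Rightarrow> _ \<Rightarrow> _ \<Rightarrow> 'k"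
  have G: "?G \<kappa> \<mu> \<in> polyfun (tuple_coords n s)" for \<kappa> \<mu>
  proof -
    obtain l i u v y where \<kappa>: "\<kappa> = (l, i, u, v, y)" by (cases \<kappa>) auto
    show ?thesis
    proof (cases "l < s \<and> i < m")
      case True
      then have "(\<lambda>b. coeff (line_poly (\<lambda>x. mono_eval x \<mu>)
        (\<lambda>k. u * tuple_row n b l 0 k + v * tuple_row n b l 1 k) y) i) \<in> polyfun (tuple_coords n s)"
        by (intro polyfun_coeff_line_poly[OF polyfun_mono_eval[OF order.refl]] polyfun.add polyfun.mult
            polyfun.const polyfun_tuple_row) auto
      then show ?thesis using True by (simp add: vanishing_cond_def \<kappa>)
    next
      case False
      then have "?G \<kappa> \<mu> = (\<lambda>_. 0)" by (auto simp: vanishing_cond_def \<kappa>)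
      then show ?thesis by (simp only: polyfun.const)
    qed
  qed
  define indep where "indep = (\<lambda>d b. \<forall>c. (\<forall>\<kappa>. (\<Sum>\<mu>\<in>monomials {..n} d. c \<mu> * ?G \<kappa> \<mu> b) = 0) \<longrightarrow>
    (\<forall>\<mu>\<in>monomials {..n} d. c \<mu> = 0))"
  have nf_iff: "no_forms_below n s m a (spanned_tuple n 1 s b) \<longleftrightarrow> (\<forall>d<a. indep d b)"
    if "spanned_tuple n 1 s b \<in> plane_tuples n 1 s" for b
    unfolding no_forms_below_def indep_def using no_form_iff_independent[OF that] by blast
  have "\<exists>h\<in>polyfun (tuple_coords n s). h b0 \<noteq> 0 \<and> (\<forall>b. h b \<noteq> 0 \<longrightarrow> indep d b)" if "d < a" for d
    unfolding indep_def
  proof (rule independent_columns_open)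
    fix c assume "\<And>\<kappa>. (\<Sum>\<mu>\<in>monomials {..n} d. c \<mu> * ?G \<kappa> \<mu> b0) = 0"
    then show "\<forall>\<mu>\<in>monomials {..n} d. c \<mu> = 0"
      using nf that nf_iff[OF b0] unfolding indep_def by blast
  qed (rule finite_monomials, simp, rule G)
  then obtain h where h: "\<And>d. d < a \<Longrightarrow> h d \<in> polyfun (tuple_coords n s)" "\<And>d. d < a \<Longrightarrow> h d b0 \<noteq> 0"
    "\<And>d b. d < a \<Longrightarrow> h d b \<noteq> 0 \<Longrightarrow> indep d b" by metis
  obtain r where r: "r \<in> polyfun (tuple_coords n s)" "r b0 \<noteq> 0"
    "\<And>b. r b \<noteq> 0 \<Longrightarrow> spanned_tuple n 1 s b \<in> plane_tuples n 1 s"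
    using full_rank_open[OF b0] by blast
  define H where "H = (\<lambda>b. r b * (\<Prod>d<a. h d b))"
  have "H \<in> polyfun (tuple_coords n s)"
    unfolding H_def using h(1) r(1) by (intro polyfun.mult polyfun_prod) auto
  moreover have "H b0 \<noteq> 0" using h(2) r(2) by (auto simp: H_def)
  moreover have "spanned_tuple n 1 s b \<in> plane_tuples n 1 s \<and>
      no_forms_below n s m a (spanned_tuple n 1 s b)" if "H b \<noteq> 0" for b
  proof -
    have "r b \<noteq> 0" "\<And>d. d < a \<Longrightarrow> h d b \<noteq> 0" using that by (auto simp: H_def)
    then show ?thesis using r(3) nf_iff h(3) by blast
  qed
  ultimately show ?thesis by blast
qed

text \<open>
  The space of tuples of matrices is an affine space, hence irreducible.
\<close>
lemma zariski_open_Int_nonempty: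
  fixes U U' :: "(nat \<Rightarrow> (nat \<Rightarrow> 'k::{field,infinite}) set) set"
  assumes "zariski_open n 1 s U" "U \<noteq> {}" "zariski_open n 1 s U'" "U' \<noteq> {}"
  shows "U \<inter> U' \<noteq> {}"
proof -
  have witness: "\<exists>b f. f \<in> polyfun (tuple_coords n s) \<and> f b \<noteq> 0 \<and>
      spanned_tuple n 1 s b \<in> plane_tuples n 1 s \<and>
      (\<forall>b. spanned_tuple n 1 s b \<in> plane_tuples n 1 s \<longrightarrow> f b \<noteq> 0 \<longrightarrow> spanned_tuple n 1 s b \<in> U)"
    if U: "zariski_open n 1 s U" "U \<noteq> {}" for U :: "(nat \<Rightarrow> (nat \<Rightarrow> 'k) set) set"
  proof -
    obtain F where F: "F \<subseteq> mpolys ({..<s} \<times> {..1} \<times> {..n})" "U \<subseteq> plane_tuples n 1 s"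
      "\<And>b. spanned_tuple n 1 s b \<in> plane_tuples n 1 s \<Longrightarrow>
        spanned_tuple n 1 s b \<in> U \<longleftrightarrow> (\<exists>f\<in>F. mpoly_eval b f \<noteq> 0)"
      using U(1) unfolding zariski_open_def by blast
    obtain L where L: "L \<in> U" using U(2) by blast
    then obtain b where b: "L = spanned_tuple n 1 s b" using plane_tuple_spanned F(2) by blast
    then obtain f where f: "f \<in> F" "mpoly_eval b f \<noteq> 0" using F(2) F(3)[of b] L by blast
    have "(\<lambda>b. mpoly_eval b f) \<in> polyfun (tuple_coords n s)"
      using F(1) f(1) by (intro polyfun_mpoly_eval) auto
    then show ?thesis using f F(2,3) L b by blast
  qed
  obtain b f where f: "f \<in> polyfun (tuple_coords n s)" "f b \<noteq> 0"
    "spanned_tuple n 1 s b \<in> plane_tuples n 1 s"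
    "\<And>b. spanned_tuple n 1 s b \<in> plane_tuples n 1 s \<Longrightarrow> f b \<noteq> 0 \<Longrightarrow> spanned_tuple n 1 s b \<in> U"
    using witness[OF assms(1,2)] by blast
  obtain b' f' where f': "f' \<in> polyfun (tuple_coords n s)" "f' b' \<noteq> 0"
    "\<And>b. spanned_tuple n 1 s b \<in> plane_tuples n 1 s \<Longrightarrow> f' b \<noteq> 0 \<Longrightarrow> spanned_tuple n 1 s b \<in> U'"
    using witness[OF assms(3,4)] by blast
  obtain h where h: "h \<in> polyfun (tuple_coords n s)" "h b \<noteq> 0"
    "\<And>b. h b \<noteq> 0 \<Longrightarrow> spanned_tuple n 1 s b \<in> plane_tuples n 1 s"
    using full_rank_open[OF f(3)] by blast
  have "\<exists>x. f x * h x \<noteq> 0 \<and> f' x \<noteq> 0"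
    using polyfun_density[OF f'(1) polyfun.mult[OF f(1) h(1)], of b b'] f(2) h(2) f'(2) by auto
  then show ?thesis using f(4) f'(3) h(3) by fastforce
qed

text \<open>
  Since the values of \<open>alpha\<close> on all tuples are at most \<open>t\<close>, their maximum is attained, and by
  semicontinuity it is attained on a nonempty open set. It is the only general value as two
  nonempty open sets meet; a single special tuple bounds it from below.
\<close>
lemma general_alpha_bounds:
  fixes L0 :: "nat \<Rightarrow> (nat \<Rightarrow> 'k::{field,infinite}) set"
  assumes L0: "L0 \<in> plane_tuples n 1 s" and nf: "no_forms_below n s m a L0"
    and ex: "\<And>L :: nat \<Rightarrow> (nat \<Rightarrow> 'k) set. L \<in> plane_tuples n 1 s \<Longrightarrow>
      \<exists>f\<in>symbolic_power (coord_ring n) (union_ideal n s L) m. f \<noteq> 0 \<and> is_form t f"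
  shows "a \<le> general_alpha TYPE('k) n 1 s m" "general_alpha TYPE('k) n 1 s m \<le> t"
proof -
  define al where "al = (\<lambda>L :: nat \<Rightarrow> (nat \<Rightarrow> 'k) set.
    alpha (symbolic_power (coord_ring n) (union_ideal n s L) m))"
  have al_eq: "alpha (symbolic_power (coord_ring n) (union_ideal n s L) m) = al L" for L
    by (simp add: al_def)
  let ?T = "plane_tuples n 1 s :: (nat \<Rightarrow> (nat \<Rightarrow> 'k) set) set"
  have al_le: "al L \<le> t" if "L \<in> ?T" for L
    unfolding al_def alpha_def by (rule Least_le) (rule ex[OF that])
  have al_ge: "c \<le> al L" if nfc: "no_forms_below n s m c L" and L: "L \<in> ?T" for L c
  proof -
    have "\<exists>f\<in>symbolic_power (coord_ring n) (union_ideal n s L) m. f \<noteq> 0 \<and> is_form (al L) f"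
      unfolding al_def alpha_def by (rule LeastI_ex) (use ex[OF L] in blast)
    then show ?thesis using nfc unfolding no_forms_below_def by (metis not_le)
  qed
  have al_nf: "no_forms_below n s m (al L) L" for L
    unfolding no_forms_below_def al_def alpha_def using not_less_Least by blast
  have fin: "finite (al ` ?T)" by (rule finite_subset[of _ "{..t}"]) (use al_le in auto)
  define A where "A = Max (al ` ?T)"
  have "A \<in> al ` ?T" unfolding A_def by (rule Max_in[OF fin]) (use L0 in auto)
  then obtain L1 where L1: "L1 \<in> ?T" "al L1 = A" by auto
  define U where "U = {L \<in> ?T. no_forms_below n s m A L}"
  have U_al: "al L = A" if "L \<in> U" for L
  proof (rule antisym)
    show "al L \<le> A" unfolding A_def using fin that by (intro Max_ge) (auto simp: U_def)
    show "A \<le> al L" using al_ge that by (auto simp: U_def)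
  qed
  have U: "zariski_open n 1 s U"
    unfolding zariski_open_def
  proof (intro conjI exI[of _ "{f \<in> mpolys ({..<s} \<times> {..1} \<times> {..n}).
        \<forall>b. mpoly_eval b f \<noteq> 0 \<longrightarrow> spanned_tuple n 1 s b \<in> U}"] allI impI)
    fix b assume b: "spanned_tuple n 1 s b \<in> ?T"
    show "spanned_tuple n 1 s b \<in> U \<longleftrightarrow> (\<exists>f\<in>{f \<in> mpolys ({..<s} \<times> {..1} \<times> {..n}).
        \<forall>b. mpoly_eval b f \<noteq> 0 \<longrightarrow> spanned_tuple n 1 s b \<in> U}. mpoly_eval b f \<noteq> 0)"
    proof
      assume "spanned_tuple n 1 s b \<in> U"
      then obtain h where h: "h \<in> polyfun (tuple_coords n s)" "h b \<noteq> 0"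
        "\<And>b. h b \<noteq> 0 \<Longrightarrow> spanned_tuple n 1 s b \<in> U"
        using no_forms_below_open[OF b] unfolding U_def by blast
      obtain f where "f \<in> mpolys ({..<s} \<times> {..1} \<times> {..n})" "\<And>b. mpoly_eval b f = h b"
        by (rule polyfun_imp_mpoly[OF h(1)]) blast
      then show "\<exists>f\<in>{f \<in> mpolys ({..<s} \<times> {..1} \<times> {..n}).
        \<forall>b. mpoly_eval b f \<noteq> 0 \<longrightarrow> spanned_tuple n 1 s b \<in> U}. mpoly_eval b f \<noteq> 0"
        using h(2,3) by auto
    qed auto
  qed (auto simp: U_def)
  have "L1 \<in> U" using L1 al_nf[of L1] by (simp add: U_def)
  then have U_ne: "U \<noteq> {}" by blast
  have "general_alpha TYPE('k) n 1 s m = A"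
    unfolding general_alpha_def al_eq
  proof (rule the_equality)
    show "for_general n 1 s (\<lambda>L. al L = A)"
      unfolding for_general_def using U U_ne U_al by blast
    fix A' assume "for_general n 1 s (\<lambda>L. al L = A')"
    then obtain U' where U': "zariski_open n 1 s U'" "U' \<noteq> {}" "\<And>L. L \<in> U' \<Longrightarrow> al L = A'"
      unfolding for_general_def by blast
    then obtain L where "L \<in> U" "L \<in> U'" using zariski_open_Int_nonempty[OF U U_ne] by blast
    then show "A' = A" using U_al U'(3) by blast
  qed
  moreover have "a \<le> A" using al_ge[OF nf L0] Max_ge[OF fin, of "al L0"] L0 by (simp add: A_def)
  moreover have "A \<le> t" using al_le[OF L1(1)] L1(2) by simp
  ultimately show "a \<le> general_alpha TYPE('k) n 1 s m" "general_alpha TYPE('k) n 1 s m \<le> t" by auto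
qed

section \<open>Counting conditions\<close>

lemma homogeneous_system:
  fixes A :: "'e \<Rightarrow> 'm \<Rightarrow> 'k::field"
  assumes "finite E" "finite M" "card E < card M"
  shows "\<exists>c. (\<exists>\<mu>\<in>M. c \<mu> \<noteq> 0) \<and> (\<forall>e\<in>E. (\<Sum>\<mu>\<in>M. A e \<mu> * c \<mu>) = 0)"
  using assms
proof (induction E arbitrary: A M rule: finite_induct)
  case empty
  then have "M \<noteq> {}" by auto
  then show ?case by (intro exI[of _ "\<lambda>_. 1"]) auto
next
  case (insert e E)
  show ?case
  proof (cases "\<forall>\<mu>\<in>M. A e \<mu> = 0")
    case True
    obtain c where "\<exists>\<mu>\<in>M. c \<mu> \<noteq> 0" "\<forall>e\<in>E. (\<Sum>\<mu>\<in>M. A e \<mu> * c \<mu>) = 0"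
      using insert.IH[OF insert.prems(1), of A] insert.prems insert.hyps by auto
    then show ?thesis using True by (intro exI[of _ c]) auto
  next
    case False
    then obtain \<nu> where \<nu>: "\<nu> \<in> M" "A e \<nu> \<noteq> 0" by blast
    let ?M = "M - {\<nu>}"
    have "card E < card ?M" using insert.prems insert.hyps \<nu>(1) by simp
    then obtain c where c: "\<exists>\<mu>\<in>?M. c \<mu> \<noteq> 0"
      "\<And>e'. e' \<in> E \<Longrightarrow> (\<Sum>\<mu>\<in>?M. (A e' \<mu> - A e' \<nu> / A e \<nu> * A e \<mu>) * c \<mu>) = 0"
      using insert.IH[of ?M "\<lambda>e' \<mu>. A e' \<mu> - A e' \<nu> / A e \<nu> * A e \<mu>"] insert.prems(1) by auto
    define S where "S = (\<lambda>e'. \<Sum>\<mu>\<in>?M. A e' \<mu> * c \<mu>)"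
    define c' where "c' = c(\<nu> := - S e / A e \<nu>)"
    have sum: "(\<Sum>\<mu>\<in>M. A e' \<mu> * c' \<mu>) = S e' - A e' \<nu> / A e \<nu> * S e" for e'
    proof -
      have "(\<Sum>\<mu>\<in>M. A e' \<mu> * c' \<mu>) = A e' \<nu> * c' \<nu> + (\<Sum>\<mu>\<in>?M. A e' \<mu> * c' \<mu>)"
        using insert.prems(1) \<nu>(1) by (rule sum.remove)
      also have "(\<Sum>\<mu>\<in>?M. A e' \<mu> * c' \<mu>) = S e'"
        unfolding S_def by (rule sum.cong) (auto simp: c'_def)
      finally show ?thesis by (simp add: c'_def)
    qed
    have zero: "S e' - A e' \<nu> / A e \<nu> * S e = 0" if "e' \<in> insert e E" for e'
    proof (cases "e' = e")
      case True
      then show ?thesis using \<nu>(2) by simp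
    next
      case False
      then have "e' \<in> E" using that by simp
      from c(2)[OF this] show ?thesis
        by (simp add: S_def left_diff_distrib sum_subtractf sum_distrib_left mult.assoc)
    qed
    have "\<exists>\<mu>\<in>M. c' \<mu> \<noteq> 0" using c(1) by (auto simp: c'_def)
    then show ?thesis by (intro exI[of _ c'] conjI ballI) (simp_all only: sum zero)
  qed
qed

lemma off_degree_superset:
  assumes "finite K" "Poly_Mapping.keys \<mu> \<subseteq> K"
  shows "off_degree i j \<mu> = (\<Sum>x\<in>K - {i, j}. Poly_Mapping.lookup \<mu> x)"
  unfolding off_degree_def by (rule sum.mono_neutral_left) (use assms in \<open>auto simp: in_keys_iff\<close>)

text \<open>
  The number of monomials of degree \<open>t\<close> whose degree \<open>d\<close> in the \<open>n - 1\<close> coordinates normal to a line is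
  less than \<open>m\<close>, for \<open>t \<ge> m - 1\<close>; multiplicity \<open>m\<close> along the line imposes that many conditions on
  forms of degree \<open>t\<close>.
\<close>
definition line_conditions :: "nat \<Rightarrow> nat \<Rightarrow> nat \<Rightarrow> nat" where
  "line_conditions n m t = (\<Sum>d<m. (t - d + 1) * ((d + (n - 2)) choose (n - 2)))"

lemma card_low_monomials:
  assumes n: "n \<ge> 2" and ij: "i \<le> n" "j \<le> n" "i \<noteq> j"
  shows "card {\<mu> \<in> monomials {..n} t. off_degree i j \<mu> < m} \<le> line_conditions n m t"
proof -
  define Y where "Y = {..n} - {i, j}"
  have Y: "finite Y" "i \<notin> Y" "j \<notin> Y" "{..n} = insert i (insert j Y)" using ij by (auto simp: Y_def)
  have cardY: "card Y = Suc (n - 2)" using n ij by (simp add: Y_def card_Diff_subset)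
  let ?S = "SIGMA d:{..<m}. {..t - d} \<times> monomials Y d"
  let ?g = "\<lambda>(d, e, \<nu>). Poly_Mapping.single i e + (Poly_Mapping.single j (t - d - e) + \<nu>)"
  have "{\<mu> \<in> monomials {..n} t. off_degree i j \<mu> < m} \<subseteq> ?g ` ?S"
  proof
    fix \<mu> assume "\<mu> \<in> {\<mu> \<in> monomials {..n} t. off_degree i j \<mu> < m}"
    then have \<mu>: "\<mu> \<in> monomials (insert i (insert j Y)) t" "off_degree i j \<mu> < m" by (auto simp: Y(4))
    obtain e \<mu>' where e: "e \<le> t" "\<mu>' \<in> monomials (insert j Y) (t - e)"
      "\<mu> = Poly_Mapping.single i e + \<mu>'"
      using \<mu>(1) ij(3) Y(2) by (auto simp: monomials_insert)
    obtain e' \<nu> where e': "e' \<le> t - e" "\<nu> \<in> monomials Y (t - e - e')"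
      "\<mu>' = Poly_Mapping.single j e' + \<nu>"
      using e(2) Y(3) by (auto simp: monomials_insert)
    define d where "d = t - e - e'"
    have \<nu>: "\<nu> \<in> monomials Y d" using e'(2) by (simp add: d_def)
    have "Poly_Mapping.keys \<mu> \<subseteq> insert i (insert j Y)" using \<mu>(1) by (simp add: monomials_def)
    then have "off_degree i j \<mu> = (\<Sum>x\<in>insert i (insert j Y) - {i, j}. Poly_Mapping.lookup \<mu> x)"
      using Y(1) by (intro off_degree_superset) auto
    also have "\<dots> = (\<Sum>x\<in>Y. Poly_Mapping.lookup \<nu> x)"
      by (rule sum.cong) (use Y in \<open>auto simp: e(3) e'(3) lookup_add lookup_single when_def\<close>)
    also have "\<dots> = d" using mono_degree_superset[OF Y(1), of \<nu>] \<nu> by (simp add: monomials_def)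
    finally have "d < m" using \<mu>(2) by simp
    moreover have "e \<le> t - d" "t - d - e = e'" using e(1) e'(1) by (auto simp: d_def)
    ultimately show "\<mu> \<in> ?g ` ?S" using \<nu> e(3) e'(3) by (auto intro!: image_eqI[of _ _ "(d, e, \<nu>)"])
  qed
  moreover have fin: "finite ?S" using finite_monomials[OF Y(1)] by auto
  ultimately have "card {\<mu> \<in> monomials {..n} t. off_degree i j \<mu> < m} \<le> card (?g ` ?S)"
    by (intro card_mono) auto
  also have "\<dots> \<le> card ?S" using fin by (rule card_image_le)
  also have "\<dots> = line_conditions n m t"
    using finite_monomials[OF Y(1)]
    by (simp add: line_conditions_def card_cartesian_product card_monomials[OF Y(1) cardY])
  finally show ?thesis .
qed

lemma is_form_if_scales:
  fixes p :: "('v, 'k::{field,infinite}) mpoly"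
  assumes "\<And>x z. mpoly_eval (\<lambda>k. z * x k) p = z ^ t * mpoly_eval x p"
  shows "is_form t p"
  unfolding is_form_mono_degree
proof (rule ballI, rule ccontr)
  fix \<mu> assume \<mu>: "\<mu> \<in> Poly_Mapping.keys p" and ne: "mono_degree \<mu> \<noteq> t"
  let ?K = "Poly_Mapping.keys p" and ?e = "mono_degree \<mu>" and ?c = "Poly_Mapping.lookup p"
  let ?M = "{\<nu> \<in> ?K. mono_degree \<nu> = ?e}"
  have "(\<Sum>\<nu>\<in>?M. ?c \<nu> * mono_eval x \<nu>) = 0" for x
  proof -
    have "(\<Sum>\<nu>\<in>?K. monom (?c \<nu> * mono_eval x \<nu>) (mono_degree \<nu>)) = monom (mpoly_eval x p) t"
    proof (rule poly_all_eqI)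
      fix z
      have "poly (\<Sum>\<nu>\<in>?K. monom (?c \<nu> * mono_eval x \<nu>) (mono_degree \<nu>)) z = mpoly_eval (\<lambda>k. z * x k) p"
        by (simp add: poly_sum poly_monom mpoly_eval_altdef mono_eval_scale mono_degree_def mult_ac)
      then show "poly (\<Sum>\<nu>\<in>?K. monom (?c \<nu> * mono_eval x \<nu>) (mono_degree \<nu>)) z =
          poly (monom (mpoly_eval x p) t) z"
        by (simp add: assms poly_monom mult.commute)
    qed
    then have "coeff (\<Sum>\<nu>\<in>?K. monom (?c \<nu> * mono_eval x \<nu>) (mono_degree \<nu>)) ?e = 0"
      using ne by simp
    then have "(\<Sum>\<nu>\<in>?K. if mono_degree \<nu> = ?e then ?c \<nu> * mono_eval x \<nu> else 0) = 0"
      by (simp add: coeff_sum)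
    then show ?thesis by (subst sum.inter_filter) auto
  qed
  then have "?c \<mu> = 0"
    by (rule mono_eval_independent[of ?M ?c, rotated]) (use \<mu> in auto)
  then show False using \<mu> by (simp add: in_keys_iff)
qed

text \<open>
  In coordinates adapted to the \<open>l\<close>-th line, multiplicity \<open>m\<close> means that the coefficients at the
  monomials in \<open>?low l\<close> vanish. These are linear equations in the coefficients of \<open>f\<close>, and there are
  fewer equations than coefficients.
\<close>
lemma form_of_high_order_exists:
  fixes L :: "nat \<Rightarrow> (nat \<Rightarrow> 'k::{field,infinite}) set"
  assumes L: "L \<in> plane_tuples n 1 s" and n: "n \<ge> 2"
    and count: "s * line_conditions n m t < (t + n) choose n"
  shows "\<exists>f\<in>symbolic_power (coord_ring n) (union_ideal n s L) m. f \<noteq> 0 \<and> is_form t f"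
proof -
  let ?M = "monomials {..n} t"
  have L': "\<forall>l<s. L l \<in> planes n 1" using L by (simp add: plane_tuples_iff)
  have fin: "finite ?M" by (rule finite_monomials) simp
  have "\<exists>b c i j. pivots n b c i j \<and> L l = lin2 b c" if "l < s" for l
    using planes_cases[OF L'[rule_format, OF that]] by metis
  then obtain b c i j where bc: "\<And>l. l < s \<Longrightarrow> pivots n (b l) (c l) (i l) (j l)"
    "\<And>l. l < s \<Longrightarrow> L l = lin2 (b l) (c l)" by metis
  have "\<exists>h. h \<in> mpolys {..n} \<and> is_form t h \<and>
      (\<forall>x. mpoly_eval x h = mono_eval (frame n (b l) (c l) (i l) (j l) x) \<nu>)"
    if l: "l < s" and \<nu>: "\<nu> \<in> ?M" for l \<nu>
  proof -
    let ?F = "frame n (b l) (c l) (i l) (j l)"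
    have "(\<lambda>x. mono_eval (?F x) \<nu>) \<in> polyfun (coords {..n})"
      by (rule polyfun_compose[OF polyfun_mono_eval[OF order.refl] polyfun_frame[OF bc(1)[OF l]]])
    then obtain h where h: "h \<in> mpolys {..n}" "\<And>x. mpoly_eval x h = mono_eval (?F x) \<nu>"
      by (rule polyfun_imp_mpoly) blast
    have "?F (\<lambda>k. z * x k) = (\<lambda>k. z * ?F x k)" for z x
      by (auto simp: frame_def algebra_simps)
    then have "is_form t h"
      using \<nu> by (intro is_form_if_scales) (simp add: h(2) mono_eval_scale monomials_def mono_degree_def)
    then show ?thesis using h by blast
  qed
  then obtain h where h: "\<And>l \<nu>. l < s \<Longrightarrow> \<nu> \<in> ?M \<Longrightarrow> h l \<nu> \<in> mpolys {..n}"
    "\<And>l \<nu>. l < s \<Longrightarrow> \<nu> \<in> ?M \<Longrightarrow> is_form t (h l \<nu>)"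
    "\<And>l \<nu> x. l < s \<Longrightarrow> \<nu> \<in> ?M \<Longrightarrow> mpoly_eval x (h l \<nu>) = mono_eval (frame n (b l) (c l) (i l) (j l) x) \<nu>"
    by metis
  let ?low = "\<lambda>l. {\<mu> \<in> ?M. off_degree (i l) (j l) \<mu> < m}"
  let ?E = "SIGMA l:{..<s}. ?low l"
  have finE: "finite ?E" using fin by auto
  have "card ?E = (\<Sum>l<s. card (?low l))" using fin by simp
  also have "\<dots> \<le> (\<Sum>l<s. line_conditions n m t)"
  proof (rule sum_mono)
    fix l assume "l \<in> {..<s}"
    then have piv: "pivots n (b l) (c l) (i l) (j l)" using bc(1) by simp
    show "card (?low l) \<le> line_conditions n m t"
      by (rule card_low_monomials[OF n _ _ pivots_neq[OF piv]]) (use piv in \<open>auto simp: pivots_def\<close>)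
  qed
  also have "\<dots> < card ?M" using count card_monomials[of "{..n}" n t] by simp
  finally obtain a where a: "\<exists>\<nu>\<in>?M. a \<nu> \<noteq> 0"
    "\<And>l \<mu>. l < s \<Longrightarrow> \<mu> \<in> ?low l \<Longrightarrow> (\<Sum>\<nu>\<in>?M. Poly_Mapping.lookup (h l \<nu>) \<mu> * a \<nu>) = 0"
    using homogeneous_system[OF finE fin, of "\<lambda>(l, \<mu>) \<nu>. Poly_Mapping.lookup (h l \<nu>) \<mu>"] by auto
  define f where "f = mpoly_of_coeffs ?M a"
  have f: "f \<in> mpolys {..n}" "is_form t f" unfolding f_def by (rule mpoly_of_coeffs_form; simp)+
  have "f \<in> symbolic_power (coord_ring n) (union_ideal n s L) m"
  proof (rule symbolic_powerI[OF L' f(1)])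
    fix l assume l: "l < s"
    define g where "g = mpoly_of_coeffs ?M (\<lambda>\<mu>. \<Sum>\<nu>\<in>?M. Poly_Mapping.lookup (h l \<nu>) \<mu> * a \<nu>)"
    have "mpoly_eval x g = mpoly_eval (frame n (b l) (c l) (i l) (j l) x) f" for x
    proof -
      have "mpoly_eval x g = (\<Sum>\<nu>\<in>?M. a \<nu> * (\<Sum>\<mu>\<in>?M. Poly_Mapping.lookup (h l \<nu>) \<mu> * mono_eval x \<mu>))"
        unfolding g_def mpoly_eval_mpoly_of_coeffs sum_distrib_right sum_distrib_left
        by (subst sum.swap) (simp add: mult_ac)
      also have "\<dots> = (\<Sum>\<nu>\<in>?M. a \<nu> * mono_eval (frame n (b l) (c l) (i l) (j l) x) \<nu>)"
      proof (intro sum.cong refl)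
        fix \<nu> assume \<nu>: "\<nu> \<in> ?M"
        have "mpoly_eval x (h l \<nu>) = (\<Sum>\<mu>\<in>?M. Poly_Mapping.lookup (h l \<nu>) \<mu> * mono_eval x \<mu>)"
          by (rule mpoly_eval_superset[OF fin form_keys[OF h(1,2)[OF l \<nu>]]])
        then show "a \<nu> * (\<Sum>\<mu>\<in>?M. Poly_Mapping.lookup (h l \<nu>) \<mu> * mono_eval x \<mu>) =
            a \<nu> * mono_eval (frame n (b l) (c l) (i l) (j l) x) \<nu>"
          using h(3)[OF l \<nu>] by simp
      qed
      finally show ?thesis by (simp add: f_def mpoly_eval_mpoly_of_coeffs)
    qed
    moreover have "m \<le> off_degree (i l) (j l) \<mu>" if \<mu>: "\<mu> \<in> Poly_Mapping.keys g" for \<mu>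
    proof (rule ccontr)
      assume "\<not> ?thesis"
      moreover have "\<mu> \<in> ?M" using \<mu> keys_mpoly_of_coeffs[OF fin] unfolding g_def by blast
      ultimately have "Poly_Mapping.lookup g \<mu> = 0"
        using a(2)[OF l, of \<mu>] by (simp add: g_def lookup_mpoly_of_coeffs[OF fin])
      then show False using \<mu> by (simp add: in_keys_iff)
    qed
    moreover have "g \<in> mpolys {..n}" unfolding g_def by (rule mpoly_of_coeffs_form) simp
    ultimately show "\<exists>b c i j h. pivots n b c i j \<and> L l = lin2 b c \<and> h \<in> mpolys {..n} \<and>
      (\<forall>x. mpoly_eval x h = mpoly_eval (frame n b c i j x) f) \<and>
      (\<forall>\<mu>\<in>Poly_Mapping.keys h. m \<le> off_degree i j \<mu>)"
      using bc[OF l] by blast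
  qed
  moreover have "f \<noteq> 0"
  proof
    assume "f = 0"
    then have "a \<nu> = 0" if "\<nu> \<in> ?M" for \<nu>
      using lookup_mpoly_of_coeffs[OF fin, of a \<nu>] that unfolding f_def by simp
    then show False using a(1) by blast
  qed
  ultimately show ?thesis using f(2) by blast
qed


section \<open>The special configuration\<close>

text \<open>
  The special tuple: one line for each point of a grid \<open>A\<^sup>N\<close> with \<open>N + 1\<close> elements in \<open>A\<close>.
\<close>
lemma scroll_configuration:
  assumes n: "n = N + 2" and N: "N \<ge> 1"
  shows "\<exists>L :: nat \<Rightarrow> (nat \<Rightarrow> 'k::{field,infinite}) set. L \<in> plane_tuples n 1 ((N + 1) ^ N) \<and>
    no_forms_below n ((N + 1) ^ N) m (m * (N + 1)) L"
proof -
  let ?s = "(N + 1) ^ N"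
  obtain A :: "'k set" where A: "finite A" "card A = N + 1"
    using infinite_arbitrarily_large[OF infinite_UNIV] by blast
  let ?P = "PiE {..<N} (\<lambda>_. A)"
  have "card ?P = ?s" using A by (simp add: card_PiE)
  moreover have "finite ?P" using A by (intro finite_PiE) auto
  ultimately obtain g where g: "bij_betw g {..<?s} ?P"
    using ex_bij_betw_nat_finite[of ?P] by (auto simp: atLeast0LessThan)
  define L where "L = (\<lambda>l\<in>{..<?s}. lin2 (scroll_line0 N (g l)) (scroll_line1 N (g l)))"
  have "pivots n (scroll_line0 N \<alpha>) (scroll_line1 N \<alpha>) (N + 1) (N + 2)" for \<alpha> :: "nat \<Rightarrow> 'k"
    by (auto simp: pivots_def scroll_line0_def scroll_line1_def n)
  then have planes: "lin2 (scroll_line0 N \<alpha>) (scroll_line1 N \<alpha>) \<in> planes n 1" for \<alpha> :: "nat \<Rightarrow> 'k"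
    by (rule lin2_in_planes)
  have L: "L \<in> plane_tuples n 1 ?s"
    unfolding plane_tuples_iff using planes by (auto simp: L_def)
  have L': "\<forall>l<?s. L l \<in> planes n 1" using L by (simp add: plane_tuples_iff)
  have "no_forms_below n ?s m (m * (N + 1)) L"
    unfolding no_forms_below_def
  proof (intro allI impI ballI)
    fix d f assume d: "d < m * (N + 1)" and form: "is_form d f"
      and f: "f \<in> symbolic_power (coord_ring n) (union_ideal n ?s L) m"
    show "f = 0"
    proof (rule scroll_lines_vanish[OF A N])
      show "f \<in> mpolys {..N + 2}" using f by (simp add: symbolic_power_def n)
      show "is_form d f" "d < m * (N + 1)" by fact+
      fix \<alpha> :: "nat \<Rightarrow> 'k" and u v
      assume \<alpha>: "\<And>j. j < N \<Longrightarrow> \<alpha> j \<in> A"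
      define \<beta> where "\<beta> = restrict \<alpha> {..<N}"
      have "\<beta> \<in> ?P" using \<alpha> by (auto simp: \<beta>_def)
      then have "\<beta> \<in> g ` {..<?s}" using g by (simp add: bij_betw_def)
      then obtain l where l: "l < ?s" "g l = \<beta>" by auto
      have "scroll_line0 N \<alpha> = scroll_line0 N \<beta>" "scroll_line1 N \<alpha> = scroll_line1 N \<beta>"
        by (auto simp: scroll_line0_def scroll_line1_def \<beta>_def fun_eq_iff)
      then have "(\<lambda>i. u * scroll_line0 N \<alpha> i + v * scroll_line1 N \<alpha> i) \<in> L l"
        using l by (auto simp: L_def lin2_iff)
      then show "ord_ge m (\<lambda>a. mpoly_eval a f) (\<lambda>i. u * scroll_line0 N \<alpha> i + v * scroll_line1 N \<alpha> i)"
        using symbolic_power_ord_ge[OF L' l(1) _ f] by blast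
    qed
  qed
  then show ?thesis using L by blast
qed

section \<open>The expected value\<close>

lemma binomial_step: "Suc k * (n choose Suc k) = (n - k) * (n choose k)"
  by (simp only: binomial_absorption binomial_absorb_comp)

lemma weighted_binomial_sum:
  fixes T :: real
  shows "(\<Sum>d<m. (T - real d) * real ((d + k) choose k)) =
    T * real ((m + k) choose (k + 1)) - real (k + 1) * real ((m + k) choose (k + 2))"
proof (induction m)
  case (Suc m)
  have step: "real m * real ((m + k) choose k) = real (k + 1) * real ((m + k) choose (k + 1))"
    using arg_cong[OF binomial_step[of k "m + k"], of real] by (simp add: algebra_simps)
  have 1: "real ((Suc m + k) choose (k + 1)) = real ((m + k) choose k) + real ((m + k) choose (k + 1))"
    by simp
  have 2: "real ((Suc m + k) choose (k + 2)) = real ((m + k) choose (k + 1)) + real ((m + k) choose (k + 2))"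
    by simp
  have "(\<Sum>d<Suc m. (T - real d) * real ((d + k) choose k)) =
      T * real ((m + k) choose (k + 1)) - real (k + 1) * real ((m + k) choose (k + 2)) +
      (T * real ((m + k) choose k) - real m * real ((m + k) choose k))"
    unfolding sum.lessThan_Suc Suc.IH by (simp only: left_diff_distrib)
  also have "\<dots> = T * real ((Suc m + k) choose (k + 1)) - real (k + 1) * real ((Suc m + k) choose (k + 2))"
    unfolding step 1 2 distrib_left by (simp only: algebra_simps)
  finally show ?case .
qed (simp add: binomial_eq_0)

lemma line_conditions_closed_form:
  assumes "m \<le> t + 1"
  shows "real (line_conditions (k + 2) m t) =
    (real t + 1) * real ((m + k) choose (k + 1)) - real (k + 1) * real ((m + k) choose (k + 2))"
proof -
  have "real (line_conditions (k + 2) m t) = (\<Sum>d<m. (real t + 1 - real d) * real ((d + k) choose k))"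
    unfolding line_conditions_def of_nat_sum
  proof (rule sum.cong)
    fix d assume "d \<in> {..<m}"
    then have "real (t - d + 1) = real t + 1 - real d" using assms by (simp add: of_nat_diff)
    then show "real ((t - d + 1) * ((d + (k + 2 - 2)) choose (k + 2 - 2))) =
        (real t + 1 - real d) * real ((d + k) choose k)"
      by (simp only: of_nat_mult add_diff_cancel_right')
  qed simp
  then show ?thesis by (simp only: weighted_binomial_sum)
qed

lemma choose_asymptotics:
  "(\<lambda>m. real ((m + k) choose j) / real m ^ j) \<longlonglongrightarrow> 1 / fact j"
proof (induction j)
  case (Suc j)
  have "(\<lambda>m. (real ((m + k) choose j) / real m ^ j) * ((1 + (real k - real j) / real m) / real (Suc j)))
      \<longlonglongrightarrow> (1 / fact j) * ((1 + 0) / real (Suc j))"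
    by (intro tendsto_intros Suc lim_const_over_n) simp
  moreover have "eventually (\<lambda>m. (real ((m + k) choose j) / real m ^ j) *
      ((1 + (real k - real j) / real m) / real (Suc j)) = real ((m + k) choose Suc j) / real m ^ Suc j) sequentially"
    using eventually_ge_at_top[of "Suc j"]
  proof eventually_elim
    case (elim m)
    have "real (Suc j) * real ((m + k) choose Suc j) = (real m + real k - real j) * real ((m + k) choose j)"
      using arg_cong[OF binomial_step[of j "m + k"], of real] elim
      by (simp only: of_nat_mult of_nat_diff of_nat_add)
    then have 1: "real ((m + k) choose Suc j) = (real m + real k - real j) * real ((m + k) choose j) / real (Suc j)"
      by (metis nonzero_mult_div_cancel_left of_nat_0_neq)
    have 2: "1 + (real k - real j) / real m = (real m + real k - real j) / real m"
      using elim by (simp add: field_simps)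
    show ?case unfolding 1 2 by (simp add: mult_ac)
  qed
  ultimately show ?case
    by (subst (asm) tendsto_cong) (auto simp: mult.commute)
qed simp

lemma power_le_binomial: "real t ^ n / fact n \<le> real ((t + n) choose n)"
proof (induction n)
  case (Suc n)
  have "real t ^ Suc n / fact (Suc n) = (real t ^ n / fact n) * (real t / real (Suc n))"
    by (simp add: mult_ac)
  also have "\<dots> \<le> real ((t + n) choose n) * (real (Suc (t + n)) / real (Suc n))"
    by (intro mult_mono Suc divide_right_mono) auto
  also have "\<dots> = real ((t + Suc n) choose Suc n)"
    using arg_cong[OF Suc_times_binomial_eq[of "t + n" n], of real]
    by (simp add: field_simps del: binomial_Suc_Suc)
  finally show ?case .
qed simp

text \<open>
  The polynomial \<open>x\<^sup>d\<^sup>+\<^sup>1 - s (d + 1) x + s d\<close> with \<open>s = d\<^sup>d\<^sup>-\<^sup>1\<close> is, up to a constant factor, \<open>\<Lambda>\<close> for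
  \<open>s\<close> lines in projective \<open>(d + 1)\<close>-space. It vanishes at \<open>d\<close>, and Bernoulli's inequality bounds the
  increase of \<open>x\<^sup>d\<^sup>+\<^sup>1\<close> to the right of \<open>d\<close> from below by a multiple of \<open>x - d\<close> with a slope larger than
  \<open>s (d + 1)\<close>.
\<close>
lemma expected_polynomial_pos:
  fixes x :: real
  assumes d: "d \<ge> 2" and x: "x > real d"
  shows "real (d ^ (d - 1)) * (real (d + 1) * x - real d) < x ^ (d + 1)"
proof -
  obtain e where e: "d = Suc e" "e \<ge> 1" using d by (cases d) auto
  define D where "D = real d"
  define h where "h = x - D"
  have h: "h > 0" using x by (simp add: h_def D_def)
  have D: "D \<ge> 2" using d by (simp add: D_def)
  have "1 + real (d + 1) * (h / D) \<le> (1 + h / D) ^ (d + 1)"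
    by (rule Bernoulli_inequality) (use h D in \<open>simp add: add_nonneg_pos order.trans[of _ 0]\<close>)
  then have "D ^ (d + 1) * (1 + real (d + 1) * (h / D)) \<le> D ^ (d + 1) * (1 + h / D) ^ (d + 1)"
    using D by (intro mult_left_mono) auto
  also have "D ^ (d + 1) * (1 + h / D) ^ (d + 1) = x ^ (d + 1)"
    unfolding power_mult_distrib[symmetric] using D by (simp add: h_def field_simps)
  finally have ge: "D ^ (d + 1) * (1 + real (d + 1) * (h / D)) \<le> x ^ (d + 1)" .
  have "D ^ (d + 1) * (1 + real (d + 1) * (h / D)) = D ^ e * (D * D + (D + 1) * D * h)"
    using D by (simp add: e D_def field_simps)
  moreover have "real (d ^ (d - 1)) * (real (d + 1) * x - real d) = D ^ e * (D * D + (D + 1) * h)"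
    by (simp add: e D_def h_def algebra_simps)
  moreover have "D ^ e * (D * D + (D + 1) * h) < D ^ e * (D * D + (D + 1) * D * h)"
  proof (rule mult_strict_left_mono)
    have "(D + 1) * h * 1 < (D + 1) * h * D" using D h by (intro mult_strict_left_mono) auto
    then show "D * D + (D + 1) * h < D * D + (D + 1) * D * h" by (simp add: mult_ac)
  qed (use D in auto)
  ultimately show ?thesis using ge by simp
qed

lemma expected_value_common_denominator:
  fixes F :: real
  assumes "F \<noteq> 0" "c \<noteq> 0"
  shows "S * (x * (1 / F) - K * (1 / (c * F))) = S * (c * x - K) / (c * F)"
  using assms by (simp add: field_simps)

lemma fact_lines: "(fact (k + 2) :: real) = real (k + 2) * fact (k + 1)"
  by simp

text \<open>
  After division by \<open>m\<^sup>n\<close> the right side minus the left side tends to the value of \<open>\<Lambda>\<close> at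
  \<open>n - 1 + \<epsilon>\<close>, which is positive.
\<close>
lemma eventually_form_count:
  fixes \<epsilon> :: real
  assumes n: "n \<ge> 3" and \<epsilon>: "\<epsilon> > 0"
  defines "s \<equiv> (n - 1) ^ (n - 2)" and "t \<equiv> \<lambda>m. nat \<lceil>(real n - 1 + \<epsilon>) * real m\<rceil>"
  shows "eventually (\<lambda>m. s * line_conditions n m (t m) < (t m + n) choose n) sequentially"
proof -
  obtain k where k: "n = k + 2" "k \<ge> 1" using n by (intro that[of "n - 2"]) auto
  define \<tau> where "\<tau> = real n - 1 + \<epsilon>"
  let ?B1 = "\<lambda>m. real ((m + k) choose (k + 1))" and ?B2 = "\<lambda>m. real ((m + k) choose (k + 2))"
  \<comment> \<open>The bound \<open>t m + 1 \<le> \<tau> * m + 2\<close> accounts for the rounding.\<close>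
  define \<phi> where "\<phi> = (\<lambda>m. real s * ((\<tau> + 2 / real m) * (?B1 m / real m ^ (k + 1)) -
    real (k + 1) * (?B2 m / real m ^ (k + 2))))"
  have "\<phi> \<longlonglongrightarrow> real s * ((\<tau> + 0) * (1 / fact (k + 1)) - real (k + 1) * (1 / fact (k + 2)))"
    unfolding \<phi>_def by (intro tendsto_intros choose_asymptotics lim_const_over_n)
  moreover have "real s * ((\<tau> + 0) * (1 / fact (k + 1)) - real (k + 1) * (1 / fact (k + 2))) < \<tau> ^ n / fact n"
  proof -
    have "real s * ((\<tau> + 0) * (1 / fact (k + 1)) - real (k + 1) * (1 / fact (k + 2))) =
        real s * (real (k + 2) * \<tau> - real (k + 1)) / (real (k + 2) * fact (k + 1))"
      unfolding fact_lines add_0_right by (rule expected_value_common_denominator) auto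
    also have "\<dots> = real s * (real (k + 2) * \<tau> - real (k + 1)) / fact n"
      by (simp only: k(1) fact_lines)
    also have "\<dots> = real ((k + 1) ^ (k + 1 - 1)) * (real (k + 1 + 1) * \<tau> - real (k + 1)) / fact n"
      by (simp add: s_def k)
    also have "\<dots> < \<tau> ^ (k + 1 + 1) / fact n"
      by (intro divide_strict_right_mono expected_polynomial_pos) (use k \<epsilon> in \<open>auto simp: \<tau>_def\<close>)
    finally show ?thesis by (simp add: k)
  qed
  ultimately have "eventually (\<lambda>m. \<phi> m < \<tau> ^ n / fact n) sequentially"
    by (rule order_tendstoD(2))
  then show ?thesis
    using eventually_gt_at_top[of 0]
  proof eventually_elim
    case (elim m)
    have \<tau>: "\<tau> \<ge> 1" using n \<epsilon> by (simp add: \<tau>_def)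
    have m: "real m > 0" using elim by simp
    have tm: "\<tau> * real m \<le> real (t m)" "real (t m) \<le> \<tau> * real m + 1"
      using \<tau> m unfolding t_def \<tau>_def[symmetric] by (auto simp: of_nat_nat le_of_int_ceiling of_int_ceiling_le_add_one)
    have "1 * real m \<le> \<tau> * real m" using \<tau> by (intro mult_right_mono) auto
    then have "m \<le> t m + 1" using tm(1) by simp
    then have "real (s * line_conditions n m (t m)) =
        real s * ((real (t m) + 1) * ?B1 m - real (k + 1) * ?B2 m)"
      by (simp only: k of_nat_mult line_conditions_closed_form)
    also have "\<dots> \<le> real s * ((\<tau> * real m + 2) * ?B1 m - real (k + 1) * ?B2 m)"
      using tm(2) by (intro mult_left_mono diff_right_mono mult_right_mono) auto
    also have "\<dots> = \<phi> m * real m ^ n"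
      using m by (simp add: \<phi>_def k field_simps)
    also have "\<dots> < \<tau> ^ n / fact n * real m ^ n"
      using elim by (intro mult_strict_right_mono) auto
    also have "\<dots> = (\<tau> * real m) ^ n / fact n" by (simp add: power_mult_distrib)
    also have "\<dots> \<le> real (t m) ^ n / fact n"
      using tm(1) \<tau> by (intro divide_right_mono power_mono) auto
    also have "\<dots> \<le> real ((t m + n) choose n)" by (rule power_le_binomial)
    finally show ?case by linarith
  qed
qed


section \<open>The polynomial \<open>\<Lambda>\<close> and its largest root\<close>

lemma poly_binom_poly: "poly (binom_poly a) x = (\<Prod>j=1..a. x + real j) / fact a"
  by (simp add: binom_poly_def poly_prod add.commute)

lemma poly_binom_poly_nat: "poly (binom_poly a) (real x) = real ((x + a) choose a)"
proof (induction a)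
  case 0
  then show ?case by (simp add: poly_binom_poly)
next
  case (Suc a)
  have "poly (binom_poly (Suc a)) (real x) = poly (binom_poly a) (real x) * (real (Suc (x + a)) / real (Suc a))"
    by (simp add: poly_binom_poly mult_ac add_ac)
  also have "\<dots> = real ((x + Suc a) choose Suc a)"
    using arg_cong[OF Suc_times_binomial_eq[of "x + a" a], of real]
    by (simp add: Suc field_simps del: binomial_Suc_Suc)
  finally show ?case .
qed

lemma degree_binom_poly [simp]: "degree (binom_poly a) = a"
  unfolding binom_poly_def by (simp add: degree_prod_eq_sum_degree)

lemma lead_coeff_binom_poly: "coeff (binom_poly a) a = 1 / fact a"
proof -
  have "lead_coeff (binom_poly a) = 1 / fact a"
    unfolding binom_poly_def by (simp add: lead_coeff_smult lead_coeff_prod)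
  then show ?thesis by simp
qed

text \<open>
  In the ring of polynomials in \<open>m\<close> over the polynomials in \<open>\<tau>\<close>, \<open>const_poly p\<close> is \<open>p(m)\<close> and
  \<open>homogenize p\<close> is \<open>p(m \<tau>)\<close>.
\<close>
definition const_poly :: "real poly \<Rightarrow> real poly poly" where
  "const_poly p = map_poly (\<lambda>c. [:c:]) p"

definition homogenize :: "real poly \<Rightarrow> real poly poly" where
  "homogenize p = (\<Sum>i\<le>degree p. monom (monom (coeff p i) i) i)"

lemma coeff_const_poly: "coeff (const_poly p) i = [:coeff p i:]"
  by (simp add: const_poly_def coeff_map_poly)

lemma coeff_homogenize: "coeff (homogenize p) i = monom (coeff p i) i"
  by (cases "i \<le> degree p") (auto simp: homogenize_def coeff_sum coeff_eq_0 sum.delta if_distrib cong: if_cong)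

lemma poly_const_poly: "poly (const_poly p) [:x:] = [:poly p x:]"
  by (induction p) (simp_all add: const_poly_def map_poly_pCons)

lemma linear_monom_power: "[:0, x:] ^ i = monom (x ^ i) i" for x :: real
  by (simp add: monom_altdef[of "x ^ i"] smult_power flip: power_mult_distrib) (simp add: smult_power[symmetric])

lemma poly_homogenize: "poly (homogenize p) [:x:] = pcompose p [:0, x:]"
proof (rule poly_eqI)
  fix j
  have 1: "poly (homogenize p) [:x:] = (\<Sum>i\<le>degree p. monom (coeff p i * x ^ i) i)"
    by (simp add: homogenize_def poly_sum poly_monom poly_const_pow mult_monom smult_monom mult.commute)
  have 2: "pcompose p [:0, x:] = (\<Sum>i\<le>degree p. monom (coeff p i * x ^ i) i)"
    by (simp add: pcompose_altdef poly_altdef linear_monom_power smult_monom degree_map_poly coeff_map_poly)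
  show "coeff (poly (homogenize p) [:x:]) j = coeff (pcompose p [:0, x:]) j" by (simp only: 1 2)
qed

lemma c_poly_lines:
  assumes "m \<ge> 1"
  shows "c_poly (k + 2) 1 m = smult (poly (pcompose (binom_poly (k + 1)) [:-1, 1:]) (real m)) [:1, 1:] -
    [:real (k + 1) * poly (pcompose (binom_poly (k + 2)) [:-2, 1:]) (real m):]"
proof -
  have B1: "poly (pcompose (binom_poly (k + 1)) [:-1, 1:]) (real m) = real ((m + k) choose (k + 1))"
  proof -
    have "poly (pcompose (binom_poly (k + 1)) [:-1, 1:]) (real m) = poly (binom_poly (k + 1)) (real (m - 1))"
      using assms by (simp add: poly_pcompose of_nat_diff algebra_simps)
    also have "\<dots> = real ((m - 1 + (k + 1)) choose (k + 1))" by (rule poly_binom_poly_nat)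
    also have "m - 1 + (k + 1) = m + k" using assms by simp
    finally show ?thesis .
  qed
  have B2: "poly (pcompose (binom_poly (k + 2)) [:-2, 1:]) (real m) = real ((m + k) choose (k + 2))"
  \<comment> \<open>For \<open>m = 1\<close> the argument \<open>m - 2\<close> is negative; both sides are zero.\<close>
  proof (cases "m = 1")
    case True
    have "(\<Prod>j=1..k + 2. (- 1) + real j) = 0" by (rule prod_zero) (auto intro!: bexI[of _ 1])
    then have "poly (binom_poly (k + 2)) (- 1) = 0" unfolding poly_binom_poly by simp
    then show ?thesis using True by (simp add: poly_pcompose binomial_eq_0 del: binomial_Suc_Suc)
  next
    case False
    then have m: "m \<ge> 2" using assms by simp
    then have "poly (pcompose (binom_poly (k + 2)) [:-2, 1:]) (real m) = poly (binom_poly (k + 2)) (real (m - 2))"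
      by (simp add: poly_pcompose of_nat_diff algebra_simps)
    also have "\<dots> = real ((m - 2 + (k + 2)) choose (k + 2))" by (rule poly_binom_poly_nat)
    also have "m - 2 + (k + 2) = m + k" using m by simp
    finally show ?thesis .
  qed
  show ?thesis
  proof (rule poly_all_eqI)
    fix z :: real
    have "poly (c_poly (k + 2) 1 m) z = (\<Sum>i<m. (z + 1 - real i) * real ((i + k) choose k))"
      by (simp add: c_poly_def poly_sum poly_pcompose poly_binom_poly algebra_simps)
    also have "\<dots> = (z + 1) * real ((m + k) choose (k + 1)) - real (k + 1) * real ((m + k) choose (k + 2))"
      by (rule weighted_binomial_sum)
    finally show "poly (c_poly (k + 2) 1 m) z = poly (smult (poly (pcompose (binom_poly (k + 1)) [:-1, 1:]) (real m)) [:1, 1:] -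
      [:real (k + 1) * poly (pcompose (binom_poly (k + 2)) [:-2, 1:]) (real m):]) z"
      unfolding B1 B2 by (simp add: algebra_simps)
  qed
qed

text \<open>
  The explicit \<open>Q\<close> has the required values, and it is the only one since a polynomial over the
  domain of polynomials in \<open>\<tau>\<close> is determined by its values at infinitely many points.
\<close>
lemma Lambda_poly_lines:
  "Lambda_poly (k + 2) 1 s = monom (1 / fact (k + 2)) (k + 2) -
     smult (real s) ([:0, 1 / fact (k + 1):] - [:real (k + 1) / fact (k + 2):])"
proof -
  define b1 where "b1 = pcompose (binom_poly (k + 1)) [:-1, 1:]"
  define b2 where "b2 = pcompose (binom_poly (k + 2)) [:-2, 1:]"
  define Q where "Q = homogenize (binom_poly (k + 2)) -
    smult [:real s:] ([:1, [:0, 1:]:] * const_poly b1 - smult [:real (k + 1):] (const_poly b2))"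
  have Q: "poly Q [:real m:] = pcompose (P_poly (k + 2) 1 s m) [:0, real m:]" if m: "m \<ge> 1" for m
  proof -
    have "P_poly (k + 2) 1 s m = binom_poly (k + 2) -
        smult (real s) (smult (poly b1 (real m)) [:1, 1:] - [:real (k + 1) * poly b2 (real m):])"
      by (simp only: P_poly_def c_poly_lines[OF m] b1_def b2_def)
    then show ?thesis
      by (simp add: Q_def poly_homogenize poly_const_poly pcompose_diff pcompose_smult pcompose_pCons)
  qed
  have unique: "Q' = Q" if Q': "\<forall>m\<ge>1. poly Q' [:real m:] = pcompose (P_poly (k + 2) 1 s m) [:0, real m:]" for Q'
  proof (rule ccontr)
    assume "Q' \<noteq> Q"
    then have "finite {x. poly (Q' - Q) x = 0}" by (intro poly_roots_finite) simp
    moreover have "(\<lambda>m. [:real m:]) ` {1..} \<subseteq> {x. poly (Q' - Q) x = 0}" using Q Q' by auto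
    ultimately have "finite ((\<lambda>m. [:real m:]) ` {1::nat..})" by (rule rev_finite_subset)
    then have "finite {1::nat..}" by (rule finite_imageD) (auto simp: inj_on_def)
    then show False using infinite_Ici by blast
  qed
  have The: "(THE Q. \<forall>m\<ge>1. poly Q [:real m:] = pcompose (P_poly (k + 2) 1 s m) [:0, real m:]) = Q"
    by (rule the_equality) (use Q unique in blast)+
  have deg: "degree b1 = k + 1" "degree b2 = k + 2" by (simp_all add: b1_def b2_def degree_pcompose)
  have lead1: "coeff b1 (k + 1) = 1 / fact (k + 1)"
  proof -
    have "lead_coeff b1 = lead_coeff (binom_poly (k + 1)) * lead_coeff [:-1, 1::real:] ^ degree (binom_poly (k + 1))"
      unfolding b1_def by (rule lead_coeff_comp) simp
    then show ?thesis using deg(1) lead_coeff_binom_poly[of "k + 1"] by simp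
  qed
  have lead2: "coeff b2 (k + 2) = 1 / fact (k + 2)"
  proof -
    have "lead_coeff b2 = lead_coeff (binom_poly (k + 2)) * lead_coeff [:-2, 1::real:] ^ degree (binom_poly (k + 2))"
      unfolding b2_def by (rule lead_coeff_comp) simp
    then show ?thesis using deg(2) lead_coeff_binom_poly[of "k + 2"] by simp
  qed
  have zero: "coeff b1 (k + 2) = 0" by (rule coeff_eq_0) (simp add: deg)
  have prod: "coeff ([:1, [:0, 1:]:] * const_poly b1) (k + 2) = [:0, 1 / fact (k + 1):]"
    using lead1 zero by (simp add: coeff_pCons coeff_const_poly mult_pCons_left split: nat.split)
  have "Lambda_poly (k + 2) 1 s = coeff Q (k + 2)" unfolding Lambda_poly_def The ..
  also have "\<dots> = monom (1 / fact (k + 2)) (k + 2) -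
     smult (real s) ([:0, 1 / fact (k + 1):] - [:real (k + 1) / fact (k + 2):])"
    unfolding Q_def coeff_diff coeff_smult prod coeff_homogenize coeff_const_poly lead2 lead_coeff_binom_poly
    by simp
  finally show ?thesis .
qed

lemma poly_Lambda_poly_lines:
  "poly (Lambda_poly (k + 2) 1 s) x = (x ^ (k + 2) - real s * (real (k + 2) * x - real (k + 1))) / fact (k + 2)"
proof -
  have "poly (Lambda_poly (k + 2) 1 s) x = x ^ (k + 2) / fact (k + 2) -
      real s * (x * (1 / fact (k + 1)) - real (k + 1) * (1 / fact (k + 2)))"
    unfolding Lambda_poly_lines by (simp add: poly_monom algebra_simps del: fact_Suc)
  also have "\<dots> = x ^ (k + 2) / fact (k + 2) - real s * (real (k + 2) * x - real (k + 1)) / fact (k + 2)"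
    unfolding fact_lines by (subst expected_value_common_denominator) auto
  finally show ?thesis by (simp only: diff_divide_distrib)
qed

lemma g_root_lines:
  assumes "n \<ge> 3"
  shows "g_root n 1 ((n - 1) ^ (n - 2)) = real n - 1"
proof -
  obtain k where k: "n = k + 2" "k \<ge> 1"
    using assms by (intro that[of "n - 2"]) auto
  have root: "poly (Lambda_poly n 1 ((n - 1) ^ (n - 2))) x = 0 \<longleftrightarrow>
      x ^ (k + 2) = real ((k + 1) ^ k) * (real (k + 2) * x - real (k + 1))" for x
  proof -
    have "(n - 1) ^ (n - 2) = (k + 1) ^ k" by (simp add: k)
    then have "poly (Lambda_poly n 1 ((n - 1) ^ (n - 2))) x =
        (x ^ (k + 2) - real ((k + 1) ^ k) * (real (k + 2) * x - real (k + 1))) / fact (k + 2)"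
      using poly_Lambda_poly_lines[of k "(k + 1) ^ k" x] by (simp only: k(1))
    then show ?thesis by (simp del: of_nat_power fact_Suc)
  qed
  show ?thesis
    unfolding g_root_def
  proof (rule Greatest_equality)
    show "poly (Lambda_poly n 1 ((n - 1) ^ (n - 2))) (real n - 1) = 0"
      unfolding root by (simp add: k(1) algebra_simps)
    fix y assume "poly (Lambda_poly n 1 ((n - 1) ^ (n - 2))) y = 0"
    then have "y ^ (k + 2) = real ((k + 1) ^ k) * (real (k + 2) * y - real (k + 1))"
      unfolding root .
    then have "y ^ (k + 1 + 1) = real ((k + 1) ^ (k + 1 - 1)) * (real (k + 1 + 1) * y - real (k + 1))"
      by (simp del: of_nat_power)
    then show "y \<le> real n - 1"
      using expected_polynomial_pos[of "k + 1" y] k by (cases "y \<le> real n - 1") auto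
  qed
qed

section \<open>The limit of the general initial degrees\<close>

text \<open>
  The special tuple on the scroll gives \<open>m (n - 1) \<le> \<alpha>\<close> and the count of conditions gives
  \<open>\<alpha> \<le> (n - 1 + \<epsilon>) m + 1\<close> for large \<open>m\<close>.
\<close>
lemma general_alpha_lines_limit:
  fixes n :: nat
  assumes n: "n \<ge> 3"
  shows "(\<lambda>m. real (general_alpha TYPE('k::alg_closed_field) n 1 ((n - 1) ^ (n - 2)) m) / real m)
    \<longlonglongrightarrow> real n - 1"
proof (rule LIMSEQ_I)
  fix r :: real assume r: "r > 0"
  define s where "s = (n - 1) ^ (n - 2)"
  define t where "t = (\<lambda>m. nat \<lceil>(real n - 1 + r / 2) * real m\<rceil>)"
  let ?a = "\<lambda>m. general_alpha TYPE('k) n 1 s m"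
  have "eventually (\<lambda>m. s * line_conditions n m (t m) < (t m + n) choose n) sequentially"
    unfolding s_def t_def using eventually_form_count[OF n, of "r / 2"] r by simp
  moreover have "eventually (\<lambda>m. real m > 2 / r) sequentially"
    using filterlim_real_sequentially by (simp add: filterlim_at_top_dense)
  ultimately have "eventually (\<lambda>m. norm (real (?a m) / real m - (real n - 1)) < r) sequentially"
    using eventually_gt_at_top[of 0]
  proof eventually_elim
    case (elim m)
    have m: "real m > 0" using elim(3) by simp
    obtain L0 :: "nat \<Rightarrow> (nat \<Rightarrow> 'k) set" where L0: "L0 \<in> plane_tuples n 1 s"
      "no_forms_below n s m (m * (n - 1)) L0"
    proof -
      have "n - 2 + 1 = n - 1" "n = n - 2 + 2" "n - 2 \<ge> 1" using n by auto
      then show ?thesis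
        using scroll_configuration[of n "n - 2" m, where ?'k = 'k] that unfolding s_def by metis
    qed
    have ex: "\<exists>f\<in>symbolic_power (coord_ring n) (union_ideal n s L) m. f \<noteq> 0 \<and> is_form (t m) f"
      if "L \<in> plane_tuples n 1 s" for L :: "nat \<Rightarrow> (nat \<Rightarrow> 'k) set"
      using form_of_high_order_exists[OF that _ elim(1)] n by simp
    have "m * (n - 1) \<le> ?a m" "?a m \<le> t m"
      using general_alpha_bounds[OF L0 ex] by blast+
    then have "real (m * (n - 1)) \<le> real (?a m)" "real (?a m) \<le> real (t m)"
      by (simp_all only: of_nat_le_iff)
    moreover have "real (t m) \<le> (real n - 1 + r / 2) * real m + 1"
    proof -
      have "0 \<le> (real n - 1 + r / 2) * real m" using n r by (intro mult_nonneg_nonneg) auto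
      then show ?thesis unfolding t_def by (simp add: of_nat_nat of_int_ceiling_le_add_one)
    qed
    moreover have "1 < (r / 2) * real m" using elim(2) r by (simp add: field_simps)
    ultimately have "(real n - 1) * real m \<le> real (?a m)" "real (?a m) < (real n - 1 + r) * real m"
      using n by (auto simp: of_nat_diff algebra_simps)
    then have "real n - 1 \<le> real (?a m) / real m" "real (?a m) / real m < real n - 1 + r"
      using m by (simp_all add: pos_le_divide_eq pos_divide_less_eq)
    then show ?case by (simp add: abs_less_iff)
  qed
  then show "\<exists>no. \<forall>m\<ge>no. norm (real (general_alpha TYPE('k) n 1 ((n - 1) ^ (n - 2)) m) / real m -
      (real n - 1)) < r"
    by (simp add: eventually_sequentially s_def)
qed

theorem proposition4p1:
  fixes n :: nat
  assumes "n \<ge> 3"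
  shows "general_gamma TYPE('k::alg_closed_field) n 1 ((n - 1) ^ (n - 2)) =
           g_root n 1 ((n - 1) ^ (n - 2))
       \<and> g_root n 1 ((n - 1) ^ (n - 2)) = real n - 1"
  using general_alpha_lines_limit[OF assms, where ?'k = 'k] g_root_lines[OF assms]
  by (simp add: general_gamma_def limI)

end
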